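(* Let $F:\mathbb{R}^n\rightrightarrows\mathbb{R}^n$ be an upper semicontinuous set-valued map such that $F(x)$ is nonempty, compact and convex for every $x\in\mathbb{R}^n$, and let $\Sigma:\ \dot x\in F(x)$. Let $X_o,X_u\subset\mathbb{R}^n$ and let $B:\mathbb{R}^n\to\mathbb{R}$ be a barrier function candidate with respect to $(X_o,X_u)$, i.e. $B(x)>0$ for all $x\in X_u$ and $B(x)\le 0$ for all $x\in X_o$. Let $K:=\{x\in\mathbb{R}^n: B(x)\le 0\}$ and let $\partial K$ be its topological boundary. Then $\Sigma$ is uniformly robustly safe with respect to $(X_o,X_u)$ if at least one of the following conditions holds: (1) There exists a constant $\epsilon>0$ such that $K$ is forward invariant for $\Sigma_\epsilon:\ \dot x\in F(x)+\epsilon\mathbb{B}$. (2) $\partial K$ is bounded and there exists a continuous function $\epsilon:\mathbb{R}^n\to\mathbb{R}_{>0}$ such that $K$ is forward invariant for $\Sigma_\epsilon:\ \dot x\in F(x)+\epsilon(x)\mathbb{B}$. (3) $\Sigma$ is robustly safe with respect to $(X_o,X_u)$, and either $\mathbb{R}^n\setminus X_u$ is bounded or $\mathbb{R}^n\setminus X_o$ is bounded. (4) $B$ is continuously differentiable and $$\inf\left\{\frac{\langle\nabla B(x),-\eta\rangle}{|\nabla B(x)|}:\ x\in\partial K,\ \eta\in F(x)\right\}>0.$$ (5) $B$ is locally Lipschitz and $$\inf\left\{\frac{\langle\zeta,-\eta\rangle}{|\zeta|}:\ x\in\partial K,\ \eta\in F(x),\ \zeta\in\partial_C B(x)\right\}>0.$$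 (6) $B$ is lower semicontinuous, $F$ is locally Lipschitz, and there is an open neighborhood $U(\partial K)$ of $\partial K$ such that $$\inf\left\{\frac{\langle\zeta,-\eta\rangle}{|\zeta|}:\ x\in U(\partial K),\ \eta\in F(x),\ \zeta\in\partial_P B(x)\right\}>0.$$ (7) $B$ is upper semicontinuous, $F$ is locally Lipschitz, $\mathrm{cl}(K)\cap X_u=\emptyset$, and there is an open neighborhood $U(\partial K)$ of $\partial K$ such that $$\inf\left\{\frac{\langle\zeta,\eta\rangle}{|\zeta|}:\ x\in U(\partial K),\ \eta\in F(x),\ \zeta\in\partial_P(-B)(x)\right\}>0.$$ In (4)–(7) it is part of the condition that the quotients are well defined, i.e. that the vectors $\nabla B(x)$, respectively $\zeta$, appearing in the denominators are nonzero.
   Context: $|\cdot|$ is the Euclidean norm, $\mathbb{B}\subset\mathbb{R}^n$ is the closed unit ball centered at the origin, $\mathrm{cl}$ denotes closure, and the infimum of the empty set is $+\infty$. A set-valued map $F:\mathbb{R}^n\rightrightarrows\mathbb{R}^n$ is upper semicontinuous if for every $x$ and every $\varepsilon>0$ there is a neighborhood $U(x)$ of $x$ such that $F(y)\subset F(x)+\varepsilon\mathbb{B}$ for all $y\in U(x)$. It is locally Lipschitz if for every nonempty compact set $U$ there is $k>0$ with $F(x_1)\subset F(x_2)+k|x_1-x_2|\mathbb{B}$ for all $x_1,x_2\in U$. A scalar function is locally Lipschitz if it is Lipschitz on every nonempty compact set. Solutions: a solution to $\dot x\in G(x)$ starting from $x_o$ is a locally absolutely continuous map $\phi:\mathrm{dom}\,\phi\to\mathbb{R}^n$,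 where $\mathrm{dom}\,\phi=[0,T]$ with $T\in\mathbb{R}_{\ge0}$ or $\mathrm{dom}\,\phi=[0,T)$ with $T\in\mathbb{R}_{\ge0}\cup\{+\infty\}$, such that $\phi(0)=x_o$ and $\dot\phi(t)\in G(\phi(t))$ for almost all $t\in\mathrm{dom}\,\phi$. A set $K$ is forward invariant for a differential inclusion if every solution $\phi$ starting from $K$ satisfies $\phi(\mathrm{dom}\,\phi)\subset K$. A differential inclusion is safe with respect to $(X_o,X_u)$ if every solution $\phi$ starting from $X_o$ satisfies $\phi(\mathrm{dom}\,\phi)\subset\mathbb{R}^n\setminus X_u$. Robust safety: $\Sigma$ is robustly safe with respect to $(X_o,X_u)$ if there exists a continuous function $\epsilon:\mathbb{R}^n\to\mathbb{R}_{>0}$ such that $\Sigma_\epsilon:\ \dot x\in F(x)+\epsilon(x)\mathbb{B}$ is safe with respect to $(X_o,X_u)$. $\Sigma$ is uniformly robustly safe if this holds with a constant function $\epsilon>0$. The Clarke generalized gradient of a locally Lipschitz $B$ at $x$ is $\partial_C B(x):=\mathrm{co}\{\lim_{i\to\infty}\nabla B(x_i): x_i\to x,\ x_i\notin\Omega\cup\Omega_B\}$, where $\mathrm{co}$ is the convex hull, $\Omega_B$ is the set of points where $B$ is not differentiable, and $\Omega$ is any set of Lebesgue measure zero (the result does not depend on the choice of $\Omega$). The proximal subdifferential of a function $B:\mathbb{R}^n\to\mathbb{R}$ (lower semicontinuous) at $x$ is $\partial_P B(x):=\{\zeta\in\mathbb{R}^n:(\zeta,-1)\in N^P_{\mathrm{epi}\,B}(x,B(x))\}$,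 where $\mathrm{epi}\,B:=\{(x,r)\in\mathbb{R}^n\times\mathbb{R}: r\ge B(x)\}$ and, for a closed set $S\subset\mathbb{R}^{n+1}$ and $y\in S$, $N^P_S(y):=\{\zeta\in\mathbb{R}^{n+1}:\exists r>0 \text{ such that } |y+r\zeta|_S=r|\zeta|\}$, with $|z|_S$ the distance from $z$ to $S$. *)

theory Defs
  imports "HOL-Analysis.Analysis"
begin

section \<open>Set-valued maps and semicontinuity\<close>

text \<open>Sums of sets are Minkowski sums (from \<open>Set_Algebras\<close>); \<open>(*\<^sub>R) r ` cball 0 1\<close> is the
  closed unit ball scaled by \<open>r\<close>.\<close>

definition usc_setmap :: "('a::euclidean_space \<Rightarrow> 'a set) \<Rightarrow> bool" where
  "usc_setmap F \<longleftrightarrow>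
     (\<forall>x. \<forall>\<epsilon>>0. \<exists>U. open U \<and> x \<in> U \<and> (\<forall>y\<in>U. F y \<subseteq> F x + (*\<^sub>R) \<epsilon> ` cball 0 1))"

definition locally_lipschitz_setmap :: "('a::euclidean_space \<Rightarrow> 'a set) \<Rightarrow> bool" where
  "locally_lipschitz_setmap F \<longleftrightarrow>
     (\<forall>U. compact U \<and> U \<noteq> {} \<longrightarrow>
        (\<exists>k>0. \<forall>x1\<in>U. \<forall>x2\<in>U. F x1 \<subseteq> F x2 + (*\<^sub>R) (k * norm (x1 - x2)) ` cball 0 1))"

definition locally_lipschitz_fun :: "('a::euclidean_space \<Rightarrow> real) \<Rightarrow> bool" where
  "locally_lipschitz_fun B \<longleftrightarrow> (\<forall>U. compact U \<and> U \<noteq> {} \<longrightarrow> (\<exists>L. L-lipschitz_on U B))"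

definition lsc_fun :: "('a::topological_space \<Rightarrow> real) \<Rightarrow> bool" where
  "lsc_fun B \<longleftrightarrow> (\<forall>x. \<forall>c < B x. eventually (\<lambda>y. c < B y) (nhds x))"

definition usc_fun :: "('a::topological_space \<Rightarrow> real) \<Rightarrow> bool" where
  "usc_fun B \<longleftrightarrow> (\<forall>x. \<forall>c > B x. eventually (\<lambda>y. B y < c) (nhds x))"


section \<open>Solutions of differential inclusions\<close>

definition absolutely_continuous_on_interval ::
    "real \<Rightarrow> real \<Rightarrow> (real \<Rightarrow> 'a::real_normed_vector) \<Rightarrow> bool" where
  "absolutely_continuous_on_interval a b \<phi> \<longleftrightarrow>
     (\<forall>\<epsilon>>0. \<exists>\<delta>>0. \<forall>I :: (real \<times> real) set.
        finite I \<and> (\<forall>(u, v)\<in>I. a \<le> u \<and> u \<le> v \<and> v \<le> b) \<and>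
        disjoint_family_on (\<lambda>(u, v). {u<..<v}) I \<and> (\<Sum>(u, v)\<in>I. v - u) < \<delta> \<longrightarrow>
        (\<Sum>(u, v)\<in>I. norm (\<phi> v - \<phi> u)) < \<epsilon>)"

definition locally_absolutely_continuous_on ::
    "real set \<Rightarrow> (real \<Rightarrow> 'a::real_normed_vector) \<Rightarrow> bool" where
  "locally_absolutely_continuous_on D \<phi> \<longleftrightarrow>
     (\<forall>a b. a \<le> b \<and> {a..b} \<subseteq> D \<longrightarrow> absolutely_continuous_on_interval a b \<phi>)"

definition solution_domain :: "real set \<Rightarrow> bool" where
  "solution_domain D \<longleftrightarrow> (\<exists>T\<ge>0. D = {0..T}) \<or> (\<exists>T\<ge>0. D = {0..<T}) \<or> D = {0..}"

text \<open>A solution is represented by a total function \<open>\<phi>\<close> together with its domain \<open>D\<close>; the values of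
  \<open>\<phi>\<close> outside \<open>D\<close> are irrelevant. The clause \<open>0 \<in> D\<close> excludes the empty domain \<open>{0..<0}\<close>, for
  which the initial condition would be meaningless.\<close>

definition solution_from ::
    "('a::euclidean_space \<Rightarrow> 'a set) \<Rightarrow> 'a \<Rightarrow> real set \<Rightarrow> (real \<Rightarrow> 'a) \<Rightarrow> bool" where
  "solution_from G x0 D \<phi> \<longleftrightarrow>
     solution_domain D \<and> 0 \<in> D \<and> \<phi> 0 = x0 \<and> locally_absolutely_continuous_on D \<phi> \<and>
     (AE t in lebesgue. t \<in> D \<longrightarrow>
        (\<exists>v. (\<phi> has_vector_derivative v) (at t within D) \<and> v \<in> G (\<phi> t)))"

definition perturbed ::
    "('a::euclidean_space \<Rightarrow> 'a set) \<Rightarrow> ('a \<Rightarrow> real) \<Rightarrow> 'a \<Rightarrow> 'a set" where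
  "perturbed F \<epsilon> x = F x + (*\<^sub>R) (\<epsilon> x) ` cball 0 1"


section \<open>Invariance, safety and barrier function candidates\<close>

definition forward_invariant :: "('a::euclidean_space \<Rightarrow> 'a set) \<Rightarrow> 'a set \<Rightarrow> bool" where
  "forward_invariant G K \<longleftrightarrow> (\<forall>x0\<in>K. \<forall>D \<phi>. solution_from G x0 D \<phi> \<longrightarrow> \<phi> ` D \<subseteq> K)"

definition safe :: "('a::euclidean_space \<Rightarrow> 'a set) \<Rightarrow> 'a set \<Rightarrow> 'a set \<Rightarrow> bool" where
  "safe G Xo Xu \<longleftrightarrow> (\<forall>x0\<in>Xo. \<forall>D \<phi>. solution_from G x0 D \<phi> \<longrightarrow> \<phi> ` D \<subseteq> - Xu)"

definition robustly_safe :: "('a::euclidean_space \<Rightarrow> 'a set) \<Rightarrow> 'a set \<Rightarrow> 'a set \<Rightarrow> bool" where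
  "robustly_safe F Xo Xu \<longleftrightarrow>
     (\<exists>\<epsilon>. continuous_on UNIV \<epsilon> \<and> (\<forall>x. 0 < \<epsilon> x) \<and> safe (perturbed F \<epsilon>) Xo Xu)"

definition uniformly_robustly_safe ::
    "('a::euclidean_space \<Rightarrow> 'a set) \<Rightarrow> 'a set \<Rightarrow> 'a set \<Rightarrow> bool" where
  "uniformly_robustly_safe F Xo Xu \<longleftrightarrow> (\<exists>\<epsilon>>0. safe (perturbed F (\<lambda>_. \<epsilon>)) Xo Xu)"

definition barrier_candidate :: "('a \<Rightarrow> real) \<Rightarrow> 'a set \<Rightarrow> 'a set \<Rightarrow> bool" where
  "barrier_candidate B Xo Xu \<longleftrightarrow> (\<forall>x\<in>Xu. 0 < B x) \<and> (\<forall>x\<in>Xo. B x \<le> 0)"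


section \<open>Gradients and generalized gradients\<close>

text \<open>\<open>grad B x\<close> is meaningful only at points where \<open>B\<close> is differentiable.\<close>

definition grad :: "('a::euclidean_space \<Rightarrow> real) \<Rightarrow> 'a \<Rightarrow> 'a" where
  "grad B x = (THE g. GDERIV B x :> g)"

definition continuously_differentiable :: "('a::euclidean_space \<Rightarrow> real) \<Rightarrow> bool" where
  "continuously_differentiable B \<longleftrightarrow>
     (\<forall>x. B differentiable (at x)) \<and> continuous_on UNIV (grad B)"

text \<open>The parameter \<open>\<Omega>\<close> is the Lebesgue null set that is disregarded, in addition to the points of
  non-differentiability, in the definition of the Clarke generalized gradient.\<close>

definition clarke_gradient ::
    "'a::euclidean_space set \<Rightarrow> ('a \<Rightarrow> real) \<Rightarrow> 'a \<Rightarrow> 'a set" where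
  "clarke_gradient \<Omega> B x =
     convex hull {g. \<exists>X. X \<longlonglongrightarrow> x \<and> (\<forall>i. X i \<notin> \<Omega> \<union> {y. \<not> B differentiable (at y)}) \<and>
                         (\<lambda>i::nat. grad B (X i)) \<longlonglongrightarrow> g}"

definition proximal_normal_cone :: "'b::euclidean_space set \<Rightarrow> 'b \<Rightarrow> 'b set" where
  "proximal_normal_cone S y = {\<zeta>. \<exists>r>0. infdist (y + r *\<^sub>R \<zeta>) S = r * norm \<zeta>}"

definition proximal_subdifferential :: "('a::euclidean_space \<Rightarrow> real) \<Rightarrow> 'a \<Rightarrow> 'a set" where
  "proximal_subdifferential B x =
     {\<zeta>. (\<zeta>, -1) \<in> proximal_normal_cone (epigraph UNIV B) (x, B x)}"

end

theory Submission
  imports Defs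
begin

text \<open>Each condition is reduced to the invariance of \<open>K\<close>, or the safety of \<open>Xo\<close>, under a constant
  perturbation. Invariance is a local matter at the frontier of \<open>K\<close>: a solution that leaves \<open>K\<close> passes
  through a frontier point \<open>x\<close>, and has short arcs near \<open>x\<close> that start in \<open>K\<close> and end outside. Under
  (2) a lower bound for \<open>\<epsilon>\<close> near the bounded frontier suffices; under (3) the safety assumption is
  applied up to the first, or from the last, visit to the outside of a large ball. Under (4) to (7) half
  of a lower bound of the quotients serves as the perturbation, and \<open>B\<close> is nonincreasing along the short
  arcs. For the proximal conditions this is proved for the Moreau envelope of \<open>B\<close> (in backward time for
  \<open>- B\<close>), where the Lipschitz continuity of \<open>F\<close> moves velocities from a point to the minimiser that
  defines its envelope. For the Clarke gradient the strict inequality extends to a neighbourhood by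
  compactness, and integrating the almost everywhere gradient given by Rademacher's theorem along almost
  all parallel segments yields \<open>B (x + h v) \<le> B x\<close>.\<close>

section \<open>Absolutely continuous functions\<close>

text \<open>The functions that must decrease along a solution (an envelope, or \<open>B\<close>
  itself) are Lipschitz but may fail to be differentiable along the whole curve, so no chain rule
  applies. Monotonicity is therefore tested by
  \<open>g (z + h *\<^sub>R v) \<le> g z + e * h\<close> for every \<open>z\<close> near
  \<open>\<phi> t\<close>, with \<open>v\<close> the velocity at \<open>t\<close>. Averaging over
  parallel segments and freezing a minimiser both give this form, and it suffices for a covering
  argument with arcs around \<open>t\<close>. If the quotients are at least \<open>c\<close>, a
  velocity from \<open>F x\<close> plus a vector of norm at most \<open>c / 2\<close> still
  satisfies \<open>inner \<zeta> v \<le> - (c / 2) * norm \<zeta>\<close>. The remaining margin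
  makes the Clarke inequality strict and pays for the error \<open>k * dist x y\<close> in the
  proximal cases. \<open>K\<close> need be neither open nor closed, so an exit is described by arcs
  from \<open>K\<close> to its complement and not by a last point in \<open>K\<close>. In
  Rademacher's theorem, additivity of directional derivatives is tested on indicators of boxes: a
  translation moves from the function to the box, whose frontier is null.\<close>

lemma AE_lebesgue_iff_negligible: "(AE x in lebesgue. P x) \<longleftrightarrow> negligible {x. \<not> P x}"
  unfolding eventually_ae_filter negligible_iff_null_sets
  by (auto intro: null_sets_completion_subset)

lemma sum_length_disjoint_intervals_le:
  fixes I :: "(real \<times> real) set"
  assumes I: "finite I" "\<And>x y. (x, y) \<in> I \<Longrightarrow> x \<le> y \<and> {x<..<y} \<subseteq> T"
    and disj: "disjoint_family_on (\<lambda>(x, y). {x<..<y}) I"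
    and T: "T \<in> lmeasurable"
  shows "(\<Sum>(x, y)\<in>I. y - x) \<le> measure lebesgue T"
proof -
  have "(\<Sum>(x, y)\<in>I. y - x) = (\<Sum>i\<in>I. measure lebesgue ((\<lambda>(x, y). {x<..<y}) i))"
    using I by (intro sum.cong) auto
  also have "\<dots> = measure lebesgue (\<Union>i\<in>I. (\<lambda>(x, y). {x<..<y}) i)"
    using I disj by (intro measure_finite_Union[symmetric]) auto
  also have "\<dots> \<le> measure lebesgue T"
    using I T by (intro measure_mono_fmeasurable) auto
  finally show ?thesis .
qed

text \<open>The interval is cut into pieces of two kinds. Near a point outside \<open>E\<close>,
  \<open>loc\<close> bounds the increment over any interval around that point. Near a point of
  \<open>E\<close>, the piece lies in an open set so small that absolute continuity bounds the sum
  of all such increments at once.\<close>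

lemma absolutely_continuous_nonincreasing:
  fixes g :: "real \<Rightarrow> real"
  assumes ab: "a \<le> b" and ac: "absolutely_continuous_on_interval a b g"
    and E: "negligible E"
    and loc: "\<And>t e. t \<in> {a..b} \<Longrightarrow> t \<notin> E \<Longrightarrow> e > 0 \<Longrightarrow>
      \<exists>d>0. \<forall>u v. a \<le> u \<and> u \<le> t \<and> t \<le> v \<and> v \<le> b \<and> v - u < d \<longrightarrow> g v - g u \<le> e * (v - u)"
  shows "g b \<le> g a"
proof (rule field_le_epsilon)
  fix e :: real assume e: "e > 0"
  \<comment> \<open>One half of \<open>e\<close> is spread over \<open>{a..b}\<close>, the other is
    kept for the pieces near \<open>E\<close>; the summand 1 covers \<open>a = b\<close>.\<close>
  define e1 where "e1 = e / 2 / (b - a + 1)"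
  have e1: "e1 > 0" "e1 * (b - a) \<le> e / 2"
    using e ab by (auto simp: e1_def field_simps)
  obtain \<delta> where \<delta>: "\<delta> > 0" and ac': "\<And>I :: (real \<times> real) set. finite I \<Longrightarrow>
      (\<forall>(u, v)\<in>I. a \<le> u \<and> u \<le> v \<and> v \<le> b) \<Longrightarrow> disjoint_family_on (\<lambda>(u, v). {u<..<v}) I \<Longrightarrow>
      (\<Sum>(u, v)\<in>I. v - u) < \<delta> \<Longrightarrow> (\<Sum>(u, v)\<in>I. norm (g v - g u)) < e / 2"
    using ac[unfolded absolutely_continuous_on_interval_def, rule_format, of "e / 2"] e by auto
  have "E \<in> sets lebesgue" using E by (rule negligible_imp_sets)
  then obtain T where T: "open T" "E \<subseteq> T" "T - E \<in> lmeasurable"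
      "emeasure lebesgue (T - E) < ennreal \<delta>"
    using sets_lebesgue_outer_open[of E \<delta>] \<delta> by blast
  have Tm: "T \<in> lmeasurable"
    using fmeasurable.Un[OF T(3) negligible_imp_measurable[OF E]] T(2) by (simp add: Un_absorb2)
  have "measure lebesgue T \<le> measure lebesgue (T - E) + measure lebesgue E"
    using measure_Un_le[of "T - E" lebesgue E] T E \<open>E \<in> sets lebesgue\<close> by (simp add: Un_absorb2)
  also have "\<dots> < \<delta>"
    using T(3,4) E \<delta> by (simp add: negligible_imp_measure0 emeasure_eq_measure2 ennreal_less_iff)
  finally have mT: "measure lebesgue T < \<delta>" .
  \<comment> \<open>The increment is charged partly to length and partly to finitely many disjoint
    intervals inside \<open>T\<close>. This survives concatenation, so bisection reduces it to short
    intervals around each point. The strict \<open>x < y\<close> keeps the families of two adjacent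
    intervals disjoint, so that their sums add.\<close>
  let ?P = "\<lambda>u v. a \<le> u \<and> v \<le> b \<longrightarrow> (\<exists>I. finite I \<and>
      (\<forall>(x, y)\<in>I. u \<le> x \<and> x < y \<and> y \<le> v \<and> {x<..<y} \<subseteq> T) \<and>
      disjoint_family_on (\<lambda>(x, y). {x<..<y}) I \<and>
      g v - g u \<le> e1 * (v - u) + (\<Sum>(x, y)\<in>I. norm (g y - g x)))"
  have "?P a b"
  proof (rule Bolzano[where P = ?P, OF ab])
    fix u m v assume 1: "?P u m" and 2: "?P m v" and le: "u \<le> m" "m \<le> v"
    show "?P u v"
    proof
      assume *: "a \<le> u \<and> v \<le> b"
      obtain I where I: "finite I" "\<forall>(x, y)\<in>I. u \<le> x \<and> x < y \<and> y \<le> m \<and> {x<..<y} \<subseteq> T"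
        "disjoint_family_on (\<lambda>(x, y). {x<..<y}) I"
        "g m - g u \<le> e1 * (m - u) + (\<Sum>(x, y)\<in>I. norm (g y - g x))"
        using 1 * le by auto
      obtain J where J: "finite J" "\<forall>(x, y)\<in>J. m \<le> x \<and> x < y \<and> y \<le> v \<and> {x<..<y} \<subseteq> T"
        "disjoint_family_on (\<lambda>(x, y). {x<..<y}) J"
        "g v - g m \<le> e1 * (v - m) + (\<Sum>(x, y)\<in>J. norm (g y - g x))"
        using 2 * le by auto
      have IJ: "I \<inter> J = {}" using I(2) J(2) by fastforce
      show "\<exists>I. finite I \<and>
      (\<forall>(x, y)\<in>I. u \<le> x \<and> x < y \<and> y \<le> v \<and> {x<..<y} \<subseteq> T) \<and>
      disjoint_family_on (\<lambda>(x, y). {x<..<y}) I \<and>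
      g v - g u \<le> e1 * (v - u) + (\<Sum>(x, y)\<in>I. norm (g y - g x))"
      proof (intro exI[of _ "I \<union> J"] conjI)
        show "\<forall>(x, y)\<in>I \<union> J. u \<le> x \<and> x < y \<and> y \<le> v \<and> {x<..<y} \<subseteq> T"
          using I(2) J(2) le by fastforce
        have "(\<lambda>(x, y). {x<..<y}) i \<inter> (\<lambda>(x, y). {x<..<y}) j = {}" if "i \<in> I" "j \<in> J" for i j
          using I(2) J(2) that by fastforce
        then show "disjoint_family_on (\<lambda>(x, y). {x<..<y}) (I \<union> J)"
          using I(3) J(3) unfolding disjoint_family_on_def by blast
        show "g v - g u \<le> e1 * (v - u) + (\<Sum>(x, y)\<in>I \<union> J. norm (g y - g x))"
          using I(4) J(4) by (simp add: sum.union_disjoint[OF I(1) J(1) IJ] algebra_simps)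
      qed (use I J in auto)
    qed
  next
    fix t assume t: "a \<le> t" "t \<le> b"
    show "\<exists>d>0. \<forall>u v. u \<le> t \<and> t \<le> v \<and> v - u < d \<longrightarrow> ?P u v"
    proof (cases "t \<in> E")
      case False
      then obtain d where d: "d > 0" "\<And>u v. a \<le> u \<Longrightarrow> u \<le> t \<Longrightarrow> t \<le> v \<Longrightarrow> v \<le> b \<Longrightarrow> v - u < d \<Longrightarrow>
          g v - g u \<le> e1 * (v - u)"
        using loc[of t e1] t e1 by fastforce
      show ?thesis
        by (intro exI[of _ d] conjI d(1) allI impI exI[of _ "{}"])
           (use d(2) in \<open>auto simp: disjoint_family_on_def\<close>)
    next
      case True
      then obtain d where d: "d > 0" "cball t d \<subseteq> T"
        using T(1,2) by (meson open_contains_cball subsetD)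
      have "?P u v" if uv: "u \<le> t" "t \<le> v" "v - u < d" for u v
      proof (cases "u = v")
        case False
        have "{u<..<v} \<subseteq> T"
          using d(2) uv by (intro order_trans[OF _ d(2)]) (auto simp: dist_real_def)
        moreover have "g v - g u \<le> e1 * (v - u) + norm (g v - g u)"
          using e1(1) uv abs_ge_self[of "g v - g u"] mult_nonneg_nonneg[of e1 "v - u"]
          by (simp only: real_norm_def) linarith
        ultimately show ?thesis
          using uv False by (intro impI exI[of _ "{(u, v)}"]) (simp add: disjoint_family_on_def)
      qed (auto intro!: exI[of _ "{}"] simp: disjoint_family_on_def)
      then show ?thesis using d(1) by blast
    qed
  qed
  then obtain I where I: "finite I" "\<forall>(x, y)\<in>I. a \<le> x \<and> x < y \<and> y \<le> b \<and> {x<..<y} \<subseteq> T"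
      "disjoint_family_on (\<lambda>(x, y). {x<..<y}) I"
      "g b - g a \<le> e1 * (b - a) + (\<Sum>(x, y)\<in>I. norm (g y - g x))"
    by auto
  have "(\<Sum>(x, y)\<in>I. y - x) \<le> measure lebesgue T"
    using I Tm by (intro sum_length_disjoint_intervals_le) (auto intro: less_imp_le)
  then have "(\<Sum>(x, y)\<in>I. norm (g y - g x)) < e / 2"
    using I mT by (intro ac') (auto intro: less_imp_le)
  then show "g b \<le> g a + e" using I(4) e1(2) by linarith
qed

lemma absolutely_continuous_imp_continuous_on:
  assumes "absolutely_continuous_on_interval a b \<phi>"
  shows "continuous_on {a..b} \<phi>"
  unfolding continuous_on_iff
proof (intro ballI allI impI)
  fix x e :: real assume x: "x \<in> {a..b}" and e: "e > 0"
  obtain d where d: "d > 0" and ac: "\<And>I :: (real \<times> real) set. finite I \<Longrightarrow>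
      (\<forall>(u, v)\<in>I. a \<le> u \<and> u \<le> v \<and> v \<le> b) \<Longrightarrow> disjoint_family_on (\<lambda>(u, v). {u<..<v}) I \<Longrightarrow>
      (\<Sum>(u, v)\<in>I. v - u) < d \<Longrightarrow> (\<Sum>(u, v)\<in>I. norm (\<phi> v - \<phi> u)) < e"
    using assms[unfolded absolutely_continuous_on_interval_def, rule_format, OF e] by auto
  have 1: "norm (\<phi> v - \<phi> u) < e" if "a \<le> u" "u \<le> v" "v \<le> b" "v - u < d" for u v
    using ac[of "{(u, v)}"] that by (simp add: disjoint_family_on_def)
  have "dist (\<phi> y) (\<phi> x) < e" if "y \<in> {a..b}" "dist y x < d" for y
    using 1[of x y] 1[of y x] x that
    by (cases "x \<le> y") (auto simp: dist_norm norm_minus_commute)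
  then show "\<exists>d>0. \<forall>x'\<in>{a..b}. dist x' x < d \<longrightarrow> dist (\<phi> x') (\<phi> x) < e"
    using d by blast
qed

lemma absolutely_continuous_lipschitz_compose:
  fixes g :: "'a::real_normed_vector \<Rightarrow> 'b::real_normed_vector"
  assumes ac: "absolutely_continuous_on_interval a b \<phi>"
    and g: "L-lipschitz_on W g" and W: "\<phi> ` {a..b} \<subseteq> W"
  shows "absolutely_continuous_on_interval a b (\<lambda>t. g (\<phi> t))"
  unfolding absolutely_continuous_on_interval_def
proof (intro allI impI)
  fix e :: real assume e: "e > 0"
  have L: "L \<ge> 0" using g by (rule lipschitz_on_nonneg)
  \<comment> \<open>\<open>L + 1\<close> in place of \<open>L\<close> keeps the division meaningful
    for \<open>L = 0\<close>.\<close>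
  obtain d where d: "d > 0" and ac: "\<And>I :: (real \<times> real) set. finite I \<Longrightarrow>
      (\<forall>(u, v)\<in>I. a \<le> u \<and> u \<le> v \<and> v \<le> b) \<Longrightarrow> disjoint_family_on (\<lambda>(u, v). {u<..<v}) I \<Longrightarrow>
      (\<Sum>(u, v)\<in>I. v - u) < d \<Longrightarrow> (\<Sum>(u, v)\<in>I. norm (\<phi> v - \<phi> u)) < e / (L + 1)"
    using ac[unfolded absolutely_continuous_on_interval_def, rule_format, of "e / (L + 1)"] e L by auto
  have "(\<Sum>(u, v)\<in>I. norm (g (\<phi> v) - g (\<phi> u))) < e"
    if I: "finite I" "\<forall>(u, v)\<in>I. a \<le> u \<and> u \<le> v \<and> v \<le> b"
      "disjoint_family_on (\<lambda>(u, v). {u<..<v}) I" "(\<Sum>(u, v)\<in>I. v - u) < d" for I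
  proof -
    have "(\<Sum>(u, v)\<in>I. norm (g (\<phi> v) - g (\<phi> u))) \<le> (\<Sum>(u, v)\<in>I. (L + 1) * norm (\<phi> v - \<phi> u))"
    proof (intro sum_mono, clarify)
      fix u v assume "(u, v) \<in> I"
      then have "a \<le> u \<and> u \<le> v \<and> v \<le> b" using I(2) by auto
      then have "\<phi> u \<in> W" "\<phi> v \<in> W" using W by auto
      then have "norm (g (\<phi> v) - g (\<phi> u)) \<le> L * norm (\<phi> v - \<phi> u)"
        using lipschitz_onD[OF g] by (simp add: dist_norm)
      then show "norm (g (\<phi> v) - g (\<phi> u)) \<le> (L + 1) * norm (\<phi> v - \<phi> u)"
        by (simp add: distrib_right add_increasing2)
    qed
    also have "\<dots> = (L + 1) * (\<Sum>(u, v)\<in>I. norm (\<phi> v - \<phi> u))"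
      by (simp add: sum_distrib_left case_prod_unfold)
    also have "\<dots> < (L + 1) * (e / (L + 1))"
      using ac[OF I] L by (intro mult_strict_left_mono) auto
    finally show ?thesis using L by simp
  qed
  then show "\<exists>\<delta>>0. \<forall>I. finite I \<and> (\<forall>(u, v)\<in>I. a \<le> u \<and> u \<le> v \<and> v \<le> b) \<and>
        disjoint_family_on (\<lambda>(u, v). {u<..<v}) I \<and> (\<Sum>(u, v)\<in>I. v - u) < \<delta> \<longrightarrow>
        (\<Sum>(u, v)\<in>I. norm (g (\<phi> v) - g (\<phi> u))) < e"
    using d by blast
qed

text \<open>An arc from \<open>\<phi> x\<close> to \<open>\<phi> y\<close> with
  \<open>x \<le> t \<le> y\<close> is compared with the straight motion from \<open>\<phi> x\<close>
  with the velocity \<open>v\<close> at \<open>t\<close> during the time \<open>y - x\<close>.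
  Differentiability at \<open>t\<close> makes the endpoints differ by a small multiple of
  \<open>y - x\<close>, and the Lipschitz constant turns this into a small change of
  \<open>g\<close>. The straight motion starts at \<open>\<phi> x\<close>, which is why
  \<open>der\<close> speaks of all base points near \<open>\<phi> t\<close>.\<close>

lemma lipschitz_nonincreasing_along_curve:
  fixes \<phi> :: "real \<Rightarrow> 'a::euclidean_space" and g :: "'a \<Rightarrow> real"
  assumes ab: "a \<le> b" and ac: "absolutely_continuous_on_interval a b \<phi>"
    and W: "open W" "\<phi> ` {a..b} \<subseteq> W" and g: "L-lipschitz_on W g"
    and E: "negligible E"
    and der: "\<And>t. t \<in> {a..b} \<Longrightarrow> t \<notin> E \<Longrightarrow> \<exists>v. (\<phi> has_vector_derivative v) (at t within {a..b}) \<and>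
      (\<forall>e>0. \<exists>d>0. \<forall>z h. dist z (\<phi> t) < d \<longrightarrow> 0 \<le> h \<longrightarrow> h < d \<longrightarrow> g (z + h *\<^sub>R v) \<le> g z + e * h)"
  shows "g (\<phi> b) \<le> g (\<phi> a)"
proof (rule absolutely_continuous_nonincreasing[OF ab absolutely_continuous_lipschitz_compose[OF ac g W(2)] E])
  fix t e :: real assume t: "t \<in> {a..b}" "t \<notin> E" and e: "e > 0"
  have L: "L \<ge> 0" using g by (rule lipschitz_on_nonneg)
  obtain v where v: "(\<phi> has_vector_derivative v) (at t within {a..b})"
    and vg: "\<And>e. e > 0 \<Longrightarrow> \<exists>d>0. \<forall>z h. dist z (\<phi> t) < d \<longrightarrow> 0 \<le> h \<longrightarrow> h < d \<longrightarrow> g (z + h *\<^sub>R v) \<le> g z + e * h"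
    using der[OF t] by blast
  obtain d1 where d1: "d1 > 0" "\<And>z h. dist z (\<phi> t) < d1 \<Longrightarrow> 0 \<le> h \<Longrightarrow> h < d1 \<Longrightarrow>
      g (z + h *\<^sub>R v) \<le> g z + e / 2 * h"
    using vg[of "e / 2"] e by auto
  define e1 where "e1 = e / (2 * (L + 1))"
  have e1: "e1 > 0" "L * e1 \<le> e / 2" using e L by (auto simp: e1_def field_simps)
  have "\<exists>d>0. \<forall>y\<in>{a..b}. norm (y - t) < d \<longrightarrow>
      norm (\<phi> y - \<phi> t - (y - t) *\<^sub>R v) \<le> e1 * norm (y - t)"
    using v e1 unfolding has_vector_derivative_def has_derivative_within_alt by blast
  then obtain d2 where d2: "d2 > 0" "\<And>y. y \<in> {a..b} \<Longrightarrow> \<bar>y - t\<bar> < d2 \<Longrightarrow>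
      norm (\<phi> y - \<phi> t - (y - t) *\<^sub>R v) \<le> e1 * \<bar>y - t\<bar>"
    by (auto simp: real_norm_def)
  have "\<phi> t \<in> W" using W t by auto
  then obtain r where r: "r > 0" "ball (\<phi> t) r \<subseteq> W"
    using W(1) open_contains_ball by blast
  have "\<exists>d>0. \<forall>y\<in>{a..b}. dist y t < d \<longrightarrow> dist (\<phi> y) (\<phi> t) < min d1 (r / 2)"
    using absolutely_continuous_imp_continuous_on[OF ac] t d1(1) r(1)
    unfolding continuous_on_iff by (metis half_gt_zero min_less_iff_conj)
  then obtain d3 where d3: "d3 > 0" "\<And>y. y \<in> {a..b} \<Longrightarrow> \<bar>y - t\<bar> < d3 \<Longrightarrow>
      dist (\<phi> y) (\<phi> t) < min d1 (r / 2)"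
    by (auto simp: dist_real_def)
  \<comment> \<open>Keeps the endpoint of the straight motion within \<open>r\<close> of
    \<open>\<phi> t\<close>, hence in \<open>W\<close>, where \<open>g\<close> is Lipschitz; the
    other half of \<open>r\<close> is used up by \<open>\<phi> x\<close>.\<close>
  define d4 where "d4 = r / (2 * (norm v + 1))"
  have d4: "d4 > 0" "d4 * norm v < r / 2"
  proof -
    show "d4 > 0" using r(1) by (auto simp: d4_def intro!: divide_pos_pos add_nonneg_pos)
    then have "d4 * norm v < d4 * (norm v + 1)" by simp
    also have "\<dots> = r / 2"
      using norm_ge_zero[of v] unfolding d4_def by (simp add: field_simps add_nonneg_eq_0_iff)
    finally show "d4 * norm v < r / 2" .
  qed
  have "g (\<phi> y) - g (\<phi> x) \<le> e * (y - x)"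
    if xy: "a \<le> x" "x \<le> t" "t \<le> y" "y \<le> b" "y - x < min (min d1 d2) (min d3 d4)" for x y
  proof -
    let ?z = "\<phi> x + (y - x) *\<^sub>R v"
    have x: "dist (\<phi> x) (\<phi> t) < min d1 (r / 2)" and y: "dist (\<phi> y) (\<phi> t) < min d1 (r / 2)"
      using d3(2)[of x] d3(2)[of y] xy by auto
    have "norm ((y - x) *\<^sub>R v) \<le> d4 * norm v"
      using xy by (simp add: mult_right_mono)
    then have "dist (\<phi> t) ?z < r"
      using x d4(2) norm_triangle_ineq[of "\<phi> x - \<phi> t" "(y - x) *\<^sub>R v"]
      by (simp add: dist_norm norm_minus_commute algebra_simps)
    then have z: "?z \<in> W" using r(2) by auto
    have yW: "\<phi> y \<in> W" using W(2) xy by auto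
    \<comment> \<open>Both ends are expanded at \<open>t\<close>; as \<open>t\<close> lies between
      \<open>x\<close> and \<open>y\<close>, the two errors add up to
      \<open>e1 * (y - x)\<close>.\<close>
    have "\<phi> y - ?z = (\<phi> y - \<phi> t - (y - t) *\<^sub>R v) - (\<phi> x - \<phi> t - (x - t) *\<^sub>R v)"
      by (simp add: algebra_simps)
    then have "norm (\<phi> y - ?z) \<le> norm (\<phi> y - \<phi> t - (y - t) *\<^sub>R v) + norm (\<phi> x - \<phi> t - (x - t) *\<^sub>R v)"
      by (metis norm_triangle_ineq4)
    also have "\<dots> \<le> e1 * \<bar>y - t\<bar> + e1 * \<bar>x - t\<bar>"
      using d2(2)[of x] d2(2)[of y] xy by (intro add_mono) auto
    also have "\<dots> = e1 * (y - x)" using xy by (simp add: algebra_simps)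
    finally have n: "norm (\<phi> y - ?z) \<le> e1 * (y - x)" .
    have "g (\<phi> y) - g ?z \<le> L * norm (\<phi> y - ?z)"
      using lipschitz_onD[OF g yW z] by (simp add: dist_norm)
    also have "\<dots> \<le> L * (e1 * (y - x))" using n L by (rule mult_left_mono)
    also have "\<dots> \<le> e / 2 * (y - x)"
      using mult_right_mono[OF e1(2), of "y - x"] xy by (simp add: mult.assoc)
    finally have "g (\<phi> y) - g ?z \<le> e / 2 * (y - x)" .
    moreover have "g ?z \<le> g (\<phi> x) + e / 2 * (y - x)"
      using d1(2)[of "\<phi> x" "y - x"] x xy by auto
    ultimately show ?thesis by simp
  qed
  then show "\<exists>d>0. \<forall>u v. a \<le> u \<and> u \<le> t \<and> t \<le> v \<and> v \<le> b \<and> v - u < d \<longrightarrow>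
      g (\<phi> v) - g (\<phi> u) \<le> e * (v - u)"
    using d1(1) d2(1) d3(1) d4(1) by (intro exI[of _ "min (min d1 d2) (min d3 d4)"]) auto
qed

section \<open>Solutions and local invariance\<close>

lemma solution_domain_interval:
  assumes "solution_domain D" "s \<in> D" "u \<in> D" "s \<le> t" "t \<le> u"
  shows "t \<in> D"
  using assms unfolding solution_domain_def by auto

lemma solution_domain_nonneg:
  assumes "solution_domain D" "s \<in> D"
  shows "0 \<le> s"
  using assms unfolding solution_domain_def by auto

lemma solution_domain_atLeastAtMost: "0 \<le> T \<Longrightarrow> solution_domain {0..T}"
  unfolding solution_domain_def by auto

text \<open>The shift restarts a solution at a later time; the reflection is for solutions run
  backwards.\<close>

lemma absolutely_continuous_affine:
  assumes ac: "absolutely_continuous_on_interval a b \<phi>"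
  shows "absolutely_continuous_on_interval (a - s) (b - s) (\<lambda>t. \<phi> (s + t))"
    and "absolutely_continuous_on_interval (s - b) (s - a) (\<lambda>t. \<phi> (s - t))"
proof -
  show "absolutely_continuous_on_interval (a - s) (b - s) (\<lambda>t. \<phi> (s + t))"
    unfolding absolutely_continuous_on_interval_def
  proof (intro allI impI)
    fix e :: real assume "e > 0"
    with ac obtain d where d: "d > 0" and ac': "\<And>I :: (real \<times> real) set. finite I \<Longrightarrow>
      (\<forall>(u, v)\<in>I. a \<le> u \<and> u \<le> v \<and> v \<le> b) \<Longrightarrow> disjoint_family_on (\<lambda>(u, v). {u<..<v}) I \<Longrightarrow>
      (\<Sum>(u, v)\<in>I. v - u) < d \<Longrightarrow> (\<Sum>(u, v)\<in>I. norm (\<phi> v - \<phi> u)) < e"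
      unfolding absolutely_continuous_on_interval_def by (metis (lifting))
    have "(\<Sum>(u, v)\<in>I. norm (\<phi> (s + v) - \<phi> (s + u))) < e"
      if I: "finite I" "\<forall>(u, v)\<in>I. a - s \<le> u \<and> u \<le> v \<and> v \<le> b - s"
        "disjoint_family_on (\<lambda>(u, v). {u<..<v}) I" "(\<Sum>(u, v)\<in>I. v - u) < d" for I
    proof -
      let ?f = "\<lambda>(u, v). (s + u, s + v)"
      have inj: "inj_on ?f I" by (auto simp: inj_on_def)
      have "(\<Sum>(u, v)\<in>?f ` I. norm (\<phi> v - \<phi> u)) < e"
      proof (rule ac')
        show "disjoint_family_on (\<lambda>(u, v). {u<..<v}) (?f ` I)"
          unfolding disjoint_family_on_def
        proof (intro ballI impI equals0I)
          fix i j z assume ij: "i \<in> ?f ` I" "j \<in> ?f ` I" "i \<noteq> j"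
            and z: "z \<in> (case i of (u, v) \<Rightarrow> {u<..<v}) \<inter> (case j of (u, v) \<Rightarrow> {u<..<v})"
          obtain x1 y1 x2 y2 where 1: "(x1, y1) \<in> I" "(x2, y2) \<in> I"
              and i: "i = (s + x1, s + y1)" and j: "j = (s + x2, s + y2)"
            using ij(1,2) by auto
          have "(x1, y1) \<noteq> (x2, y2)" using i j ij(3) by auto
          then have "{x1<..<y1} \<inter> {x2<..<y2} = {}"
            using I(3)[unfolded disjoint_family_on_def, rule_format, OF 1] by auto
          moreover have "z - s \<in> {x1<..<y1} \<inter> {x2<..<y2}"
            using z unfolding i j by auto
          ultimately show False by blast
        qed
        show "(\<Sum>(u, v)\<in>?f ` I. v - u) < d"
          using I(4) unfolding sum.reindex[OF inj] by (simp add: o_def case_prod_unfold)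
      qed (use I in auto)
      then show ?thesis unfolding sum.reindex[OF inj] by (simp add: o_def case_prod_unfold)
    qed
    then show "\<exists>\<delta>>0. \<forall>I. finite I \<and> (\<forall>(u, v)\<in>I. a - s \<le> u \<and> u \<le> v \<and> v \<le> b - s) \<and>
        disjoint_family_on (\<lambda>(u, v). {u<..<v}) I \<and> (\<Sum>(u, v)\<in>I. v - u) < \<delta> \<longrightarrow>
        (\<Sum>(u, v)\<in>I. norm (\<phi> (s + v) - \<phi> (s + u))) < e"
      using d by blast
  qed
next
  show "absolutely_continuous_on_interval (s - b) (s - a) (\<lambda>t. \<phi> (s - t))"
    unfolding absolutely_continuous_on_interval_def
  proof (intro allI impI)
    fix e :: real assume "e > 0"
    with ac obtain d where d: "d > 0" and ac': "\<And>I :: (real \<times> real) set. finite I \<Longrightarrow>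
      (\<forall>(u, v)\<in>I. a \<le> u \<and> u \<le> v \<and> v \<le> b) \<Longrightarrow> disjoint_family_on (\<lambda>(u, v). {u<..<v}) I \<Longrightarrow>
      (\<Sum>(u, v)\<in>I. v - u) < d \<Longrightarrow> (\<Sum>(u, v)\<in>I. norm (\<phi> v - \<phi> u)) < e"
      unfolding absolutely_continuous_on_interval_def by (metis (lifting))
    have "(\<Sum>(u, v)\<in>I. norm (\<phi> (s - v) - \<phi> (s - u))) < e"
      if I: "finite I" "\<forall>(u, v)\<in>I. s - b \<le> u \<and> u \<le> v \<and> v \<le> s - a"
        "disjoint_family_on (\<lambda>(u, v). {u<..<v}) I" "(\<Sum>(u, v)\<in>I. v - u) < d" for I
    proof -
      let ?f = "\<lambda>(u, v). (s - v, s - u)"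
      have inj: "inj_on ?f I" by (auto simp: inj_on_def)
      have "(\<Sum>(u, v)\<in>?f ` I. norm (\<phi> v - \<phi> u)) < e"
      proof (rule ac')
        show "disjoint_family_on (\<lambda>(u, v). {u<..<v}) (?f ` I)"
          unfolding disjoint_family_on_def
        proof (intro ballI impI equals0I)
          fix i j z assume ij: "i \<in> ?f ` I" "j \<in> ?f ` I" "i \<noteq> j"
            and z: "z \<in> (case i of (u, v) \<Rightarrow> {u<..<v}) \<inter> (case j of (u, v) \<Rightarrow> {u<..<v})"
          obtain x1 y1 x2 y2 where 1: "(x1, y1) \<in> I" "(x2, y2) \<in> I"
              and i: "i = (s - y1, s - x1)" and j: "j = (s - y2, s - x2)"
            using ij(1,2) by auto
          have "(x1, y1) \<noteq> (x2, y2)" using i j ij(3) by auto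
          then have "{x1<..<y1} \<inter> {x2<..<y2} = {}"
            using I(3)[unfolded disjoint_family_on_def, rule_format, OF 1] by auto
          moreover have "s - z \<in> {x1<..<y1} \<inter> {x2<..<y2}"
            using z unfolding i j by auto
          ultimately show False by blast
        qed
        show "(\<Sum>(u, v)\<in>?f ` I. v - u) < d"
          using I(4) unfolding sum.reindex[OF inj] by (simp add: o_def case_prod_unfold)
      qed (use I in auto)
      then show ?thesis
        unfolding sum.reindex[OF inj] by (simp add: o_def case_prod_unfold norm_minus_commute)
    qed
    then show "\<exists>\<delta>>0. \<forall>I. finite I \<and> (\<forall>(u, v)\<in>I. s - b \<le> u \<and> u \<le> v \<and> v \<le> s - a) \<and>
        disjoint_family_on (\<lambda>(u, v). {u<..<v}) I \<and> (\<Sum>(u, v)\<in>I. v - u) < \<delta> \<longrightarrow>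
        (\<Sum>(u, v)\<in>I. norm (\<phi> (s - v) - \<phi> (s - u))) < e"
      using d by blast
  qed
qed

lemma absolutely_continuous_on_subinterval:
  assumes "absolutely_continuous_on_interval a b \<phi>" "a \<le> c" "d \<le> b"
  shows "absolutely_continuous_on_interval c d \<phi>"
  unfolding absolutely_continuous_on_interval_def
proof (intro allI impI)
  fix e :: real assume "e > 0"
  then obtain \<delta> where \<delta>: "\<delta> > 0" and ac': "\<And>I :: (real \<times> real) set. finite I \<Longrightarrow>
      (\<forall>(u, v)\<in>I. a \<le> u \<and> u \<le> v \<and> v \<le> b) \<Longrightarrow> disjoint_family_on (\<lambda>(u, v). {u<..<v}) I \<Longrightarrow>
      (\<Sum>(u, v)\<in>I. v - u) < \<delta> \<Longrightarrow> (\<Sum>(u, v)\<in>I. norm (\<phi> v - \<phi> u)) < e"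
    using assms(1) unfolding absolutely_continuous_on_interval_def by (metis (lifting))
  show "\<exists>\<delta>>0. \<forall>I. finite I \<and> (\<forall>(u, v)\<in>I. c \<le> u \<and> u \<le> v \<and> v \<le> d) \<and>
        disjoint_family_on (\<lambda>(u, v). {u<..<v}) I \<and> (\<Sum>(u, v)\<in>I. v - u) < \<delta> \<longrightarrow>
        (\<Sum>(u, v)\<in>I. norm (\<phi> v - \<phi> u)) < e"
    using assms(2,3) by (intro exI[of _ \<delta>] conjI \<delta> allI impI ac') fastforce+
qed

lemma solution_from_atLeastAtMost_iff:
  assumes "0 \<le> T"
  shows "solution_from G x {0..T} \<phi> \<longleftrightarrow>
    \<phi> 0 = x \<and> absolutely_continuous_on_interval 0 T \<phi> \<and>
    negligible {t \<in> {0..T}. \<not> (\<exists>v. (\<phi> has_vector_derivative v) (at t within {0..T}) \<and> v \<in> G (\<phi> t))}"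
  using assms absolutely_continuous_on_subinterval[of 0 T \<phi>]
  by (auto simp: solution_from_def solution_domain_atLeastAtMost AE_lebesgue_iff_negligible
    locally_absolutely_continuous_on_def)

text \<open>Cuts out the arc over \<open>{s..u}\<close> and changes the inclusion on the way:
  \<open>G\<close> has to be contained in \<open>H\<close> only at the points of this arc. A
  constant perturbation is traded for \<open>\<epsilon>\<close> in this way inside a bounded
  region.\<close>

lemma solution_from_shift:
  assumes sol: "solution_from G x0 D \<phi>" and su: "s \<in> D" "u \<in> D" "s \<le> u"
    and GH: "\<And>t. s \<le> t \<Longrightarrow> t \<le> u \<Longrightarrow> G (\<phi> t) \<subseteq> H (\<phi> t)"
  shows "solution_from H (\<phi> s) {0..u - s} (\<lambda>t. \<phi> (s + t))"
proof -
  have D: "solution_domain D" and la: "locally_absolutely_continuous_on D \<phi>"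
    and neg: "negligible {t. \<not> (t \<in> D \<longrightarrow>
        (\<exists>v. (\<phi> has_vector_derivative v) (at t within D) \<and> v \<in> G (\<phi> t)))}"
    using sol unfolding solution_from_def AE_lebesgue_iff_negligible by auto
  have sub: "{s..u} \<subseteq> D" using solution_domain_interval[OF D su(1,2)] by auto
  have ac: "absolutely_continuous_on_interval s u \<phi>"
    using la su(3) sub unfolding locally_absolutely_continuous_on_def by auto
  have "negligible {t \<in> {0..u - s}. \<not> (\<exists>v. ((\<lambda>t. \<phi> (s + t)) has_vector_derivative v)
      (at t within {0..u - s}) \<and> v \<in> H (\<phi> (s + t)))}" (is "negligible ?N")
  proof (rule negligible_subset[OF negligible_translation[OF neg, of "- s"]], rule subsetI)
    fix t assume t: "t \<in> ?N"
    have "\<not> (\<exists>v. (\<phi> has_vector_derivative v) (at (s + t) within D) \<and> v \<in> G (\<phi> (s + t)))"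
    proof
      assume "\<exists>v. (\<phi> has_vector_derivative v) (at (s + t) within D) \<and> v \<in> G (\<phi> (s + t))"
      then obtain v where v: "(\<phi> has_vector_derivative v) (at (s + t) within D)" "v \<in> G (\<phi> (s + t))"
        by blast
      have "(\<phi> has_vector_derivative v) (at (s + t) within (+) s ` {0..u - s})"
        using sub by (intro has_vector_derivative_within_subset[OF v(1)]) auto
      moreover have "((+) s has_real_derivative 1) (at t within {0..u - s})"
        by (auto intro!: derivative_eq_intros)
      ultimately have "((\<lambda>t. \<phi> (s + t)) has_vector_derivative v) (at t within {0..u - s})"
        using vector_diff_chain_within[of "(+) s" 1 t "{0..u - s}" \<phi> v]
        by (simp add: o_def has_real_derivative_iff_has_vector_derivative)
      with v(2) GH[of "s + t"] t show False by auto
    qed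
    moreover have "s + t \<in> D" using t sub by auto
    ultimately show "t \<in> (+) (- s) ` {t. \<not> (t \<in> D \<longrightarrow>
        (\<exists>v. (\<phi> has_vector_derivative v) (at t within D) \<and> v \<in> G (\<phi> t)))}"
      by (intro image_eqI[of _ _ "s + t"]) auto
  qed
  then show ?thesis
    using absolutely_continuous_affine(1)[OF ac, of s] su(3)
    by (simp add: solution_from_atLeastAtMost_iff)
qed

lemma solution_from_continuous_on:
  assumes "solution_from G x0 D \<phi>" "s \<in> D" "u \<in> D" "s \<le> u"
  shows "continuous_on {s..u} \<phi>"
  using assms solution_domain_interval[of D s u]
  unfolding solution_from_def locally_absolutely_continuous_on_def
  by (intro absolutely_continuous_imp_continuous_on) (auto simp: subset_eq)

text \<open>Let \<open>t0\<close> be the supremum of the times spent in \<open>K\<close>. Times in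
  \<open>K\<close> accumulate at \<open>t0\<close> from the left and times outside from the right,
  unless \<open>t0\<close> itself is one. So \<open>\<phi> t0\<close> is a frontier point, and a
  short arc between two such times contradicts \<open>local\<close>. Whether
  \<open>\<phi> t0\<close> lies in \<open>K\<close> is left open, since \<open>K\<close> is
  arbitrary.\<close>

lemma forward_invariantI_frontier:
  assumes local: "\<And>x. x \<in> frontier K \<Longrightarrow> \<exists>r>0. \<forall>y T \<psi>. y \<in> K \<longrightarrow> 0 \<le> T \<longrightarrow>
    solution_from G y {0..T} \<psi> \<longrightarrow> \<psi> ` {0..T} \<subseteq> ball x r \<longrightarrow> \<psi> T \<in> K"
  shows "forward_invariant G K"
  unfolding forward_invariant_def
proof (intro ballI allI impI image_subsetI)
  fix x0 D \<phi> u assume x0: "x0 \<in> K" and sol: "solution_from G x0 D \<phi>" and u: "u \<in> D"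
  have D: "solution_domain D" "0 \<in> D" and \<phi>0: "\<phi> 0 = x0"
    using sol unfolding solution_from_def by auto
  have u0: "0 \<le> u" using solution_domain_nonneg[OF D(1) u] .
  have cont: "continuous_on {0..u} \<phi>" by (rule solution_from_continuous_on[OF sol D(2) u u0])
  show "\<phi> u \<in> K"
  proof (rule ccontr)
    assume nK: "\<phi> u \<notin> K"
    define S where "S = {t \<in> {0..u}. \<phi> t \<in> K}"
    define t0 where "t0 = Sup S"
    have S0: "0 \<in> S" using x0 \<phi>0 u0 by (simp add: S_def)
    have bdd: "bdd_above S" by (auto simp: S_def)
    have t0: "0 \<le> t0" "t0 \<le> u"
    proof -
      show "0 \<le> t0" unfolding t0_def by (rule cSup_upper[OF S0 bdd])
      show "t0 \<le> u" unfolding t0_def using S0 by (intro cSup_least) (auto simp: S_def)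
    qed
    have near: "\<exists>s v. s \<in> {0..u} \<and> v \<in> {0..u} \<and> s \<le> t0 \<and> t0 \<le> v \<and> t0 - d < s \<and> v < t0 + d \<and>
        \<phi> s \<in> K \<and> \<phi> v \<notin> K" if "d > 0" for d
    proof -
      obtain s where s: "s \<in> S" "t0 - d < s"
        using less_cSupD[of S "t0 - d"] S0 \<open>d > 0\<close> by (auto simp: t0_def)
      have st: "s \<le> t0" using cSup_upper[OF s(1) bdd] by (simp add: t0_def)
      \<comment> \<open>Just after \<open>t0\<close> but not beyond \<open>u\<close>; if
        \<open>t0 = u\<close> this is \<open>u\<close> itself, which is outside \<open>K\<close> by
        assumption.\<close>
      define v where "v = min u (t0 + d / 2)"
      have v: "v \<in> {0..u}" "t0 \<le> v" "v < t0 + d" using t0 \<open>d > 0\<close> by (auto simp: v_def)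
      have "v \<notin> S"
      proof (cases "t0 = u")
        case True
        then show ?thesis using nK \<open>d > 0\<close> by (auto simp: S_def v_def)
      next
        case False
        then have "t0 < v" using t0 \<open>d > 0\<close> by (auto simp: v_def)
        then show ?thesis using cSup_upper[OF _ bdd, of v] by (auto simp: t0_def)
      qed
      then have "\<phi> v \<notin> K" using v(1) by (simp add: S_def)
      moreover have "s \<in> {0..u}" "\<phi> s \<in> K" using s(1) by (simp_all add: S_def)
      ultimately show ?thesis using s(2) st v by blast
    qed
    have ct: "\<exists>d>0. \<forall>y\<in>{0..u}. \<bar>y - t0\<bar> < d \<longrightarrow> dist (\<phi> y) (\<phi> t0) < e" if "e > 0" for e
      using cont[unfolded continuous_on_iff, rule_format, of t0 e] t0 that by (simp add: dist_real_def)
    have "\<phi> t0 \<in> frontier K"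
      unfolding frontier_straddle
    proof (intro mem_Collect_eq[THEN iffD2] allI impI)
      fix e :: real assume "e > 0"
      then obtain d where d: "d > 0" "\<And>y. y \<in> {0..u} \<Longrightarrow> \<bar>y - t0\<bar> < d \<Longrightarrow> dist (\<phi> y) (\<phi> t0) < e"
        using ct by blast
      obtain s v where "s \<in> {0..u}" "v \<in> {0..u}" "s \<le> t0" "t0 \<le> v" "t0 - d < s" "v < t0 + d"
        "\<phi> s \<in> K" "\<phi> v \<notin> K" using near[OF d(1)] by blast
      then show "(\<exists>x\<in>K. dist (\<phi> t0) x < e) \<and> (\<exists>x. x \<notin> K \<and> dist (\<phi> t0) x < e)"
        using d(2)[of s] d(2)[of v] by (auto simp: dist_commute)
    qed
    then obtain r where r: "r > 0" "\<And>y T \<psi>. y \<in> K \<Longrightarrow> 0 \<le> T \<Longrightarrow>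
      solution_from G y {0..T} \<psi> \<Longrightarrow> \<psi> ` {0..T} \<subseteq> ball (\<phi> t0) r \<Longrightarrow> \<psi> T \<in> K"
      using local by metis
    obtain d where d: "d > 0" "\<And>y. y \<in> {0..u} \<Longrightarrow> \<bar>y - t0\<bar> < d \<Longrightarrow> dist (\<phi> y) (\<phi> t0) < r"
      using ct[OF r(1)] by blast
    obtain s v where sv: "s \<in> {0..u}" "v \<in> {0..u}" "s \<le> t0" "t0 \<le> v" "t0 - d < s" "v < t0 + d"
      "\<phi> s \<in> K" "\<phi> v \<notin> K" using near[OF d(1)] by blast
    have "solution_from G (\<phi> s) {0..v - s} (\<lambda>t. \<phi> (s + t))"
      using sv u D by (intro solution_from_shift[OF sol]) (auto intro: solution_domain_interval[OF D(1,2) u])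
    moreover have "(\<lambda>t. \<phi> (s + t)) ` {0..v - s} \<subseteq> ball (\<phi> t0) r"
    proof (intro image_subsetI)
      fix t assume "t \<in> {0..v - s}"
      then have "dist (\<phi> (s + t)) (\<phi> t0) < r" using sv by (intro d(2)) auto
      then show "\<phi> (s + t) \<in> ball (\<phi> t0) r" by (simp add: dist_commute)
    qed
    ultimately have "\<phi> (s + (v - s)) \<in> K"
      using r(2)[of "\<phi> s" "v - s" "\<lambda>t. \<phi> (s + t)"] sv by auto
    with sv show False by simp
  qed
qed

section \<open>Constant lower bounds for the perturbation\<close>

lemma scaleR_image_unit_cball:
  fixes r :: real assumes "0 \<le> r"
  shows "(*\<^sub>R) r ` cball 0 1 = (cball 0 r :: 'a::real_normed_vector set)"
  using assms cball_scale[of r "0 :: 'a" 1] by (cases "r = 0") (auto intro!: image_eqI[of _ _ 0])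

lemma mem_perturbed_iff:
  assumes "0 \<le> \<epsilon> x"
  shows "v \<in> perturbed F \<epsilon> x \<longleftrightarrow> (\<exists>\<eta>\<in>F x. \<exists>b. norm b \<le> \<epsilon> x \<and> v = \<eta> + b)"
  unfolding perturbed_def scaleR_image_unit_cball[OF assms] set_plus_def mem_Collect_eq mem_cball_0
  by (auto simp: Bex_def)

lemma perturbed_mono: "\<epsilon> x \<le> \<delta> x \<Longrightarrow> 0 \<le> \<epsilon> x \<Longrightarrow> perturbed F \<epsilon> x \<subseteq> perturbed F \<delta> x"
  by (force simp: mem_perturbed_iff)

lemma continuous_positive_lower_bound:
  fixes \<epsilon> :: "'a::heine_borel \<Rightarrow> real"
  assumes "continuous_on UNIV \<epsilon>" "\<And>x. 0 < \<epsilon> x" "bounded S"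
  obtains c where "0 < c" "\<And>x. x \<in> S \<Longrightarrow> c \<le> \<epsilon> x"
proof (cases "S = {}")
  case False
  obtain x where "x \<in> closure S" "\<And>y. y \<in> closure S \<Longrightarrow> \<epsilon> x \<le> \<epsilon> y"
    using continuous_attains_inf[of "closure S" \<epsilon>] assms False
    by (metis closure_eq_empty compact_closure continuous_on_subset subset_UNIV)
  then show ?thesis using that[of "\<epsilon> x"] assms(2) closure_subset[of S] by blast
qed (use that[of 1] in auto)

text \<open>By the local criterion only arcs within distance 1 of a frontier point matter. They lie
  in \<open>cball 0 (R + 1)\<close>, where \<open>\<epsilon>\<close> has a positive lower bound
  \<open>c\<close>, and therefore solve the inclusion perturbed by
  \<open>\<epsilon>\<close>.\<close>

lemma uniform_forward_invariant_of_bounded_frontier: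
  assumes bdd: "bounded (frontier K)" and cont: "continuous_on UNIV \<epsilon>" and pos: "\<And>x. 0 < \<epsilon> x"
    and inv: "forward_invariant (perturbed F \<epsilon>) K"
  obtains c where "0 < c" "forward_invariant (perturbed F (\<lambda>_. c)) K"
proof -
  obtain R where R: "\<And>x. x \<in> frontier K \<Longrightarrow> norm x \<le> R" using bdd unfolding bounded_iff by auto
  obtain c where c: "0 < c" "\<And>x. x \<in> cball 0 (R + 1) \<Longrightarrow> c \<le> \<epsilon> x"
    using continuous_positive_lower_bound[OF cont pos bounded_cball] by metis
  have "forward_invariant (perturbed F (\<lambda>_. c)) K"
  proof (rule forward_invariantI_frontier)
    fix x assume x: "x \<in> frontier K"
    have "\<psi> T \<in> K" if y: "y \<in> K" "0 \<le> T" and sol: "solution_from (perturbed F (\<lambda>_. c)) y {0..T} \<psi>"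
      and ball: "\<psi> ` {0..T} \<subseteq> ball x 1" for y T \<psi>
    proof -
      have "perturbed F (\<lambda>_. c) (\<psi> t) \<subseteq> perturbed F \<epsilon> (\<psi> t)" if "0 \<le> t" "t \<le> T" for t
      proof (rule perturbed_mono)
        have "\<psi> t \<in> ball x 1" using ball that by (auto simp only: image_subset_iff atLeastAtMost_iff)
        then have "\<psi> t \<in> cball 0 (R + 1)"
          using R[OF x] norm_triangle_sub[of "\<psi> t" x] by (auto simp: dist_norm norm_minus_commute)
        then show "c \<le> \<epsilon> (\<psi> t)" by (rule c(2))
      qed (use c in auto)
      then have "solution_from (perturbed F \<epsilon>) (\<psi> 0) {0..T} \<psi>"
        using solution_from_shift[OF sol, of 0 T "perturbed F \<epsilon>"] y by simp
      moreover have "\<psi> 0 = y" using sol unfolding solution_from_def by simp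
      ultimately have "\<psi> ` {0..T} \<subseteq> K"
        using inv y(1) unfolding forward_invariant_def by blast
      then show ?thesis using y(2) by auto
    qed
    then show "\<exists>r>0. \<forall>y T \<psi>. y \<in> K \<longrightarrow> 0 \<le> T \<longrightarrow> solution_from (perturbed F (\<lambda>_. c)) y {0..T} \<psi> \<longrightarrow>
        \<psi> ` {0..T} \<subseteq> ball x r \<longrightarrow> \<psi> T \<in> K"
      by (intro exI[of _ 1]) auto
  qed
  with c(1) show ?thesis by (rule that)
qed

text \<open>In \<open>cball 0 R\<close> the constant \<open>c\<close> lies below
  \<open>\<epsilon>\<close>, so arcs in that ball that start in \<open>Xo\<close> avoid
  \<open>Xu\<close>. If the complement of \<open>Xu\<close> is in the open ball, then norm
  \<open>R\<close> would be reached for the first time outside \<open>Xu\<close>, but every point of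
  such norm is in \<open>Xu\<close>. If the complement of \<open>Xo\<close> is in the open ball, the
  last point of norm at least \<open>R\<close> lies in \<open>Xo\<close> and serves as a new initial
  point.\<close>

lemma uniformly_robustly_safeI_bounded:
  assumes safe: "robustly_safe F Xo Xu" and disj: "Xo \<inter> Xu = {}"
    and bdd: "bounded (- Xu) \<or> bounded (- Xo)"
  shows "uniformly_robustly_safe F Xo Xu"
proof -
  obtain \<epsilon> where \<epsilon>: "continuous_on UNIV \<epsilon>" "\<And>x. 0 < \<epsilon> x" "safe (perturbed F \<epsilon>) Xo Xu"
    using safe unfolding robustly_safe_def by blast
  obtain R where R: "(\<forall>x. x \<notin> Xu \<longrightarrow> norm x < R) \<or> (\<forall>x. x \<notin> Xo \<longrightarrow> norm x < R)"
    using bdd unfolding bounded_pos_less by auto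
  obtain c where c: "0 < c" "\<And>x. x \<in> cball 0 R \<Longrightarrow> c \<le> \<epsilon> x"
    using continuous_positive_lower_bound[OF \<epsilon>(1,2) bounded_cball] by metis
  have "safe (perturbed F (\<lambda>_. c)) Xo Xu"
    unfolding safe_def
  proof (intro ballI allI impI image_subsetI)
    fix x0 D \<phi> u assume x0: "x0 \<in> Xo" and sol: "solution_from (perturbed F (\<lambda>_. c)) x0 D \<phi>" and u: "u \<in> D"
    have D: "solution_domain D" "0 \<in> D" and \<phi>0: "\<phi> 0 = x0"
      using sol unfolding solution_from_def by auto
    have u0: "0 \<le> u" using solution_domain_nonneg[OF D(1) u] .
    have cont: "continuous_on {0..u} \<phi>" by (rule solution_from_continuous_on[OF sol D(2) u u0])
    have *: "\<phi> t \<notin> Xu" if st: "0 \<le> s" "s \<le> t" "t \<le> u" "\<phi> s \<in> Xo" "\<And>r. s \<le> r \<Longrightarrow> r \<le> t \<Longrightarrow> norm (\<phi> r) \<le> R" for s t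
    proof -
      have "solution_from (perturbed F \<epsilon>) (\<phi> s) {0..t - s} (\<lambda>r. \<phi> (s + r))"
        using st c by (intro solution_from_shift[OF sol] perturbed_mono)
          (auto intro: solution_domain_interval[OF D(1,2) u])
      then have "(\<lambda>r. \<phi> (s + r)) ` {0..t - s} \<subseteq> - Xu"
        using \<epsilon>(3) st(4) unfolding safe_def by blast
      then show ?thesis using st(2) by (auto simp: image_subset_iff dest: bspec[of _ _ "t - s"])
    qed
    let ?S = "{t \<in> {0..u}. R \<le> norm (\<phi> t)}"
    have "closed ?S"
      using cont by (intro continuous_on_closed_Collect_le[of "{0..u}"] continuous_intros) auto
    then have comp: "compact ?S"
      unfolding compact_eq_bounded_closed by (auto intro: bounded_subset[of "{0..u}"])
    show "\<phi> u \<in> - Xu"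
    proof (cases "?S = {}")
      case True
      then show ?thesis using *[of 0 u] u0 x0 \<phi>0 by force
    next
      case ne: False
      from R show ?thesis
      proof
        assume Ru: "\<forall>x. x \<notin> Xu \<longrightarrow> norm x < R"
        obtain T where T: "T \<in> ?S" "\<And>t. t \<in> ?S \<Longrightarrow> T \<le> t"
          using compact_attains_inf[OF comp ne] by blast
        have "norm (\<phi> r) \<le> R" if r: "0 \<le> r" "r < T" for r
          using T(2)[of r] T(1) r by fastforce
        \<comment> \<open>The arc has to include its endpoint \<open>T\<close>. The bound passes to
          \<open>T\<close> by closedness from the earlier times; if \<open>T = 0\<close>, it holds
          because \<open>x0\<close> is outside \<open>Xu\<close>.\<close>
        moreover have "norm (\<phi> T) \<le> R"
        proof (cases "T = 0")
          case True
          have "x0 \<notin> Xu" using x0 disj by blast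
          then show ?thesis using Ru T(1) True \<phi>0 by fastforce
        next
          case False
          have sub: "{0..<T} \<subseteq> {t \<in> {0..u}. norm (\<phi> t) \<le> R}"
            using calculation T(1) by auto
          have "closed {t \<in> {0..u}. norm (\<phi> t) \<le> R}"
            using cont by (intro continuous_on_closed_Collect_le[of "{0..u}"] continuous_intros) auto
          with sub have "closure {0..<T} \<subseteq> {t \<in> {0..u}. norm (\<phi> t) \<le> R}"
            by (rule closure_minimal)
          moreover have "T \<in> closure {0..<T}"
            using T(1) False by (subst closure_atLeastLessThan) auto
          ultimately show ?thesis by auto
        qed
        ultimately have "\<phi> T \<notin> Xu"
          using *[of 0 T] T(1) x0 \<phi>0 by (auto simp: less_le)
        then show ?thesis using Ru T(1) by fastforce
      next
        assume Ro: "\<forall>x. x \<notin> Xo \<longrightarrow> norm x < R"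
        obtain T where T: "T \<in> ?S" "\<And>t. t \<in> ?S \<Longrightarrow> t \<le> T"
          using compact_attains_sup[OF comp ne] by blast
        have To: "\<phi> T \<in> Xo" using Ro T(1) by fastforce
        show ?thesis
        proof (cases "T = u")
          case True
          then show ?thesis using To disj by auto
        next
          case False
          have after: "norm (\<phi> r) \<le> R" if r: "T < r" "r \<le> u" for r
            using T(2)[of r] T(1) r by fastforce
          have sub: "{T<..u} \<subseteq> {t \<in> {0..u}. norm (\<phi> t) \<le> R}"
            using after T(1) by auto
          have "closed {t \<in> {0..u}. norm (\<phi> t) \<le> R}"
            using cont by (intro continuous_on_closed_Collect_le[of "{0..u}"] continuous_intros) auto
          with sub have "closure {T<..u} \<subseteq> {t \<in> {0..u}. norm (\<phi> t) \<le> R}"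
            by (rule closure_minimal)
          moreover have "T \<in> closure {T<..u}"
            using T(1) False by (subst closure_greaterThanAtMost) auto
          ultimately have "norm (\<phi> T) \<le> R" by auto
          then show ?thesis using *[of T u] T(1) To after by (force simp: le_less)
        qed
      qed
    qed
  qed
  then show ?thesis using c(1) unfolding uniformly_robustly_safe_def by blast
qed

section \<open>Proximal subgradients\<close>

text \<open>Without a minimiser the open sets \<open>{z. f y < f z}\<close> for \<open>y\<close> in
  \<open>C\<close> cover \<open>C\<close>. In a finite subcover the index with the smallest value is
  itself not covered.\<close>

lemma lsc_fun_attains_min:
  fixes f :: "'a::topological_space \<Rightarrow> real"
  assumes f: "lsc_fun f" and C: "compact C" "C \<noteq> {}"
  obtains y where "y \<in> C" "\<And>z. z \<in> C \<Longrightarrow> f y \<le> f z"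
proof (rule ccontr)
  assume "\<not> thesis"
  with that have none: "\<And>y. y \<in> C \<Longrightarrow> \<exists>z\<in>C. f z < f y" by (meson not_le)
  have op: "open {z. f y < f z}" for y
  proof (subst open_subopen, intro ballI)
    fix x assume "x \<in> {z. f y < f z}"
    then have "eventually (\<lambda>z. f y < f z) (nhds x)" using f unfolding lsc_fun_def by simp
    then show "\<exists>T. open T \<and> x \<in> T \<and> T \<subseteq> {z. f y < f z}"
      unfolding eventually_nhds by blast
  qed
  have "C \<subseteq> (\<Union>y\<in>C. {z. f y < f z})" using none by auto
  then obtain D where D: "D \<subseteq> C" "finite D" "C \<subseteq> (\<Union>y\<in>D. {z. f y < f z})"
    using compactE_image[OF C(1), of C "\<lambda>y. {z. f y < f z}"] op by metis
  have "D \<noteq> {}" using D C by auto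
  then obtain y where y: "y \<in> D" "\<And>z. z \<in> D \<Longrightarrow> f y \<le> f z"
    using D(2) Min_in[of "f ` D"] Min_le[of "f ` D"] by (metis (no_types, lifting) empty_is_image finite_imageI imageE imageI)
  then show False using D by fastforce
qed

lemma lsc_fun_add_continuous:
  fixes f h :: "'a::metric_space \<Rightarrow> real"
  assumes f: "lsc_fun f" and h: "continuous_on UNIV h"
  shows "lsc_fun (\<lambda>x. f x + h x)"
  unfolding lsc_fun_def
proof (intro allI impI)
  fix x c assume c: "c < f x + h x"
  define e where "e = (f x + h x - c) / 2"
  have e: "e > 0" using c by (simp add: e_def)
  have "eventually (\<lambda>y. f x - e < f y) (nhds x)" using f e unfolding lsc_fun_def by simp
  moreover have "eventually (\<lambda>y. h x - e < h y) (nhds x)"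
  proof -
    have "isCont h x" using h by (simp add: continuous_on_eq_continuous_at)
    then have "(h \<longlongrightarrow> h x) (nhds x)" by (simp add: isCont_def tendsto_at_iff_tendsto_nhds)
    then show ?thesis using e by (intro order_tendstoD) auto
  qed
  ultimately show "eventually (\<lambda>y. c < f y + h y) (nhds x)"
    by eventually_elim (simp add: e_def field_simps)
qed

text \<open>The ball around \<open>?p\<close> of radius \<open>r * norm (\<zeta>, - 1)\<close> has
  \<open>(y, V y)\<close> on its boundary. For small \<open>r\<close> it is curved more strongly
  than the quadratic minorant of \<open>V\<close>, so its interior misses the epigraph.\<close>

lemma proximal_subdifferentialI:
  fixes V :: "'a::euclidean_space \<Rightarrow> real"
  assumes s: "s > 0" and M: "M > 0"
    and loc: "\<And>z. dist z y < s \<Longrightarrow> V y + inner \<zeta> (z - y) - M * (norm (z - y))\<^sup>2 \<le> V z"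
  shows "\<zeta> \<in> proximal_subdifferential V y"
proof -
  \<comment> \<open>The first bound makes \<open>2 * r * M * (norm d)\<^sup>2\<close> at most
    \<open>(norm d)\<^sup>2\<close>. The second puts the points at distance at least
    \<open>s\<close>, about which \<open>loc\<close> says nothing, out of reach of the ball.\<close>
  define r where "r = min (1 / (2 * M)) (s / (2 * (norm \<zeta> + 1)))"
  have n1: "norm \<zeta> + 1 > 0" using norm_ge_zero[of \<zeta>] by linarith
  have r: "r > 0" "2 * r * M \<le> 1" "2 * r * (norm \<zeta> + 1) \<le> s"
  proof -
    show "r > 0" using s M n1 by (simp add: r_def)
    have "r \<le> 1 / (2 * M)" by (simp add: r_def)
    then show "2 * r * M \<le> 1" using M by (simp add: field_simps)
    have "r \<le> s / (2 * (norm \<zeta> + 1))" by (simp add: r_def)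
    then show "2 * r * (norm \<zeta> + 1) \<le> s" using n1 by (simp add: field_simps)
  qed
  let ?p = "(y, V y) + r *\<^sub>R (\<zeta>, - 1)"
  have in_epi: "(y, V y) \<in> epigraph UNIV V" by (simp add: epigraph_def)
  have nn: "(norm (\<zeta>, - 1 :: real))\<^sup>2 = (norm \<zeta>)\<^sup>2 + 1" by (simp add: norm_Pair)
  have "r * norm (\<zeta>, - 1 :: real) \<le> dist ?p q" if q: "q \<in> epigraph UNIV V" for q
  proof -
    obtain z \<sigma> where zs: "q = (z, \<sigma>)" "V z \<le> \<sigma>" using q by (cases q) (auto simp: epigraph_def)
    define d where "d = z - y"
    define \<tau> where "\<tau> = \<sigma> - V y"
    have "(dist ?p q)\<^sup>2 = (norm (y + r *\<^sub>R \<zeta> - z))\<^sup>2 + (V y - r - \<sigma>)\<^sup>2"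
      by (simp add: zs(1) dist_norm norm_Pair)
    also have "y + r *\<^sub>R \<zeta> - z = r *\<^sub>R \<zeta> - d" by (simp add: d_def)
    also have "(norm (r *\<^sub>R \<zeta> - d))\<^sup>2 = r\<^sup>2 * (norm \<zeta>)\<^sup>2 - 2 * r * inner \<zeta> d + (norm d)\<^sup>2"
      unfolding power2_norm_eq_inner by (simp add: inner_diff inner_commute power2_eq_square algebra_simps)
    also have "V y - r - \<sigma> = - (\<tau> + r)" by (simp add: \<tau>_def)
    finally have D: "(dist ?p q)\<^sup>2 =
      r\<^sup>2 * (norm \<zeta>)\<^sup>2 - 2 * r * inner \<zeta> d + (norm d)\<^sup>2 + (\<tau> + r)\<^sup>2"
      by (simp only: power2_minus)
    \<comment> \<open>After cancellation the claim is \<open>2 * r * inner \<zeta> d \<le> (norm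
      d)\<^sup>2 + \<tau>\<^sup>2 + 2 * r * \<tau>\<close>. For small \<open>d\<close> the minorant
      bounds \<open>\<tau>\<close> from below. For large \<open>d\<close> only
      \<open>0 \<le> (\<tau> + r)\<^sup>2\<close> is used, and \<open>(norm d)\<^sup>2\<close> pays
      for everything, including \<open>r\<^sup>2\<close>.\<close>
    have "r\<^sup>2 * ((norm \<zeta>)\<^sup>2 + 1) \<le> (dist ?p q)\<^sup>2"
    proof (cases "norm d < s")
      case True
      then have "V y + inner \<zeta> d - M * (norm d)\<^sup>2 \<le> V z"
        using loc[of z] by (simp add: d_def dist_norm)
      then have "inner \<zeta> d - M * (norm d)\<^sup>2 \<le> \<tau>" using zs(2) by (simp add: \<tau>_def)
      then have "2 * r * (inner \<zeta> d - M * (norm d)\<^sup>2) \<le> 2 * r * \<tau>"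
        using r(1) by (intro mult_left_mono) auto
      moreover have "(2 * r * M) * (norm d)\<^sup>2 \<le> 1 * (norm d)\<^sup>2"
        using r(2) by (intro mult_right_mono) auto
      ultimately show ?thesis
        unfolding D by (simp add: power2_eq_square algebra_simps) (smt (verit) zero_le_square)
    next
      case False
      have "inner \<zeta> d \<le> norm \<zeta> * norm d" by (rule norm_cauchy_schwarz)
      then have 1: "2 * r * inner \<zeta> d \<le> 2 * r * (norm \<zeta> * norm d)"
        using r(1) by (intro mult_left_mono) auto
      have "(2 * r * (norm \<zeta> + 1)) * norm d \<le> norm d * norm d"
        using r(3) False by (intro mult_right_mono) auto
      then have 2: "2 * r * (norm \<zeta> * norm d) + 2 * r * norm d \<le> norm d * norm d"
        by (simp add: algebra_simps)
      have "2 * r \<le> 2 * r * (norm \<zeta> + 1)" using r(1) by simp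
      then have "2 * r \<le> norm d" using r(3) False by linarith
      then have "r * (2 * r) \<le> r * norm d" using r(1) by (intro mult_left_mono) auto
      then have 3: "r\<^sup>2 \<le> 2 * r * norm d"
        using mult_nonneg_nonneg[of r r] r(1) by (simp add: power2_eq_square)
      have "0 \<le> (\<tau> + r)\<^sup>2" by simp
      then show ?thesis unfolding D using 1 2 3 by (simp add: power2_eq_square algebra_simps)
    qed
    then have "(r * norm (\<zeta>, - 1 :: real))\<^sup>2 \<le> (dist ?p q)\<^sup>2"
      by (simp add: power_mult_distrib nn)
    then show ?thesis by (rule power2_le_imp_le) simp
  qed
  then have "r * norm (\<zeta>, - 1 :: real) \<le> infdist ?p (epigraph UNIV V)"
    using in_epi by (subst infdist_notempty) (auto intro!: cINF_greatest)
  moreover have "infdist ?p (epigraph UNIV V) \<le> r * norm (\<zeta>, - 1 :: real)"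
  proof -
    have "infdist ?p (epigraph UNIV V) \<le> dist ?p (y, V y)" by (rule infdist_le[OF in_epi])
    also have "\<dots> = norm (r *\<^sub>R (\<zeta>, - 1 :: real))" by (simp only: dist_norm add_diff_cancel_left')
    also have "\<dots> = r * norm (\<zeta>, - 1 :: real)" using r(1) by (simp only: norm_scaleR abs_of_pos)
    finally show ?thesis .
  qed
  ultimately have "infdist ?p (epigraph UNIV V) = r * norm (\<zeta>, - 1 :: real)" by simp
  then show ?thesis
    unfolding proximal_subdifferential_def proximal_normal_cone_def using r(1) by blast
qed

text \<open>The Moreau envelope \<open>env x = min (V y + |x - y|^2 / (2 * l))\<close> is Lipschitz, and the displacement
  \<open>(x - y) / l\<close> from a minimiser \<open>y\<close> is a proximal subgradient of \<open>V\<close> at \<open>y\<close>, so the envelope is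
  nonincreasing along solutions as long as \<open>x - y\<close> is small. Clamping the envelope from above enforces
  the latter.\<close>

lemma lsc_nonincreasing_along_solution:
  fixes V :: "'a::euclidean_space \<Rightarrow> real"
  assumes V: "lsc_fun V" and r: "r > 0" and k: "k \<ge> 0" and \<delta>: "\<delta> > 0"
    and decr: "\<And>x y v \<zeta>. x \<in> ball x0 r \<Longrightarrow> y \<in> ball x0 r \<Longrightarrow> v \<in> H x \<Longrightarrow>
      \<zeta> \<in> proximal_subdifferential V y \<Longrightarrow> inner \<zeta> v \<le> norm \<zeta> * (k * dist x y - \<delta>)"
    and T: "0 \<le> T" and sol: "solution_from H (\<psi> 0) {0..T} \<psi>"
    and ball: "\<psi> ` {0..T} \<subseteq> ball x0 (r / 2)"
  shows "V (\<psi> T) \<le> V (\<psi> 0)"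
proof (rule ccontr)
  define c where "c = V (\<psi> 0)"
  assume "\<not> V (\<psi> T) \<le> V (\<psi> 0)"
  then have "eventually (\<lambda>y. c < V y) (nhds (\<psi> T))"
    using V unfolding lsc_fun_def c_def by simp
  \<comment> \<open>The contradiction will be a minimiser in this ball at which \<open>V\<close> is
    at most \<open>c\<close>.\<close>
  then obtain s where s: "s > 0" "\<And>y. dist y (\<psi> T) < s \<Longrightarrow> c < V y"
    unfolding eventually_nhds_metric by blast
  \<comment> \<open>Where the envelope is below the clamp, minimisers for points of
    \<open>ball x0 (r / 2)\<close> stay within \<open>5 * r / 8\<close> of \<open>x0\<close>. They
    are thus interior to \<open>C\<close>, so that a minimum over \<open>C\<close> is a local one,
    and they lie in the ball where \<open>decr\<close> applies.\<close>
  define C where "C = cball x0 (3 * r / 4)"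
  have C: "compact C" "C \<noteq> {}" using r by (auto simp: C_def)
  obtain y0 where y0: "\<And>z. z \<in> C \<Longrightarrow> V y0 \<le> V z" using lsc_fun_attains_min[OF V C] by metis
  \<comment> \<open>The clamping level; any number above \<open>c\<close> would do.\<close>
  define M where "M = c + 1"
  have ball': "\<psi> t \<in> ball x0 (r / 2)" if "0 \<le> t" "t \<le> T" for t
    using ball that by (auto simp only: image_subset_iff atLeastAtMost_iff)
  have half: "x \<in> C" if "x \<in> ball x0 (r / 2)" for x using that r by (auto simp: C_def)
  have Mm: "M - V y0 > 0"
    using y0[OF half[OF ball'[of 0]]] T by (simp add: M_def c_def)
  \<comment> \<open>Bound for the distance to the minimiser: \<open>s\<close> serves the final
    contradiction at \<open>\<psi> T\<close>, \<open>r / 8\<close> keeps the minimiser interior to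
    \<open>C\<close>, and the last term is half of what the margin \<open>\<delta>\<close> can pay
    for.\<close>
  define \<eta> where "\<eta> = min (min s (r / 8)) (\<delta> / (2 * (k + 1)))"
  have \<eta>: "\<eta> > 0" "\<eta> \<le> s" "\<eta> \<le> r / 8" "\<eta> \<le> \<delta> / (2 * (k + 1))"
  proof -
    show "\<eta> > 0" using s(1) r k \<delta> by (auto simp: \<eta>_def)
  qed (simp_all only: \<eta>_def min.cobounded2 min.coboundedI1 min.cobounded1)
  \<comment> \<open>Makes \<open>2 * l * (M - V y0)\<close> half of \<open>\<eta>\<^sup>2\<close>,
    so that \<open>env x \<le> M\<close> forces \<open>x\<close> to be closer than
    \<open>\<eta>\<close> to its minimiser.\<close>
  define l where "l = \<eta>\<^sup>2 / (4 * (M - V y0))"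
  have l: "l > 0" "2 * l * (M - V y0) < \<eta>\<^sup>2"
  proof -
    show "l > 0" using \<eta>(1) Mm by (simp add: l_def)
    have "2 * l * (M - V y0) = \<eta>\<^sup>2 / 2" using Mm by (simp add: l_def field_simps)
    also have "\<dots> < \<eta>\<^sup>2" using \<eta>(1) by simp
    finally show "2 * l * (M - V y0) < \<eta>\<^sup>2" .
  qed
  have "\<exists>y\<in>C. \<forall>z\<in>C. V y + (norm (x - y))\<^sup>2 / (2 * l) \<le> V z + (norm (x - z))\<^sup>2 / (2 * l)" for x
  proof -
    have "lsc_fun (\<lambda>y. V y + (norm (x - y))\<^sup>2 / (2 * l))"
      using l(1) by (intro lsc_fun_add_continuous[OF V] continuous_intros) auto
    from lsc_fun_attains_min[OF this C] show ?thesis by metis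
  qed
  then obtain p where pC: "\<And>x. p x \<in> C" and pmin: "\<And>x z. z \<in> C \<Longrightarrow>
      V (p x) + (norm (x - p x))\<^sup>2 / (2 * l) \<le> V z + (norm (x - z))\<^sup>2 / (2 * l)"
    by metis
  define env where "env x = V (p x) + (norm (x - p x))\<^sup>2 / (2 * l)" for x
  have env_le: "env x \<le> V z + (norm (x - z))\<^sup>2 / (2 * l)" if "z \<in> C" for x z
    using pmin[OF that] by (simp add: env_def)
  have close: "norm (x - p x) < \<eta>" if "env x \<le> M" for x
  proof -
    have "(norm (x - p x))\<^sup>2 / (2 * l) \<le> M - V y0"
      using that y0[OF pC[of x]] by (simp add: env_def)
    then have "(norm (x - p x))\<^sup>2 \<le> 2 * l * (M - V y0)" using l(1) by (simp add: field_simps)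
    then have "(norm (x - p x))\<^sup>2 < \<eta>\<^sup>2" using l(2) by linarith
    then show ?thesis using \<eta>(1) by (simp add: power2_less_imp_less)
  qed
  define L where "L = 2 * r / l"
  have env_lip: "env x - env x' \<le> L * norm (x - x')"
    if x: "x \<in> ball x0 (r / 2)" and x': "x' \<in> ball x0 (r / 2)" for x x'
  proof -
    let ?y = "p x'"
    have n: "norm (z - ?y) \<le> 2 * r" if "z \<in> ball x0 (r / 2)" for z
    proof -
      have "dist z ?y \<le> dist z x0 + dist x0 ?y" by (rule dist_triangle)
      also have "\<dots> \<le> 2 * r" using that pC[of x'] r by (simp add: C_def dist_commute)
      finally show ?thesis by (simp add: dist_norm)
    qed
    have "(norm (x - ?y))\<^sup>2 - (norm (x' - ?y))\<^sup>2
        = (norm (x - ?y) - norm (x' - ?y)) * (norm (x - ?y) + norm (x' - ?y))"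
      by (simp add: power2_eq_square algebra_simps)
    also have "\<dots> \<le> norm (x - x') * (2 * r + 2 * r)"
      using n[OF x] n[OF x'] norm_triangle_ineq2[of "x - ?y" "x' - ?y"]
      by (intro mult_mono) auto
    finally have "(norm (x - ?y))\<^sup>2 - (norm (x' - ?y))\<^sup>2 \<le> 4 * r * norm (x - x')" by (simp add: mult_ac)
    then have "((norm (x - ?y))\<^sup>2 - (norm (x' - ?y))\<^sup>2) / (2 * l) \<le> (4 * r * norm (x - x')) / (2 * l)"
      using l(1) by (intro divide_right_mono) auto
    then show ?thesis
      using env_le[OF pC[of x'], of x] unfolding env_def[of x'] L_def by (simp add: diff_divide_distrib)
  qed
  define g where "g x = min (env x) M" for x
  have glip: "L-lipschitz_on (ball x0 (r / 2)) g"
  proof (rule lipschitz_onI)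
    fix x y assume xy: "x \<in> ball x0 (r / 2)" "y \<in> ball x0 (r / 2)"
    have "\<bar>env x - env y\<bar> \<le> L * norm (x - y)"
      using env_lip[OF xy] env_lip[OF xy(2,1)] by (simp add: norm_minus_commute abs_le_iff)
    then show "dist (g x) (g y) \<le> L * dist x y" by (auto simp: g_def dist_real_def dist_norm)
  qed (use r l in \<open>simp add: L_def\<close>)
  have "\<exists>d>0. \<forall>z h. dist z (\<psi> t) < d \<longrightarrow> 0 \<le> h \<longrightarrow> h < d \<longrightarrow> g (z + h *\<^sub>R v) \<le> g z + e * h"
    if t: "0 \<le> t" "t \<le> T" and v: "v \<in> H (\<psi> t)" and e: "e > 0" for t v e
  proof -
    obtain d0 where d0: "d0 > 0" "ball (\<psi> t) d0 \<subseteq> ball x0 (r / 2)"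
      using ball'[OF t] open_contains_ball open_ball by metis
    \<comment> \<open>The second bound is the other half of what \<open>\<delta>\<close> can pay
      for, since \<open>v\<close> is a velocity at \<open>\<psi> t\<close> and not at
      \<open>z\<close>. The last one lets the second order term
      \<open>h\<^sup>2 * (norm v)\<^sup>2 / (2 * l)\<close> be absorbed in
      \<open>e * h\<close>.\<close>
    define d where "d = min (min d0 (\<delta> / (2 * (k + 1)))) (2 * l * e / ((norm v)\<^sup>2 + 1))"
    have nv: "(norm v)\<^sup>2 + 1 > 0" using zero_le_power2[of "norm v"] by linarith
    have d: "d > 0" "d \<le> d0" "d \<le> \<delta> / (2 * (k + 1))" "d \<le> 2 * l * e / ((norm v)\<^sup>2 + 1)"
      using d0 \<delta> k l e nv by (auto simp: d_def)
    have "g (z + h *\<^sub>R v) \<le> g z + e * h" if z: "dist z (\<psi> t) < d" and h: "0 \<le> h" "h < d" for z h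
    proof (cases "env z \<le> M")
      \<comment> \<open>Here \<open>g\<close> already has its largest possible value.\<close>
      case False
      then have "g (z + h *\<^sub>R v) \<le> g z" by (simp add: g_def)
      moreover have "0 \<le> e * h" using e h by simp
      ultimately show ?thesis by linarith
    next
      case True
      let ?y = "p z"
      define \<zeta> where "\<zeta> = (1 / l) *\<^sub>R (z - ?y)"
      have zi: "inner \<zeta> u = inner (z - ?y) u / l" for u unfolding \<zeta>_def by simp
      have zy: "norm (z - ?y) < \<eta>" by (rule close[OF True])
      have zb: "z \<in> ball x0 (r / 2)" using z d(2) by (intro subsetD[OF d0(2)]) (simp add: dist_commute)
      have yb: "dist x0 ?y < 5 * r / 8"
        using dist_triangle[of x0 ?y z] zb zy \<eta>(3) by (simp add: dist_norm)
      have expand: "(norm (z - w))\<^sup>2 = (norm (z - ?y))\<^sup>2 - 2 * inner (z - ?y) (w - ?y) + (norm (w - ?y))\<^sup>2" for w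
        by (simp add: power2_norm_eq_inner inner_diff inner_commute algebra_simps)
      have "\<zeta> \<in> proximal_subdifferential V ?y"
      proof (rule proximal_subdifferentialI)
        show "r / 8 > 0" "1 / (2 * l) > 0" using r l by auto
        fix w assume w: "dist w ?y < r / 8"
        then have "w \<in> C" using dist_triangle[of x0 w ?y] yb by (simp add: C_def dist_commute)
        from env_le[OF this, of z] have "V ?y + (norm (z - ?y))\<^sup>2 / (2 * l) \<le> V w + (norm (z - w))\<^sup>2 / (2 * l)"
          by (simp add: env_def)
        moreover have "(norm (z - w))\<^sup>2 / (2 * l) = (norm (z - ?y))\<^sup>2 / (2 * l) - inner \<zeta> (w - ?y)
            + 1 / (2 * l) * (norm (w - ?y))\<^sup>2"
          using l(1) unfolding expand[of w] zi by (simp add: field_simps)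
        ultimately show "V ?y + inner \<zeta> (w - ?y) - 1 / (2 * l) * (norm (w - ?y))\<^sup>2 \<le> V w" by linarith
      qed
      then have "inner \<zeta> v \<le> norm \<zeta> * (k * dist (\<psi> t) ?y - \<delta>)"
        using ball'[OF t] yb v r by (intro decr) auto
      also have "\<dots> \<le> 0"
      proof (rule mult_nonneg_nonpos)
        have "dist (\<psi> t) ?y \<le> dist z (\<psi> t) + norm (z - ?y)"
          using dist_triangle3[of "\<psi> t" ?y z] by (simp add: dist_norm)
        also have "\<dots> \<le> \<delta> / (2 * (k + 1)) + \<delta> / (2 * (k + 1))" using z zy d(3) \<eta>(4) by linarith
        also have "\<dots> = \<delta> / (k + 1)"
        proof -
          have "a / (2 * q) + a / (2 * q) = a / q" for a q :: real by (cases "q = 0") (auto simp: field_simps)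
          then show ?thesis .
        qed
        finally have "k * dist (\<psi> t) ?y \<le> k * (\<delta> / (k + 1))" using k by (rule mult_left_mono)
        also have "\<dots> \<le> \<delta>" using k \<delta> by (simp add: field_simps)
        finally show "k * dist (\<psi> t) ?y - \<delta> \<le> 0" by simp
      qed simp
      finally have neg: "inner \<zeta> v \<le> 0" .
      have "h * (norm v)\<^sup>2 / (2 * l) \<le> e"
      proof -
        have "h * (norm v)\<^sup>2 \<le> d * ((norm v)\<^sup>2 + 1)" using h by (intro mult_mono) auto
        also have "\<dots> \<le> 2 * l * e" using d(4) nv by (simp add: field_simps)
        finally show ?thesis using l(1) by (simp add: field_simps)
      qed
      then have hh: "h * (h * (norm v)\<^sup>2 / (2 * l)) \<le> h * e" using h by (intro mult_left_mono) auto
      \<comment> \<open>The minimiser for \<open>z\<close> is kept as a competitor for the moved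
        point, so only the quadratic term changes.\<close>
      have "env (z + h *\<^sub>R v) \<le> V ?y + (norm (z + h *\<^sub>R v - ?y))\<^sup>2 / (2 * l)" by (rule env_le[OF pC])
      also have "(norm (z + h *\<^sub>R v - ?y))\<^sup>2 = (norm (z - ?y))\<^sup>2 + 2 * h * inner (z - ?y) v + h * h * (norm v)\<^sup>2"
        by (simp add: power2_norm_eq_inner inner_diff inner_add inner_commute algebra_simps)
      also have "V ?y + \<dots> / (2 * l) = env z + h * inner \<zeta> v + h * (h * (norm v)\<^sup>2 / (2 * l))"
        using l(1) unfolding zi by (simp add: env_def field_simps)
      also have "\<dots> \<le> env z + e * h"
        using hh mult_nonneg_nonpos[OF h(1) neg] by (simp add: mult.commute)
      finally show ?thesis using True by (simp add: g_def)
    qed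
    then show ?thesis using d(1) by blast
  qed
  note gincr = this
  have sol': "absolutely_continuous_on_interval 0 T \<psi>"
    "negligible {t \<in> {0..T}. \<not> (\<exists>v. (\<psi> has_vector_derivative v) (at t within {0..T}) \<and> v \<in> H (\<psi> t))}"
    using sol unfolding solution_from_atLeastAtMost_iff[OF T] by auto
  have "g (\<psi> T) \<le> g (\<psi> 0)"
  proof (rule lipschitz_nonincreasing_along_curve[OF T sol'(1) open_ball ball glip sol'(2)])
    fix t assume t: "t \<in> {0..T}"
      and "t \<notin> {t \<in> {0..T}. \<not> (\<exists>v. (\<psi> has_vector_derivative v) (at t within {0..T}) \<and> v \<in> H (\<psi> t))}"
    then obtain v where v: "(\<psi> has_vector_derivative v) (at t within {0..T})" "v \<in> H (\<psi> t)" by blast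
    with gincr[of t v] t
    show "\<exists>v. (\<psi> has_vector_derivative v) (at t within {0..T}) \<and> (\<forall>e>0. \<exists>d>0. \<forall>z h.
        dist z (\<psi> t) < d \<longrightarrow> 0 \<le> h \<longrightarrow> h < d \<longrightarrow> g (z + h *\<^sub>R v) \<le> g z + e * h)"
      by (intro exI[of _ v]) simp
  qed
  also have "g (\<psi> 0) \<le> c"
    using env_le[OF half[OF ball'[of 0]], of "\<psi> 0"] T by (simp add: g_def c_def)
  \<comment> \<open>As \<open>c < M\<close>, the clamp is inactive at
    \<open>\<psi> T\<close>.\<close>
  finally have le: "env (\<psi> T) \<le> c" by (simp add: g_def M_def)
  then have "dist (p (\<psi> T)) (\<psi> T) < s"
    using close[of "\<psi> T"] \<eta>(2) by (simp add: M_def dist_norm norm_minus_commute)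
  then have "c < V (p (\<psi> T))" by (rule s(2))
  moreover have "V (p (\<psi> T)) \<le> env (\<psi> T)" using l(1) by (simp add: env_def)
  ultimately show False using le by linarith
qed

section \<open>Rademacher's theorem\<close>

text \<open>The intervals between \<open>x\<close> and \<open>x + h\<close> with slope below
  \<open>p\<close> form a Vitali cover of \<open>A\<close>. By monotonicity \<open>f\<close> maps
  each of them into an interval at most \<open>p\<close> times as long. Disjoint ones exhaust
  \<open>A\<close> up to a null set, whose image is null by \<open>null\<close>.\<close>

lemma measure_image_le_of_small_slopes:
  fixes f :: "real \<Rightarrow> real"
  assumes mono: "mono f" and null: "\<And>N. negligible N \<Longrightarrow> negligible (f ` N)"
    and A: "A \<in> lmeasurable" and fA: "f ` A \<in> lmeasurable" and p: "0 \<le> p"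
    and small: "\<And>x d. x \<in> A \<Longrightarrow> d > 0 \<Longrightarrow> \<exists>h. h \<noteq> 0 \<and> \<bar>h\<bar> < d \<and> (f (x + h) - f x) / h < p"
  shows "measure lebesgue (f ` A) \<le> p * measure lebesgue A"
proof (rule field_le_epsilon)
  fix e :: real assume e: "e > 0"
  define e1 where "e1 = e / (p + 1)"
  have e1: "e1 > 0" "p * e1 \<le> e" using e p by (auto simp: e1_def field_simps)
  obtain T where T: "open T" "A \<subseteq> T" "T - A \<in> lmeasurable" "emeasure lebesgue (T - A) < ennreal e1"
    using sets_lebesgue_outer_open[of A e1] A e1 by blast
  have Tm: "T \<in> lmeasurable" using fmeasurable.Un[OF T(3) A] T(2) by (simp add: Un_absorb2)
  have "measure lebesgue T \<le> measure lebesgue (T - A) + measure lebesgue A"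
    using measure_Un_le[of "T - A" lebesgue A] T A by (simp add: Un_absorb2)
  also have "measure lebesgue (T - A) \<le> e1"
    using T(3,4) e1(1) by (simp add: emeasure_eq_measure2 ennreal_less_iff)
  finally have mT: "measure lebesgue T \<le> e1 + measure lebesgue A" by simp
  \<comment> \<open>An index \<open>(x, h)\<close> stands for the interval with endpoints
    \<open>x\<close> and \<open>x + h\<close>, where \<open>h\<close> may be negative, written as a
    ball for the covering theorem.\<close>
  define c where "c i = fst i + snd i / 2" for i :: "real \<times> real"
  define r where "r i = \<bar>snd i\<bar> / 2" for i :: "real \<times> real"
  define K where "K = {i. snd i \<noteq> 0 \<and> cball (c i) (r i) \<subseteq> T \<and> (f (fst i + snd i) - f (fst i)) / snd i < p}"
  have cb: "cball (c i) (r i) = {min (fst i) (fst i + snd i)..max (fst i) (fst i + snd i)}" for i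
    by (auto simp: c_def r_def cball_eq_atLeastAtMost min_def max_def abs_if)
  have 1: "0 < r i" if "i \<in> K" for i using that by (simp add: K_def r_def)
  have 2: "\<exists>i. i \<in> K \<and> x \<in> cball (c i) (r i) \<and> r i < d" if x: "x \<in> A" and d: "d > 0" for x d
  proof -
    obtain s where s: "s > 0" "cball x s \<subseteq> T" using T(1,2) x by (meson open_contains_cball subsetD)
    obtain h where h: "h \<noteq> 0" "\<bar>h\<bar> < min d s" "(f (x + h) - f x) / h < p"
      using small[OF x, of "min d s"] d s by auto
    have "cball (c (x, h)) (r (x, h)) \<subseteq> cball x s"
      unfolding cb using h(2) by (auto simp: dist_real_def)
    then have "(x, h) \<in> K" using h s(2) by (auto simp: K_def)
    moreover have "x \<in> cball (c (x, h)) (r (x, h))" unfolding cb by auto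
    moreover have "r (x, h) < d" using h(1,2) d by (simp add: r_def)
    ultimately show ?thesis by blast
  qed
  obtain C where C: "countable C" "C \<subseteq> K" "pairwise (\<lambda>i j. disjnt (cball (c i) (r i)) (cball (c j) (r j))) C"
     "negligible (A - (\<Union>i \<in> C. cball (c i) (r i)))"
    using Vitali_covering_theorem_cballs[of K r A c] 1 2 by blast
  define N where "N = A - (\<Union>i \<in> C. cball (c i) (r i))"
  define J where "J i = {f (min (fst i) (fst i + snd i))..f (max (fst i) (fst i + snd i))}" for i
  have Jm: "J i \<in> lmeasurable" for i by (simp add: J_def)
  have mJ: "measure lebesgue (J i) \<le> p * measure lebesgue (cball (c i) (r i))" if "i \<in> K" for i
  proof -
    have s: "(f (fst i + snd i) - f (fst i)) / snd i < p" "snd i \<noteq> 0" using that by (auto simp: K_def)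
    have "f (min (fst i) (fst i + snd i)) \<le> f (max (fst i) (fst i + snd i))"
      by (rule monoD[OF mono]) auto
    then have "measure lebesgue (J i) = f (max (fst i) (fst i + snd i)) - f (min (fst i) (fst i + snd i))"
      by (simp add: J_def)
    also have "\<dots> \<le> p * \<bar>snd i\<bar>"
      using s by (cases "snd i > 0") (auto simp: min_def max_def field_simps)
    also have "\<bar>snd i\<bar> = measure lebesgue (cball (c i) (r i))"
      unfolding cb by (auto simp: min_def max_def)
    finally show ?thesis .
  qed
  have bound: "measure lebesgue (\<Union>i\<in>I. J i) \<le> p * measure lebesgue T" if I: "I \<subseteq> C" "finite I" for I
  proof -
    have "measure lebesgue (\<Union>i\<in>I. J i) \<le> (\<Sum>i\<in>I. measure lebesgue (J i))"
      using I(2) Jm by (intro measure_UNION_le) auto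
    also have "\<dots> \<le> (\<Sum>i\<in>I. p * measure lebesgue (cball (c i) (r i)))"
      using I C(2) by (intro sum_mono mJ) auto
    also have "\<dots> = p * measure lebesgue (\<Union>i\<in>I. cball (c i) (r i))"
      unfolding sum_distrib_left[symmetric]
      using I(2) pairwise_subset[OF C(3) I(1)] by (subst measure_UNION') auto
    also have "\<dots> \<le> p * measure lebesgue T"
      using I C(2) Tm p by (intro mult_left_mono measure_mono_fmeasurable)
        (auto simp: K_def intro!: sets.finite_UN)
    finally show ?thesis .
  qed
  have UJ: "(\<Union>i\<in>C. J i) \<in> lmeasurable" "measure lebesgue (\<Union>i\<in>C. J i) \<le> p * measure lebesgue T"
    using fmeasurable_UN_bound[OF C(1) Jm bound] measure_UN_bound[OF C(1) Jm bound] by auto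
  have fN: "negligible (f ` N)" using null C(4) by (simp add: N_def)
  have "f ` A \<subseteq> f ` N \<union> (\<Union>i\<in>C. J i)"
  proof
    fix y assume "y \<in> f ` A"
    then obtain x where x: "x \<in> A" "y = f x" by auto
    show "y \<in> f ` N \<union> (\<Union>i\<in>C. J i)"
    proof (cases "x \<in> N")
      case False
      then obtain i where i: "i \<in> C" "x \<in> cball (c i) (r i)" using x by (auto simp: N_def)
      then have "y \<in> J i" unfolding cb J_def x(2) using monoD[OF mono] by auto
      then show ?thesis using i by auto
    qed (use x in auto)
  qed
  then have "measure lebesgue (f ` A) \<le> measure lebesgue (f ` N \<union> (\<Union>i\<in>C. J i))"
    using fmeasurable.Un[OF negligible_imp_measurable[OF fN] UJ(1)] fA
    by (intro measure_mono_fmeasurable) auto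
  also have "\<dots> \<le> measure lebesgue (f ` N) + measure lebesgue (\<Union>i\<in>C. J i)"
    using fN UJ(1) by (intro measure_Un_le) (auto simp: negligible_imp_sets)
  also have "\<dots> \<le> p * measure lebesgue T"
    using UJ(2) fN by (simp add: negligible_imp_measure0)
  also have "\<dots> \<le> p * measure lebesgue A + e"
    using mult_left_mono[OF mT p] e1(2) by (simp add: algebra_simps)
  finally show "measure lebesgue (f ` A) \<le> p * measure lebesgue A + e" .
qed

text \<open>For bounded difference quotients, membership for some rational \<open>p < q\<close> is
  the only obstacle to a limit in direction \<open>v\<close>. The inequalities are strict so that,
  for continuous \<open>f\<close> and fixed \<open>h\<close>, they define open sets.\<close>

definition oscillation_set :: "('a::real_normed_vector \<Rightarrow> real) \<Rightarrow> 'a \<Rightarrow> real \<Rightarrow> real \<Rightarrow> 'a set" where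
  "oscillation_set f v p q = {x. \<forall>d>0.
     (\<exists>h. h \<noteq> 0 \<and> \<bar>h\<bar> < d \<and> (f (x + h *\<^sub>R v) - f x) / h < p) \<and>
     (\<exists>h. h \<noteq> 0 \<and> \<bar>h\<bar> < d \<and> (f (x + h *\<^sub>R v) - f x) / h > q)}"

text \<open>The unions over uncountably many \<open>h\<close> are harmless because they consist of
  open sets; only the bound on \<open>h\<close> has to be restricted to a sequence, which leaves a
  countable intersection.\<close>

lemma oscillation_set_borel:
  fixes f :: "'a::real_normed_vector \<Rightarrow> real"
  assumes f: "continuous_on UNIV f"
  shows "oscillation_set f v p q \<in> sets borel"
proof -
  define U where "U n = (\<Union>h\<in>{h. h \<noteq> 0 \<and> \<bar>h\<bar> < inverse (real (Suc n))}. {x. (f (x + h *\<^sub>R v) - f x) / h < p})" for n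
  define W where "W n = (\<Union>h\<in>{h. h \<noteq> 0 \<and> \<bar>h\<bar> < inverse (real (Suc n))}. {x. (f (x + h *\<^sub>R v) - f x) / h > q})" for n
  have cont: "continuous_on UNIV (\<lambda>x. (f (x + h *\<^sub>R v) - f x) / h)" if "h \<noteq> 0" for h
    using that by (intro continuous_intros continuous_on_compose2[OF f]) auto
  have "open (U n)" "open (W n)" for n
    unfolding U_def W_def
    by (auto intro!: open_UN open_Collect_less cont continuous_on_const)
  moreover have "oscillation_set f v p q = (\<Inter>n. U n \<inter> W n)"
  proof (intro equalityI subsetI)
    fix x assume "x \<in> oscillation_set f v p q"
    then have "x \<in> U n \<inter> W n" for n
      unfolding oscillation_set_def U_def W_def
      by (auto dest!: spec[of _ "inverse (real (Suc n))"])
    then show "x \<in> (\<Inter>n. U n \<inter> W n)" by blast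
  next
    fix x assume x: "x \<in> (\<Inter>n. U n \<inter> W n)"
    show "x \<in> oscillation_set f v p q"
      unfolding oscillation_set_def
    proof (intro mem_Collect_eq[THEN iffD2] allI impI)
      fix d :: real assume "d > 0"
      then obtain n where n: "inverse (real (Suc n)) < d" using reals_Archimedean by blast
      have "x \<in> U n" "x \<in> W n" using x by auto
      then show "(\<exists>h. h \<noteq> 0 \<and> \<bar>h\<bar> < d \<and> (f (x + h *\<^sub>R v) - f x) / h < p) \<and>
        (\<exists>h. h \<noteq> 0 \<and> \<bar>h\<bar> < d \<and> (f (x + h *\<^sub>R v) - f x) / h > q)"
        unfolding U_def W_def using n less_trans by blast
    qed
  qed
  ultimately show ?thesis by auto
qed

text \<open>The slopes of \<open>f\<close> lie in \<open>[1, M]\<close>, so \<open>f\<close> is a bi-Lipschitz bijection, and \<open>E\<close> and \<open>f ` E\<close>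
  satisfy both \<open>|f ` E| \<le> p * |E|\<close> and \<open>|E| \<le> |f ` E| / q\<close>.\<close>

lemma negligible_oscillation_set_bilipschitz:
  fixes f :: "real \<Rightarrow> real"
  assumes lo: "\<And>x y. x \<le> y \<Longrightarrow> y - x \<le> f y - f x" and hi: "\<And>x y. x \<le> y \<Longrightarrow> f y - f x \<le> M * (y - x)"
    and pq: "p < q"
  shows "negligible (oscillation_set f 1 p q)"
proof -
  have abs_lo: "\<bar>y - x\<bar> \<le> \<bar>f y - f x\<bar>" for x y
    using lo[of x y] lo[of y x] by (cases "x \<le> y") auto
  have abs_hi: "\<bar>f y - f x\<bar> \<le> M * \<bar>y - x\<bar>" for x y
    using hi[of x y] hi[of y x] lo[of x y] lo[of y x] by (cases "x \<le> y") auto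
  have M: "M \<ge> 1" using lo[of 0 1] hi[of 0 1] by simp
  have mono: "mono f" using lo by (intro monoI) (smt (verit))
  have lip: "M-lipschitz_on UNIV f"
    using abs_hi M by (intro lipschitz_onI) (auto simp: dist_real_def)
  have cont: "continuous_on UNIV f" using lip by (rule lipschitz_on_continuous_on)
  have inj: "inj f"
  proof (rule injI)
    fix x y assume "f x = f y" then show "x = y" using abs_lo[of x y] by simp
  qed
  have surj: "\<exists>x. f x = y" for y
  proof -
    define c where "c = \<bar>y - f 0\<bar>"
    have "f (- c) \<le> y" "y \<le> f c" using lo[of "- c" 0] lo[of 0 c] by (auto simp: c_def)
    then show ?thesis
      using IVT'[of f "- c" y c] continuous_on_subset[OF cont] by (auto simp: c_def)
  qed
  define g where "g = inv f"
  have gf: "g (f x) = x" for x using inj by (simp add: g_def)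
  have fg: "f (g y) = y" for y using surj by (metis g_def f_inv_into_f rangeI)
  have glip: "1-lipschitz_on UNIV g"
    using abs_lo[of "g _" "g _"] by (intro lipschitz_onI) (auto simp: dist_real_def fg)
  have gmono: "mono g"
  proof (rule monoI)
    fix x y :: real assume "x \<le> y"
    then show "g x \<le> g y" using lo[of "g y" "g x"] by (cases "g x \<le> g y") (auto simp: fg)
  qed
  have null: "negligible (k ` N)" if "negligible N" "L-lipschitz_on UNIV k" for N L and k :: "real \<Rightarrow> real"
  proof (rule negligible_locally_Lipschitz_image[OF order_refl that(1)])
    fix x show "\<exists>T B. open T \<and> x \<in> T \<and> (\<forall>y\<in>N \<inter> T. norm (k y - k x) \<le> B * norm (y - x))"
      using lipschitz_onD[OF that(2)] by (intro exI[of _ UNIV] exI[of _ L]) (auto simp: dist_norm)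
  qed
  show ?thesis
    \<comment> \<open>Cutting with boxes makes the measures finite, as needed to conclude from
      \<open>q * |E| \<le> p * |E|\<close>.\<close>
    unfolding negligible_on_intervals[of "oscillation_set f 1 p q"]
  proof (intro allI)
    fix a b :: real
    define E where "E = oscillation_set f 1 p q \<inter> cbox a b"
    have Eb: "E \<in> sets borel" using oscillation_set_borel[OF cont] by (simp add: E_def)
    have Em: "E \<in> lmeasurable"
      using Eb by (intro bounded_set_imp_lmeasurable) (auto simp: E_def intro: bounded_subset)
    have "f ` E = g -` E" using gf fg by (auto simp: image_iff) (metis fg)
    moreover have "g -` E \<in> sets borel"
      using measurable_sets[OF borel_measurable_continuous_onI[OF lipschitz_on_continuous_on[OF glip]] Eb] by simp
    moreover have "bounded (f ` E)"
      by (rule bounded_subset[OF compact_imp_bounded[OF compact_continuous_image[of "cbox a b" f]]])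
         (auto simp: E_def intro: continuous_on_subset[OF cont])
    ultimately have fEm: "f ` E \<in> lmeasurable"
      by (intro bounded_set_imp_lmeasurable) auto
    show "negligible (oscillation_set f 1 p q \<inter> cbox a b)"
    proof (cases "E = {}")
      case True then show ?thesis by (simp add: E_def)
    next
      case False
      have slope: "1 \<le> (f (x + h) - f x) / h" if "h \<noteq> 0" for x h
        using lo[of x "x + h"] lo[of "x + h" x] that by (cases "h > 0") (auto simp: field_simps)
      have osc: "\<exists>h. h \<noteq> 0 \<and> \<bar>h\<bar> < d \<and> (f (x + h) - f x) / h < p" "\<exists>h. h \<noteq> 0 \<and> \<bar>h\<bar> < d \<and> (f (x + h) - f x) / h > q"
        if "x \<in> E" "d > 0" for x d
        using that by (auto simp: E_def oscillation_set_def)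
      \<comment> \<open>All slopes are at least 1, so a nonempty \<open>E\<close> forces
        \<open>p > 1\<close>, and \<open>1 / q\<close> is positive.\<close>
      have p: "p > 1" using False osc(1)[of _ 1] slope by (metis ex_in_conv le_less_trans zero_less_one)
      have q: "q > 0" using p pq by simp
      have 1: "measure lebesgue (f ` E) \<le> p * measure lebesgue E"
        using p osc(1) by (intro measure_image_le_of_small_slopes[OF mono null[OF _ lip] Em fEm]) auto
      have "measure lebesgue (g ` f ` E) \<le> (1 / q) * measure lebesgue (f ` E)"
      proof (rule measure_image_le_of_small_slopes[OF gmono null[OF _ glip] fEm])
        show "g ` f ` E \<in> lmeasurable" using Em by (simp add: image_image gf)
        fix y d :: real assume "y \<in> f ` E" "d > 0"
        then obtain x where x: "x \<in> E" "y = f x" by auto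
        \<comment> \<open>A large slope of \<open>f\<close> from \<open>x\<close> to
          \<open>x + h\<close> is a small slope of the inverse from \<open>f x\<close> to
          \<open>f x + k\<close>; the bound \<open>d / M\<close> keeps \<open>k\<close> below
          \<open>d\<close>.\<close>
        obtain h where h: "h \<noteq> 0" "\<bar>h\<bar> < d / M" "(f (x + h) - f x) / h > q"
          using osc(2)[OF x(1), of "d / M"] \<open>d > 0\<close> M by auto
        define k where "k = f (x + h) - f x"
        have kh: "k / h > q" using h(3) by (simp add: k_def)
        have "k \<noteq> 0" using abs_lo[of "x + h" x] h(1) by (auto simp: k_def)
        moreover have "\<bar>k\<bar> < d"
          using abs_hi[of "x + h" x] h(2) M by (simp add: k_def field_simps)
        moreover have "(g (y + k) - g y) / k < 1 / q"
        proof -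
          have "(g (y + k) - g y) / k = 1 / (k / h)" by (simp add: x(2) k_def gf)
          also have "\<dots> < 1 / q"
            using less_trans[OF q kh] q kh by (intro divide_strict_left_mono mult_pos_pos) simp_all
          finally show ?thesis .
        qed
        ultimately show "\<exists>h. h \<noteq> 0 \<and> \<bar>h\<bar> < d \<and> (g (y + h) - g y) / h < 1 / q" by blast
      qed (use q in auto)
      then have "q * measure lebesgue E \<le> measure lebesgue (f ` E)"
        using q by (simp add: image_image gf field_simps)
      with 1 have "(q - p) * measure lebesgue E \<le> 0" by (simp add: algebra_simps)
      then have "measure lebesgue E = 0"
        using pq by (simp add: mult_le_0_iff measure_le_0_iff)
      then show ?thesis using Em by (simp add: negligible_iff_measure0 E_def)
    qed
  qed
qed

text \<open>Adding \<open>(L + 1) * x\<close> shifts all difference quotients by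
  \<open>L + 1\<close>. The slopes then lie between \<open>1\<close> and \<open>2 * L + 1\<close>,
  and the oscillation set only changes its thresholds.\<close>

lemma negligible_oscillation_set_real:
  fixes f :: "real \<Rightarrow> real"
  assumes f: "L-lipschitz_on UNIV f" and pq: "p < q"
  shows "negligible (oscillation_set f 1 p q)"
proof -
  define g where "g x = f x + (L + 1) * x" for x
  have "\<bar>f y - f x\<bar> \<le> L * \<bar>y - x\<bar>" for x y
    using lipschitz_onD[OF f, of y x] by (simp add: dist_real_def)
  then have 1: "\<bar>f y - f x\<bar> \<le> L * (y - x)" if "x \<le> y" for x y using that by (metis abs_of_nonneg diff_ge_0_iff_ge)
  have "negligible (oscillation_set g 1 (p + (L + 1)) (q + (L + 1)))"
  proof (rule negligible_oscillation_set_bilipschitz)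
    fix x y :: real assume "x \<le> y"
    from 1[OF this] show "y - x \<le> g y - g x" "g y - g x \<le> (2 * L + 1) * (y - x)"
      by (auto simp: g_def abs_le_iff algebra_simps)
  qed (use pq in simp)
  moreover have quot: "(g (x + h) - g x) / h = (f (x + h) - f x) / h + (L + 1)" if "h \<noteq> 0" for x h
    using that by (simp add: g_def field_simps)
  have "oscillation_set g 1 (p + (L + 1)) (q + (L + 1)) = oscillation_set f 1 p q"
    unfolding oscillation_set_def by (auto simp: quot cong: conj_cong)
  ultimately show ?thesis by simp
qed

section \<open>Null sets along parallel segments\<close>

lemma negligible_imp_null_borel:
  assumes "negligible S"
  obtains S' where "S \<subseteq> S'" "S' \<in> sets borel" "emeasure lborel S' = 0"
proof -
  have "AE x in lborel. x \<notin> S"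
    using assms AE_lebesgue_iff_negligible[of "\<lambda>x. x \<notin> S"] by (simp add: AE_completion_iff)
  then obtain N where "{x \<in> space lborel. \<not> x \<notin> S} \<subseteq> N" "emeasure lborel N = 0" "N \<in> sets lborel"
    by (rule AE_E)
  then show ?thesis by (intro that[of N]) auto
qed

text \<open>After exchanging the integrals, the inner one is the measure of a translate of
  \<open>S\<close>, and the parameter runs through an interval of length 1.\<close>

lemma nn_integral_lines:
  fixes S :: "'a::euclidean_space set"
  assumes S[measurable]: "S \<in> sets borel"
  shows "(\<integral>\<^sup>+ x. emeasure lborel {s \<in> {0..1::real}. x + s *\<^sub>R v \<in> S} \<partial>lborel) = emeasure lborel S"
proof -
  have "(\<integral>\<^sup>+ x. emeasure lborel {s \<in> {0..1::real}. x + s *\<^sub>R v \<in> S} \<partial>lborel)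
      = (\<integral>\<^sup>+ x. (\<integral>\<^sup>+ s. indicator {0..1::real} s * indicator S (x + s *\<^sub>R v) \<partial>lborel) \<partial>lborel)"
  proof (intro nn_integral_cong)
    fix x
    have m: "{s \<in> {0..1::real}. x + s *\<^sub>R v \<in> S} \<in> sets lborel" by measurable
    have "emeasure lborel {s \<in> {0..1::real}. x + s *\<^sub>R v \<in> S}
      = (\<integral>\<^sup>+ s. indicator {s \<in> {0..1::real}. x + s *\<^sub>R v \<in> S} s \<partial>lborel)" using m by simp
    also have "\<dots> = (\<integral>\<^sup>+ s. indicator {0..1::real} s * indicator S (x + s *\<^sub>R v) \<partial>lborel)"
      by (intro nn_integral_cong) (auto split: split_indicator)
    finally show "emeasure lborel {s \<in> {0..1::real}. x + s *\<^sub>R v \<in> S} =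
      (\<integral>\<^sup>+ s. indicator {0..1::real} s * indicator S (x + s *\<^sub>R v) \<partial>lborel)" .
  qed
  also have "\<dots> = (\<integral>\<^sup>+ s. (\<integral>\<^sup>+ x. indicator {0..1::real} s * indicator S (x + s *\<^sub>R v) \<partial>lborel) \<partial>lborel)"
    by (rule lborel_pair.Fubini'[symmetric]) measurable
  also have "\<dots> = (\<integral>\<^sup>+ s. indicator {0..1::real} s * emeasure lborel S \<partial>lborel)"
  proof (intro nn_integral_cong)
    fix s :: real
    have "(\<integral>\<^sup>+ x. indicator S (x + s *\<^sub>R v) \<partial>lborel) = (\<integral>\<^sup>+ x. indicator S x \<partial>distr lborel borel ((+) (s *\<^sub>R v)))"
      by (subst nn_integral_distr) (auto simp: add.commute)
    also have "\<dots> = emeasure lborel S" by (simp add: lborel_distr_plus)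
    finally show "(\<integral>\<^sup>+ x. indicator {0..1::real} s * indicator S (x + s *\<^sub>R v) \<partial>lborel)
        = indicator {0..1::real} s * emeasure lborel S"
      by (subst nn_integral_cmult) auto
  qed
  also have "\<dots> = emeasure lborel S"
    by (simp add: nn_integral_multc)
  finally show ?thesis .
qed

lemma negligible_if_negligible_lines:
  fixes S :: "'a::euclidean_space set"
  assumes S: "S \<in> sets borel" and lines: "\<And>x. negligible {s::real. x + s *\<^sub>R v \<in> S}"
  shows "negligible S"
proof -
  have "emeasure lborel {s \<in> {0..1::real}. x + s *\<^sub>R v \<in> S} = 0" for x
  proof -
    have m: "{s \<in> {0..1::real}. x + s *\<^sub>R v \<in> S} \<in> sets borel" using S by measurable
    have "negligible {s \<in> {0..1::real}. x + s *\<^sub>R v \<in> S}"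
      by (rule negligible_subset[OF lines[of x]]) auto
    then show ?thesis using m by (simp add: negligible_iff_emeasure0)
  qed
  then have "emeasure lborel S = 0" using nn_integral_lines[OF S, of v] by simp
  then show ?thesis using S by (simp add: negligible_iff_emeasure0)
qed

text \<open>The slices of a Borel null superset have integral zero over all base points, so almost
  all of them are null. The superset makes the measure of a slice a measurable function of the base
  point.\<close>

lemma negligible_lines:
  fixes S :: "'a::euclidean_space set"
  assumes "negligible S"
  shows "negligible {x. \<not> negligible {s \<in> {0..1::real}. x + s *\<^sub>R v \<in> S}}"
proof -
  obtain S' where S': "S \<subseteq> S'" "S' \<in> sets borel" "emeasure lborel S' = 0"
    using negligible_imp_null_borel[OF assms] by blast
  note S'(2)[measurable]
  have m: "(\<lambda>x. emeasure lborel {s \<in> {0..1::real}. x + s *\<^sub>R v \<in> S'}) \<in> borel_measurable lborel"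
  proof -
    have "(\<lambda>x. emeasure lborel {s \<in> {0..1::real}. x + s *\<^sub>R v \<in> S'}) =
      (\<lambda>x. emeasure lborel (Pair x -` {p :: 'a \<times> real. snd p \<in> {0..1} \<and> fst p + snd p *\<^sub>R v \<in> S'}))"
      by (intro ext arg_cong2[of _ _ _ _ emeasure] refl) auto
    moreover have "{p :: 'a \<times> real. snd p \<in> {0..1} \<and> fst p + snd p *\<^sub>R v \<in> S'} \<in> sets (lborel \<Otimes>\<^sub>M lborel)"
    proof -
      have "{p \<in> space (lborel \<Otimes>\<^sub>M lborel). snd (p :: 'a \<times> real) \<in> {0..1} \<and> fst p + snd p *\<^sub>R v \<in> S'} \<in> sets (lborel \<Otimes>\<^sub>M lborel)"
        by measurable
      then show ?thesis by (simp add: space_pair_measure)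
    qed
    ultimately show ?thesis by (simp add: lborel.measurable_emeasure_Pair)
  qed
  have "AE x in lborel. emeasure lborel {s \<in> {0..1::real}. x + s *\<^sub>R v \<in> S'} = 0"
    using nn_integral_lines[OF S'(2), of v] S'(3) m by (simp add: nn_integral_0_iff_AE)
  then have "AE x in lebesgue. emeasure lborel {s \<in> {0..1::real}. x + s *\<^sub>R v \<in> S'} = 0"
    by (rule AE_completion)
  then have "AE x in lebesgue. negligible {s \<in> {0..1::real}. x + s *\<^sub>R v \<in> S}"
  proof eventually_elim
    case (elim x)
    have m: "{s \<in> {0..1::real}. x + s *\<^sub>R v \<in> S'} \<in> sets borel" by measurable
    have "negligible {s \<in> {0..1::real}. x + s *\<^sub>R v \<in> S'}"
      using elim m by (simp add: negligible_iff_emeasure0)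
    then show ?case by (rule negligible_subset) (use S' in auto)
  qed
  then show ?thesis by (simp add: AE_lebesgue_iff_negligible)
qed

text \<open>On every line in direction \<open>v\<close> the set becomes a one-dimensional
  oscillation set of a function with Lipschitz constant \<open>L * norm v\<close>.\<close>

lemma negligible_oscillation_set:
  fixes f :: "'a::euclidean_space \<Rightarrow> real"
  assumes f: "L-lipschitz_on UNIV f" and pq: "p < q"
  shows "negligible (oscillation_set f v p q)"
proof (rule negligible_if_negligible_lines)
  show "oscillation_set f v p q \<in> sets borel"
    using f by (intro oscillation_set_borel lipschitz_on_continuous_on)
  fix x
  have "{s. x + s *\<^sub>R v \<in> oscillation_set f v p q} = oscillation_set (\<lambda>s. f (x + s *\<^sub>R v)) 1 p q"
    by (simp add: oscillation_set_def algebra_simps)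
  moreover have "(L * norm v)-lipschitz_on UNIV (\<lambda>s. f (x + s *\<^sub>R v))"
  proof (rule lipschitz_onI)
    fix s t :: real
    have "dist (f (x + s *\<^sub>R v)) (f (x + t *\<^sub>R v)) \<le> L * dist (x + s *\<^sub>R v) (x + t *\<^sub>R v)"
      by (rule lipschitz_onD[OF f]) auto
    also have "dist (x + s *\<^sub>R v) (x + t *\<^sub>R v) = norm v * dist s t"
      by (simp add: dist_norm flip: scaleR_diff_left)
    finally show "dist (f (x + s *\<^sub>R v)) (f (x + t *\<^sub>R v)) \<le> L * norm v * dist s t" by simp
  qed (use lipschitz_on_nonneg[OF f] in simp)
  ultimately show "negligible {s. x + s *\<^sub>R v \<in> oscillation_set f v p q}"
    using negligible_oscillation_set_real[OF _ pq] by metis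
qed

section \<open>Existence and linearity of directional derivatives\<close>

abbreviation directional_limit :: "('a::real_normed_vector \<Rightarrow> real) \<Rightarrow> 'a \<Rightarrow> 'a \<Rightarrow> real \<Rightarrow> bool" where
  "directional_limit f x v d \<equiv> ((\<lambda>h. (f (x + h *\<^sub>R v) - f x) / h) \<longlongrightarrow> d) (at 0)"

lemma directional_quotient_bound:
  fixes f :: "'a::real_normed_vector \<Rightarrow> real"
  assumes "L-lipschitz_on UNIV f"
  shows "\<bar>(f (x + h *\<^sub>R v) - f x) / h\<bar> \<le> L * norm v"
proof (cases "h = 0")
  case False
  have "\<bar>f (x + h *\<^sub>R v) - f x\<bar> \<le> L * (\<bar>h\<bar> * norm v)"
    using lipschitz_onD[OF assms, of "x + h *\<^sub>R v" x] by (simp add: dist_norm)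
  then show ?thesis using False by (simp add: abs_divide field_simps)
qed (use lipschitz_on_nonneg[OF assms] in simp)

lemma directional_limit_exists:
  fixes f :: "'a::real_normed_vector \<Rightarrow> real"
  assumes f: "L-lipschitz_on UNIV f"
    and x: "\<And>p q. p \<in> \<rat> \<Longrightarrow> q \<in> \<rat> \<Longrightarrow> p < q \<Longrightarrow> x \<notin> oscillation_set f v p q"
  shows "\<exists>d. directional_limit f x v d"
proof -
  define Q where "Q h = (f (x + h *\<^sub>R v) - f x) / h" for h
  define M where "M = L * norm v"
  have Q: "\<bar>Q h\<bar> \<le> M" for h using directional_quotient_bound[OF f] by (simp add: Q_def M_def)
  \<comment> \<open>\<open>Sup S\<close> is the lower limit of the quotients at 0, and the
    boundedness of \<open>Q\<close> makes it finite.\<close>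
  define S where "S = {q. eventually (\<lambda>h. Q h \<ge> q) (at 0)}"
  have S0: "- M \<in> S" using Q unfolding S_def by (auto simp: abs_le_iff intro!: always_eventually) (smt (verit) Q)
  have ub: "q \<le> M" if "q \<in> S" for q
  proof -
    from that obtain h where "Q h \<ge> q"
      using eventually_happens'[of "at (0::real)" "\<lambda>h. Q h \<ge> q"] by (auto simp: S_def)
    then show ?thesis using Q[of h] by simp
  qed
  have bdd: "bdd_above S" using ub by (rule bdd_aboveI)
  have freq: "\<exists>h. h \<noteq> 0 \<and> \<bar>h\<bar> < d \<and> P h" if "frequently P (at 0)" "d > 0" for P :: "real \<Rightarrow> bool" and d
    using that unfolding frequently_at by (auto simp: dist_real_def)
  have "(Q \<longlongrightarrow> Sup S) (at 0)"
  proof (rule order_tendstoI)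
    fix a assume "a < Sup S"
    then obtain q where q: "q \<in> S" "a < q" using less_cSupD[of S a] S0 by auto
    then have "eventually (\<lambda>h. Q h \<ge> q) (at 0)" by (simp add: S_def)
    then show "eventually (\<lambda>h. a < Q h) (at 0)" by eventually_elim (use q in simp)
  next
    fix a assume a: "Sup S < a"
    show "eventually (\<lambda>h. Q h < a) (at 0)"
    proof (rule ccontr)
      assume "\<not> eventually (\<lambda>h. Q h < a) (at 0)"
      then have fr: "frequently (\<lambda>h. Q h \<ge> a) (at 0)" by (simp add: frequently_def not_le)
      \<comment> \<open>Two rationals between the lower limit and \<open>a\<close>: the quotients
        exceed \<open>q\<close> frequently because they frequently reach \<open>a\<close>, and they
        fall below \<open>p\<close> frequently because \<open>p\<close> is not in
        \<open>S\<close>.\<close>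
      obtain q where q: "q \<in> \<rat>" "Sup S < q" "q < a" using Rats_dense_in_real[OF a] by auto
      obtain p where p: "p \<in> \<rat>" "Sup S < p" "p < q" using Rats_dense_in_real[OF q(2)] by auto
      have "p \<notin> S" using cSup_upper[OF _ bdd, of p] p by auto
      then have fr2: "frequently (\<lambda>h. Q h < p) (at 0)" by (simp add: S_def frequently_def not_less)
      have "x \<in> oscillation_set f v p q"
        unfolding oscillation_set_def
      proof (intro mem_Collect_eq[THEN iffD2] allI impI conjI)
        fix d :: real assume d: "d > 0"
        show "\<exists>h. h \<noteq> 0 \<and> \<bar>h\<bar> < d \<and> (f (x + h *\<^sub>R v) - f x) / h < p"
          using freq[OF fr2 d] by (simp add: Q_def)
        show "\<exists>h. h \<noteq> 0 \<and> \<bar>h\<bar> < d \<and> q < (f (x + h *\<^sub>R v) - f x) / h"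
          using freq[OF fr d] q(3) less_le_trans unfolding Q_def by blast
      qed
      with x[OF p(1) q(1) p(3)] show False by simp
    qed
  qed
  then show ?thesis by (auto simp: Q_def[abs_def])
qed

lemma AE_directional_limit:
  fixes f :: "'a::euclidean_space \<Rightarrow> real"
  assumes f: "L-lipschitz_on UNIV f"
  shows "AE x in lebesgue. \<exists>d. directional_limit f x v d"
proof -
  have c: "countable {(p, q) \<in> \<rat> \<times> \<rat> :: (real \<times> real) set. p < q}"
    by (rule countable_subset[of _ "\<rat> \<times> \<rat>"]) (auto simp: countable_rat)
  have "negligible (\<Union>(p, q)\<in>{(p, q) \<in> \<rat> \<times> \<rat>. p < q}. oscillation_set f v p q)"
    using negligible_oscillation_set[OF f] c by (intro negligible_countable_Union countable_image) auto
  then show ?thesis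
    unfolding AE_lebesgue_iff_negligible
  proof (rule negligible_subset, intro subsetI)
    fix x assume "x \<in> {x. \<not> (\<exists>d. directional_limit f x v d)}"
    then obtain p q where "p \<in> \<rat>" "q \<in> \<rat>" "p < q" "x \<in> oscillation_set f v p q"
      using directional_limit_exists[OF f, of x v] by blast
    then show "x \<in> (\<Union>(p, q)\<in>{(p, q) \<in> \<rat> \<times> \<rat>. p < q}. oscillation_set f v p q)" by blast
  qed
qed

lemma directional_limit_scale:
  assumes "directional_limit f x v d"
  shows "directional_limit f x (c *\<^sub>R v) (c * d)"
proof (cases "c = 0")
  case True
  have "((\<lambda>h. 0 / h) \<longlongrightarrow> 0) (at (0::real))" by simp
  then show ?thesis using True by simp
next
  case False
  have "filterlim (\<lambda>h. h * c) (at 0) (at (0::real))"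
    using False by (intro filterlim_atI tendsto_eq_intros) (auto simp: eventually_at_filter)
  from filterlim_compose[OF assms this]
  have "((\<lambda>h. c * ((f (x + (h * c) *\<^sub>R v) - f x) / (h * c))) \<longlongrightarrow> c * d) (at 0)"
    by (intro tendsto_intros)
  then show ?thesis using False by simp
qed

text \<open>Lebesgue measure is determined by its values on boxes. The density
  \<open>1 + w / (C + 1)\<close>, which is nonnegative by the bound on \<open>w\<close>, gives every
  box its volume; hence it defines Lebesgue measure and equals 1 almost everywhere.\<close>

lemma AE_zero_of_box_integrals:
  fixes w :: "'a::euclidean_space \<Rightarrow> real"
  assumes w[measurable]: "w \<in> borel_measurable lborel" and C: "\<And>x. \<bar>w x\<bar> \<le> C"
    and int0: "\<And>a b. (\<integral>x. indicator (box a b) x * w x \<partial>lborel) = 0"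
  shows "AE x in lborel. w x = 0"
proof -
  have C0: "C + 1 > 0" using C[of 0] by (smt (verit))
  define k where "k x = 1 + w x / (C + 1)" for x
  have k[measurable]: "k \<in> borel_measurable lborel" by (simp add: k_def[abs_def])
  have k0: "0 \<le> k x" "k x \<le> 2" for x
  proof -
    have "\<bar>w x / (C + 1)\<bar> \<le> 1" using C[of x] C0 by (simp add: abs_divide)
    then show "0 \<le> k x" "k x \<le> 2" unfolding k_def by linarith+
  qed
  have "lborel = density lborel (\<lambda>x. ennreal (k x))"
  proof (rule lborel_eqI)
    fix l u :: 'a assume lu: "\<And>b. b \<in> Basis \<Longrightarrow> l \<bullet> b \<le> u \<bullet> b"
    have fin: "emeasure lborel (box l u) < \<infinity>" by (simp add: emeasure_lborel_box_eq)
    have ind: "integrable lborel (indicator (box l u) :: 'a \<Rightarrow> real)" using fin by simp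
    have iw: "integrable lborel (\<lambda>x. indicator (box l u) x * w x)"
      by (rule Bochner_Integration.integrable_bound[OF integrable_mult_right[OF ind, of C]])
         (use C in \<open>auto simp: abs_mult split: split_indicator intro: order_trans[OF C abs_ge_self]\<close>)
    have "emeasure (density lborel (\<lambda>x. ennreal (k x))) (box l u)
        = (\<integral>\<^sup>+ x. ennreal (indicator (box l u) x + indicator (box l u) x * w x / (C + 1)) \<partial>lborel)"
      by (subst emeasure_density) (auto intro!: nn_integral_cong simp: k_def split: split_indicator)
    also have "\<dots> = ennreal (\<integral>x. indicator (box l u) x + indicator (box l u) x * w x / (C + 1) \<partial>lborel)"
    proof (rule nn_integral_eq_integral)
      show "integrable lborel (\<lambda>x. indicator (box l u) x + indicator (box l u) x * w x / (C + 1))"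
        using ind iw by auto
      show "AE x in lborel. 0 \<le> indicator (box l u) x + indicator (box l u) x * w x / (C + 1)"
        using k0(1) by (auto simp: k_def split: split_indicator)
    qed
    also have "(\<integral>x. indicator (box l u) x + indicator (box l u) x * w x / (C + 1) \<partial>lborel) = measure lborel (box l u)"
      using ind iw int0[of l u] by (subst Bochner_Integration.integral_add) auto
    also have "ennreal \<dots> = (\<Prod>b\<in>Basis. (u - l) \<bullet> b)"
      using lu fin by (simp add: emeasure_lborel_box flip: emeasure_eq_ennreal_measure)
    finally show "emeasure (density lborel (\<lambda>x. ennreal (k x))) (box l u) = (\<Prod>b\<in>Basis. (u - l) \<bullet> b)" .
  qed simp
  then have "density lborel (\<lambda>x::'a. ennreal (k x)) = density lborel (\<lambda>x. 1)"
    by (simp add: density_1)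
  then have "AE x in lborel. ennreal (k x) = 1"
    by (subst (asm) sigma_finite_measure.density_unique_iff[OF sigma_finite_lborel]) auto
  then show ?thesis
  proof eventually_elim
    case (elim x)
    then have "k x = 1" using k0[of x] by (simp add: ennreal_eq_1)
    then show ?case using C0 by (simp add: k_def)
  qed
qed

lemma lborel_integral_translation:
  fixes F :: "'a::euclidean_space \<Rightarrow> real"
  assumes "F \<in> borel_measurable borel"
  shows "(\<integral>x. F (c + x) \<partial>lborel) = (\<integral>x. F x \<partial>lborel)"
  using assms integral_distr[of "(+) c" lborel borel F] by (simp add: lborel_distr_plus)

text \<open>The quotient for \<open>u + v\<close> minus those for \<open>u\<close> and
  \<open>v\<close> equals the quotient for \<open>v\<close> at \<open>x + h n *\<^sub>R u\<close>
  minus the one at \<open>x\<close>. Integrated over a box, this shift moves to the indicator of the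
  box and the integral tends to 0. So the almost everywhere limit of these second differences has
  zero integral over every box and vanishes almost everywhere.\<close>

lemma AE_directional_limit_add:
  fixes f :: "'a::euclidean_space \<Rightarrow> real"
  assumes f: "L-lipschitz_on UNIV f"
  shows "AE x in lebesgue. \<forall>d1 d2 d3. directional_limit f x u d1 \<longrightarrow> directional_limit f x v d2 \<longrightarrow>
    directional_limit f x (u + v) d3 \<longrightarrow> d3 = d1 + d2"
proof -
  define h where "h n = inverse (real (Suc n))" for n
  have h0: "h n > 0" "h n \<le> 1" for n by (auto simp: h_def inverse_le_1_iff)
  have h_lim: "h \<longlonglongrightarrow> 0" unfolding h_def by (rule LIMSEQ_inverse_real_of_nat)
  have h_at: "filterlim h (at 0) sequentially"
    using h_lim h0(1) by (auto simp: filterlim_at less_le)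
  define g where "g n v x = (f (x + h n *\<^sub>R v) - f x) / h n" for n v x
  have fm[measurable]: "f \<in> borel_measurable borel"
    by (intro borel_measurable_continuous_onI lipschitz_on_continuous_on[OF f])
  have gm[measurable]: "g n v \<in> borel_measurable borel" for n v unfolding g_def[abs_def] by measurable
  have gb: "\<bar>g n v x\<bar> \<le> L * norm v" for n v x unfolding g_def by (rule directional_quotient_bound[OF f])
  define w where "w n x = g n v (h n *\<^sub>R u + x) - g n v x" for n x
  have w_eq: "w n x = g n (u + v) x - g n u x - g n v x" for n x
    by (simp add: w_def g_def scaleR_add_right add_ac diff_divide_distrib)
  have wm[measurable]: "w n \<in> borel_measurable borel" for n unfolding w_def[abs_def] by measurable
  define C where "C = 2 * (L * norm v)"
  have wb: "\<bar>w n x\<bar> \<le> C" for n x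
    using gb[of n v "h n *\<^sub>R u + x"] gb[of n v x] unfolding w_def C_def by linarith
  \<comment> \<open>Where the sequence diverges, \<open>lim\<close> is an unspecified number; the
    clamp makes \<open>W\<close> bounded everywhere and changes nothing where the limit
    exists.\<close>
  define W where "W x = max (- C) (min C (lim (\<lambda>n. w n x)))" for x
  have Wm[measurable]: "W \<in> borel_measurable borel" unfolding W_def[abs_def] by measurable
  have C0: "0 \<le> C" using wb[of 0 0] by linarith
  have Wb: "\<bar>W x\<bar> \<le> C" for x using C0 by (auto simp: W_def)
  have glim: "(\<lambda>n. g n v x) \<longlonglongrightarrow> d" if "directional_limit f x v d" for x v d
    using filterlim_compose[OF that h_at] by (simp add: g_def)
  have wlim: "(\<lambda>n. w n x) \<longlonglongrightarrow> d3 - d1 - d2" and Wd: "W x = d3 - d1 - d2"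
    if "directional_limit f x u d1" "directional_limit f x v d2" "directional_limit f x (u + v) d3"
    for x d1 d2 d3
  proof -
    show l: "(\<lambda>n. w n x) \<longlonglongrightarrow> d3 - d1 - d2"
      unfolding w_eq by (intro tendsto_diff glim that)
    have "\<bar>d3 - d1 - d2\<bar> \<le> C"
      by (rule Lim_bounded[OF tendsto_rabs[OF l], of 0]) (use wb in auto)
    then show "W x = d3 - d1 - d2" using limI[OF l] by (auto simp: W_def abs_le_iff)
  qed
  have Wlim: "AE x in lborel. (\<lambda>n. w n x) \<longlonglongrightarrow> W x"
  proof -
    have "AE x in lebesgue. (\<lambda>n. w n x) \<longlonglongrightarrow> W x"
      using AE_directional_limit[OF f, of u] AE_directional_limit[OF f, of v]
        AE_directional_limit[OF f, of "u + v"]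
    proof eventually_elim
      case (elim x)
      then obtain d1 d2 d3 where "directional_limit f x u d1" "directional_limit f x v d2"
        "directional_limit f x (u + v) d3" by blast
      then show ?case using wlim[of x d1 d2 d3] Wd[of x d1 d2 d3] by simp
    qed
    then show ?thesis by (simp add: AE_completion_iff)
  qed
  have "AE x in lborel. W x = 0"
  proof (rule AE_zero_of_box_integrals[OF _ Wb])
    fix a b :: 'a
    let ?I = "indicator (box a b) :: 'a \<Rightarrow> real"
    have I0: "integrable lborel ?I"
      using emeasure_lborel_box_finite[of a b] by (simp add: top.not_eq_extremum)
    then have Ii: "integrable lborel (\<lambda>x. ?I x * k)" for k by (rule integrable_mult_left)
    have lim1: "(\<lambda>n. \<integral>x. ?I x * w n x \<partial>lborel) \<longlonglongrightarrow> (\<integral>x. ?I x * W x \<partial>lborel)"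
    proof (rule integral_dominated_convergence[where w = "\<lambda>x. ?I x * C"])
      show "AE x in lborel. (\<lambda>n. ?I x * w n x) \<longlonglongrightarrow> ?I x * W x"
        using Wlim by eventually_elim (intro tendsto_intros)
      show "AE x in lborel. norm (?I x * w n x) \<le> ?I x * C" for n
        using wb by (auto simp: abs_mult split: split_indicator)
    qed (use I0 in auto)
    obtain R where "\<forall>x\<in>box a b. norm x \<le> R" using bounded_box unfolding bounded_iff by blast
    then have R: "box a b \<subseteq> cball 0 R" by auto
    \<comment> \<open>A common dominating set: as \<open>h n \<le> 1\<close>, it contains the box
      and all its shifts by \<open>h n *\<^sub>R u\<close>.\<close>
    define J where "J = (indicator (cball 0 (R + norm u)) :: 'a \<Rightarrow> real)"
    have J0: "integrable lborel J"
      unfolding J_def using emeasure_bounded_finite[OF bounded_cball, of "0::'a" "R + norm u"] by simp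
    then have Ji: "integrable lborel (\<lambda>x. J x * k)" for k by (rule integrable_mult_left)
    have eq: "(\<integral>x. ?I x * w n x \<partial>lborel) = (\<integral>x. (?I (x - h n *\<^sub>R u) - ?I x) * g n v x \<partial>lborel)" for n
    proof -
      have i1: "integrable lborel (\<lambda>x. ?I x * g n v x)"
        by (rule Bochner_Integration.integrable_bound[OF Ii[of "L * norm v"]])
           (use gb lipschitz_on_nonneg[OF f] in \<open>auto simp: abs_mult split: split_indicator\<close>)
      have i2: "integrable lborel (\<lambda>x. ?I x * g n v (h n *\<^sub>R u + x))"
        by (rule Bochner_Integration.integrable_bound[OF Ii[of "L * norm v"]])
           (use gb lipschitz_on_nonneg[OF f] in \<open>auto simp: abs_mult split: split_indicator\<close>)
      have i3: "integrable lborel (\<lambda>x. ?I (x - h n *\<^sub>R u) * g n v x)"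
      proof (rule Bochner_Integration.integrable_bound[OF Ji[of "L * norm v"]])
        show "AE x in lborel. norm (?I (x - h n *\<^sub>R u) * g n v x) \<le> norm (J x * (L * norm v))"
        proof (intro AE_I2)
          fix x
          have "J x = 1" if "x - h n *\<^sub>R u \<in> box a b"
          proof -
            have "norm (x - h n *\<^sub>R u) \<le> R" using R that by auto
            moreover have "norm (h n *\<^sub>R u) \<le> norm u" using h0[of n] by (simp add: mult_left_le_one_le)
            ultimately have "norm x \<le> R + norm u"
              using norm_triangle_sub[of x "h n *\<^sub>R u"] by linarith
            then show ?thesis by (simp add: J_def)
          qed
          then show "norm (?I (x - h n *\<^sub>R u) * g n v x) \<le> norm (J x * (L * norm v))"
            using gb[of n v x] lipschitz_on_nonneg[OF f] by (auto simp: abs_mult split: split_indicator)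
        qed
      qed measurable
      have "(\<integral>x. ?I x * w n x \<partial>lborel) = (\<integral>x. ?I x * g n v (h n *\<^sub>R u + x) \<partial>lborel) - (\<integral>x. ?I x * g n v x \<partial>lborel)"
        unfolding w_def right_diff_distrib by (rule Bochner_Integration.integral_diff[OF i2 i1])
      also have "(\<integral>x. ?I x * g n v (h n *\<^sub>R u + x) \<partial>lborel)
          = (\<integral>x. ?I (h n *\<^sub>R u + x - h n *\<^sub>R u) * g n v (h n *\<^sub>R u + x) \<partial>lborel)" by simp
      also have "\<dots> = (\<integral>x. ?I (x - h n *\<^sub>R u) * g n v x \<partial>lborel)"
        by (rule lborel_integral_translation[of "\<lambda>x. ?I (x - h n *\<^sub>R u) * g n v x"]) measurable
      also have "\<dots> - (\<integral>x. ?I x * g n v x \<partial>lborel) = (\<integral>x. (?I (x - h n *\<^sub>R u) - ?I x) * g n v x \<partial>lborel)"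
        unfolding left_diff_distrib by (rule Bochner_Integration.integral_diff[OF i3 i1, symmetric])
      finally show ?thesis .
    qed
    have lim2: "(\<lambda>n. \<integral>x. (?I (x - h n *\<^sub>R u) - ?I x) * g n v x \<partial>lborel) \<longlonglongrightarrow> (\<integral>x. 0 \<partial>(lborel :: 'a measure))"
    proof (rule integral_dominated_convergence[where w = "\<lambda>x. J x * (L * norm v)"])
      \<comment> \<open>Off the frontier of the box a small shift does not change the
        indicator.\<close>
      have fr: "AE x in lborel. x \<notin> cbox a b - box a b"
      proof -
        have "AE x in lebesgue. x \<notin> cbox a b - box a b"
          unfolding AE_lebesgue_iff_negligible
          by (rule negligible_subset[OF negligible_frontier_interval[of a b]]) auto
        then show ?thesis by (simp only: AE_completion_iff)
      qed
      then show "AE x in lborel. (\<lambda>n. (?I (x - h n *\<^sub>R u) - ?I x) * g n v x) \<longlonglongrightarrow> 0"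
      proof eventually_elim
        case (elim x)
        have xl: "(\<lambda>n. x - h n *\<^sub>R u) \<longlonglongrightarrow> x"
          using h_lim by (auto intro!: tendsto_eq_intros)
        have "eventually (\<lambda>n. ?I (x - h n *\<^sub>R u) = ?I x) sequentially"
        proof (cases "x \<in> box a b")
          case True
          have "eventually (\<lambda>n. x - h n *\<^sub>R u \<in> box a b) sequentially"
            using topological_tendstoD[OF xl open_box True] .
          then show ?thesis by eventually_elim (use True in simp)
        next
          case False
          then have "x \<in> - cbox a b" using elim by auto
          then have "eventually (\<lambda>n. x - h n *\<^sub>R u \<in> - cbox a b) sequentially"
            using topological_tendstoD[OF xl, of "- cbox a b"] by (simp add: closed_cbox open_Compl)
          then show ?thesis by eventually_elim (use False box_subset_cbox[of a b] in \<open>auto simp: indicator_def\<close>)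
        qed
        then have "eventually (\<lambda>n. (?I (x - h n *\<^sub>R u) - ?I x) * g n v x = 0) sequentially"
          by eventually_elim simp
        then show ?case by (rule tendsto_eventually)
      qed
      show "AE x in lborel. norm ((?I (x - h n *\<^sub>R u) - ?I x) * g n v x) \<le> J x * (L * norm v)" for n
      proof (intro AE_I2)
        fix x
        have "J x = 1" if "x - h n *\<^sub>R u \<in> box a b \<or> x \<in> box a b"
        proof -
          have "norm (h n *\<^sub>R u) \<le> norm u" using h0[of n] by (simp add: mult_left_le_one_le)
          moreover have "norm (x - h n *\<^sub>R u) \<le> R \<or> norm x \<le> R" using R that by auto
          ultimately have "norm x \<le> R + norm u"
            using norm_triangle_sub[of x "h n *\<^sub>R u"] norm_ge_zero[of u] by linarith
          then show ?thesis by (simp add: J_def)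
        qed
        then show "norm ((?I (x - h n *\<^sub>R u) - ?I x) * g n v x) \<le> J x * (L * norm v)"
          using gb[of n v x] lipschitz_on_nonneg[OF f]
          by (cases "x \<in> box a b"; cases "x - h n *\<^sub>R u \<in> box a b") (auto simp: J_def indicator_def)
      qed
    qed (use J0 in auto)
    have "(\<lambda>n. \<integral>x. ?I x * w n x \<partial>lborel) \<longlonglongrightarrow> 0" using lim2 by (simp add: eq)
    then show "(\<integral>x. ?I x * W x \<partial>lborel) = 0" using lim1 LIMSEQ_unique by blast
  qed measurable
  then have "AE x in lebesgue. W x = 0" by (rule AE_completion)
  then show ?thesis
  proof eventually_elim
    case (elim x)
    show ?case
    proof (intro allI impI)
      fix d1 d2 d3
      assume "directional_limit f x u d1" "directional_limit f x v d2" "directional_limit f x (u + v) d3"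
      then show "d3 = d1 + d2" using Wd[of x d1 d2 d3] elim by simp
    qed
  qed
qed

lemma AE_directional_limit_sum:
  fixes f :: "'a::euclidean_space \<Rightarrow> real"
  assumes f: "L-lipschitz_on UNIV f" and T: "finite T"
  shows "AE x in lebesgue. \<exists>e. (\<forall>b\<in>T. directional_limit f x b (e b)) \<and>
    directional_limit f x (\<Sum>b\<in>T. c b *\<^sub>R b) (\<Sum>b\<in>T. c b * e b)"
  using T
proof (induction T rule: finite_induct)
  case empty
  have "((\<lambda>h. 0 / h) \<longlongrightarrow> 0) (at (0::real))" by simp
  then show ?case by simp
next
  case (insert a T)
  let ?s = "\<Sum>b\<in>T. c b *\<^sub>R b"
  show ?case
    using insert.IH AE_directional_limit[OF f, of a] AE_directional_limit[OF f, of "c a *\<^sub>R a + ?s"]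
      AE_directional_limit_add[OF f, of "c a *\<^sub>R a" ?s]
  proof eventually_elim
    case (elim x)
    obtain e where e: "\<forall>b\<in>T. directional_limit f x b (e b)" "directional_limit f x ?s (\<Sum>b\<in>T. c b * e b)"
      using elim(1) by blast
    obtain d where d: "directional_limit f x a d" using elim(2) by blast
    obtain d' where d': "directional_limit f x (c a *\<^sub>R a + ?s) d'" using elim(3) by blast
    have "d' = c a * d + (\<Sum>b\<in>T. c b * e b)"
      using elim(4) directional_limit_scale[OF d, of "c a"] e(2) d' by blast
    moreover have "(\<Sum>b\<in>T. c b * (e(a := d)) b) = (\<Sum>b\<in>T. c b * e b)"
      using insert.hyps(2) by (intro sum.cong) auto
    ultimately show ?case
      using e(1) d d' insert.hyps by (intro exI[of _ "e(a := d)"]) auto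
  qed
qed

text \<open>The basis directions are included so that uniqueness of limits identifies the vectors
  \<open>g\<close> obtained for different \<open>v\<close> at the same point.\<close>

lemma AE_directional_limit_linear:
  fixes f :: "'a::euclidean_space \<Rightarrow> real"
  assumes f: "L-lipschitz_on UNIV f"
  shows "AE x in lebesgue. \<exists>g. (\<forall>b\<in>Basis. directional_limit f x b (inner b g)) \<and> directional_limit f x v (inner v g)"
  using AE_directional_limit_sum[OF f finite_Basis, of "\<lambda>b. inner v b"]
proof eventually_elim
  case (elim x)
  then obtain e where e: "\<forall>b\<in>Basis. directional_limit f x b (e b)"
    "directional_limit f x (\<Sum>b\<in>Basis. inner v b *\<^sub>R b) (\<Sum>b\<in>Basis. inner v b * e b)" by blast
  define g where "g = (\<Sum>b\<in>Basis. e b *\<^sub>R b)"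
  have "inner b g = e b" if "b \<in> Basis" for b
    using that by (simp add: g_def inner_commute[of b])
  moreover have "inner v g = (\<Sum>b\<in>Basis. inner v b * e b)"
    by (simp add: g_def inner_sum_right mult.commute)
  ultimately show ?case using e by (intro exI[of _ g]) (simp add: euclidean_representation)
qed

text \<open>Compactness of the unit sphere leaves finitely many directions of \<open>S\<close>, for
  which the limits are uniform. The Lipschitz bound carries the estimate over to every direction
  close to one of them.\<close>

lemma gderiv_if_directional_limits:
  fixes f :: "'a::euclidean_space \<Rightarrow> real"
  assumes f: "L-lipschitz_on UNIV f"
    and S: "\<And>y e. e > 0 \<Longrightarrow> \<exists>v\<in>S. dist y v < e" and lim: "\<And>v. v \<in> S \<Longrightarrow> directional_limit f x v (inner v g)"
  shows "GDERIV f x :> g"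
  unfolding gderiv_def has_derivative_at_alt
proof (intro conjI allI impI)
  show "bounded_linear (\<lambda>h. inner h g)" by (rule bounded_linear_inner_left)
  fix e :: real assume e: "e > 0"
  have L: "L \<ge> 0" using f by (rule lipschitz_on_nonneg)
  \<comment> \<open>Replacing a direction by a near one costs \<open>L * e1\<close> in
    \<open>f\<close> and \<open>norm g * e1\<close> in the linear term; the quotient itself
    contributes \<open>e1\<close>.\<close>
  define e1 where "e1 = e / (L + 1 + norm g)"
  have Lg: "L + 1 + norm g > 0" using L norm_ge_zero[of g] by linarith
  have e1: "e1 > 0" "e1 * (L + 1 + norm g) = e" using e Lg by (auto simp: e1_def)
  have cov: "sphere 0 1 \<subseteq> (\<Union>v\<in>S. ball v e1)"
    using S[OF e1(1)] by (auto simp: dist_commute)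
  obtain F where F: "F \<subseteq> S" "finite F" "sphere (0::'a) 1 \<subseteq> (\<Union>v\<in>F. ball v e1)"
    using compactE_image[OF compact_sphere _ cov] open_ball by metis
  have "eventually (\<lambda>h. \<forall>v\<in>F. dist ((f (x + h *\<^sub>R v) - f x) / h) (inner v g) < e1) (at 0)"
    using F(1) e1(1) by (intro eventually_ball_finite F(2) ballI tendstoD lim) auto
  then obtain d where d: "d > 0" "\<And>h v. h \<noteq> 0 \<Longrightarrow> \<bar>h\<bar> < d \<Longrightarrow> v \<in> F \<Longrightarrow>
      \<bar>(f (x + h *\<^sub>R v) - f x) / h - inner v g\<bar> < e1"
    unfolding eventually_at by (auto simp: dist_real_def)
  have "norm (f y - f x - inner (y - x) g) \<le> e * norm (y - x)" if y: "norm (y - x) < d" for y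
  proof (cases "y = x")
    case False
    define h where "h = norm (y - x)"
    have h: "h > 0" "h < d" using False y by (auto simp: h_def)
    define \<theta> where "\<theta> = (1 / h) *\<^sub>R (y - x)"
    have "norm \<theta> = 1" using h by (simp add: \<theta>_def h_def)
    then obtain v where v: "v \<in> F" "norm (\<theta> - v) < e1"
      using F(3) by (force simp: dist_norm norm_minus_commute)
    have y_eq: "y = x + h *\<^sub>R \<theta>" "y - x = h *\<^sub>R \<theta>" using h by (auto simp: \<theta>_def)
    have "\<bar>f y - f (x + h *\<^sub>R v)\<bar> \<le> L * norm (h *\<^sub>R \<theta> - h *\<^sub>R v)"
      using lipschitz_onD[OF f, of y "x + h *\<^sub>R v"] by (simp add: dist_norm y_eq(1))
    also have "\<dots> = L * (h * norm (\<theta> - v))" using h by (simp flip: scaleR_diff_right)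
    also have "\<dots> \<le> L * (h * e1)" using v h L by (intro mult_left_mono) auto
    finally have 1: "\<bar>f y - f (x + h *\<^sub>R v)\<bar> \<le> L * (h * e1)" .
    have "h * \<bar>(f (x + h *\<^sub>R v) - f x) / h - inner v g\<bar> \<le> h * e1"
      using d(2)[of h v] h v(1) by (intro mult_left_mono) auto
    moreover have "h * \<bar>(f (x + h *\<^sub>R v) - f x) / h - inner v g\<bar> = \<bar>f (x + h *\<^sub>R v) - f x - h * inner v g\<bar>"
    proof -
      have "h * \<bar>(f (x + h *\<^sub>R v) - f x) / h - inner v g\<bar> = \<bar>h * ((f (x + h *\<^sub>R v) - f x) / h - inner v g)\<bar>"
        using h by (simp add: abs_mult)
      also have "h * ((f (x + h *\<^sub>R v) - f x) / h - inner v g) = f (x + h *\<^sub>R v) - f x - h * inner v g"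
        using h by (simp add: field_simps)
      finally show ?thesis .
    qed
    ultimately have 2: "\<bar>f (x + h *\<^sub>R v) - f x - h * inner v g\<bar> \<le> h * e1" by simp
    have "\<bar>inner (v - \<theta>) g\<bar> \<le> norm (v - \<theta>) * norm g" by (rule Cauchy_Schwarz_ineq2)
    also have "\<dots> \<le> e1 * norm g" using v(2) by (intro mult_right_mono) (auto simp: norm_minus_commute)
    finally have "h * \<bar>inner (v - \<theta>) g\<bar> \<le> h * (e1 * norm g)" using h by (intro mult_left_mono) auto
    then have 3: "\<bar>h * inner v g - h * inner \<theta> g\<bar> \<le> h * (e1 * norm g)"
      using h by (simp add: inner_diff_left abs_mult flip: right_diff_distrib)
    have "\<bar>f y - f x - h * inner \<theta> g\<bar> \<le> L * (h * e1) + h * e1 + h * (e1 * norm g)"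
      using 1 2 3 by linarith
    also have "\<dots> = (e1 * (L + 1 + norm g)) * h" by (simp add: algebra_simps)
    also have "h * inner \<theta> g = inner (y - x) g" by (simp add: y_eq(2))
    finally show ?thesis unfolding e1(2) by (simp add: h_def)
  qed simp
  then show "\<exists>d>0. \<forall>y. norm (y - x) < d \<longrightarrow> norm (f y - f x - inner (y - x) g) \<le> e * norm (y - x)"
    using d(1) by blast
qed

text \<open>A countable dense set of directions keeps the exceptional set null. Off that set the
  limits in these directions are given by a single vector.\<close>

theorem rademacher:
  fixes f :: "'a::euclidean_space \<Rightarrow> real"
  assumes f: "L-lipschitz_on UNIV f"
  shows "negligible {x. \<not> f differentiable (at x)}"
proof -
  obtain S :: "'a set" where S: "countable S" "\<And>X. open X \<Longrightarrow> X \<noteq> {} \<Longrightarrow> \<exists>d\<in>S. d \<in> X"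
    by (rule countable_dense_setE) blast
  have "AE x in lebesgue. \<forall>v\<in>S. \<exists>g. (\<forall>b\<in>Basis. directional_limit f x b (inner b g)) \<and>
      directional_limit f x v (inner v g)"
    using AE_directional_limit_linear[OF f] by (simp add: AE_ball_countable S(1))
  then have "AE x in lebesgue. f differentiable (at x)"
  proof eventually_elim
    case (elim x)
    obtain v0 where "v0 \<in> S" using S(2)[of UNIV] by auto
    from bspec[OF elim this] obtain g where g: "\<forall>b\<in>Basis. directional_limit f x b (inner b g)"
      by (elim exE conjE)
    have "directional_limit f x v (inner v g)" if "v \<in> S" for v
    proof -
      from bspec[OF elim that] obtain g' where g': "\<forall>b\<in>Basis. directional_limit f x b (inner b g')"
          "directional_limit f x v (inner v g')" by (elim exE conjE)
      have "inner b g' = inner b g" if "b \<in> Basis" for b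
        using tendsto_unique[OF at_neq_bot bspec[OF g'(1) that] bspec[OF g that]] .
      then have "g' = g" by (metis euclidean_eqI inner_commute)
      then show ?thesis using g'(2) by simp
    qed
    moreover have "\<exists>v\<in>S. dist y v < e" if "e > 0" for y e
      using S(2)[of "ball y e"] that by auto
    ultimately have "GDERIV f x :> g" by (rule gderiv_if_directional_limits[OF f, rotated])
    then show ?case unfolding gderiv_def differentiable_def by blast
  qed
  then show ?thesis by (simp add: AE_lebesgue_iff_negligible)
qed

section \<open>Clarke gradients\<close>

lemma gderiv_unique:
  assumes "GDERIV f x :> g" "GDERIV f x :> g'"
  shows "g = g'"
proof -
  have "(\<lambda>h. inner h g) = (\<lambda>h. inner h g')"
    using assms unfolding gderiv_def by (rule has_derivative_unique)
  then have "inner h g = inner h g'" for h by (rule fun_cong)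
  then show ?thesis by (metis inner_commute vector_eq_ldot)
qed

lemma grad_eq: "GDERIV f x :> g \<Longrightarrow> grad f x = g"
  unfolding grad_def using gderiv_unique by blast

lemma differentiable_gderiv:
  fixes f :: "'a::euclidean_space \<Rightarrow> real"
  assumes "f differentiable (at x)"
  shows "GDERIV f x :> grad f x"
proof -
  obtain f' where f': "(f has_derivative f') (at x)" using assms by (auto simp: differentiable_def)
  then have lin: "linear f'" by (simp add: has_derivative_linear)
  have "f' = (\<lambda>h. inner h (\<Sum>b\<in>Basis. f' b *\<^sub>R b))"
  proof
    fix h
    have "f' h = f' (\<Sum>b\<in>Basis. inner h b *\<^sub>R b)" by (simp add: euclidean_representation)
    also have "\<dots> = (\<Sum>b\<in>Basis. inner h b * f' b)"
      by (simp add: linear_sum[OF lin] linear_scale[OF lin])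
    also have "\<dots> = inner h (\<Sum>b\<in>Basis. f' b *\<^sub>R b)" by (simp add: inner_sum_right mult.commute)
    finally show "f' h = inner h (\<Sum>b\<in>Basis. f' b *\<^sub>R b)" .
  qed
  then have "GDERIV f x :> (\<Sum>b\<in>Basis. f' b *\<^sub>R b)" using f' by (simp add: gderiv_def)
  then show ?thesis using grad_eq by metis
qed

text \<open>Along the direction \<open>g\<close> itself \<open>f\<close> grows at the rate
  \<open>norm g\<close>, which the Lipschitz constant bounds.\<close>

lemma norm_gderiv_le_lipschitz:
  fixes f :: "'a::euclidean_space \<Rightarrow> real"
  assumes f: "L-lipschitz_on U f" and U: "open U" "x \<in> U" and g: "GDERIV f x :> g"
  shows "norm g \<le> L"
proof (rule field_le_epsilon)
  fix e :: real assume e: "e > 0"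
  obtain d where d: "d > 0" "\<And>y. norm (y - x) < d \<Longrightarrow> norm (f y - f x - inner (y - x) g) \<le> e * norm (y - x)"
    using g e unfolding gderiv_def has_derivative_at_alt by blast
  obtain r where r: "r > 0" "ball x r \<subseteq> U" using U open_contains_ball by blast
  show "norm g \<le> L + e"
  proof (cases "g = 0")
    case True
    then show ?thesis using lipschitz_on_nonneg[OF f] e by simp
  next
    case False
    define t where "t = min d r / (2 * norm g)"
    have "min d r > 0" using d(1) r(1) by simp
    then have t: "t > 0" "t * norm g < d" "t * norm g < r" using False by (auto simp: t_def)
    let ?y = "x + t *\<^sub>R g"
    have n: "norm (?y - x) = t * norm g" using t(1) by simp
    have "?y \<in> U" using r(2) t by (auto simp: dist_norm)
    then have "\<bar>f ?y - f x\<bar> \<le> L * (t * norm g)"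
      using lipschitz_onD[OF f, of ?y x] U(2) t(1) by (simp add: dist_norm)
    moreover have "\<bar>f ?y - f x - t * (norm g * norm g)\<bar> \<le> e * (t * norm g)"
      using d(2)[of ?y] t(1,2) by (simp add: dot_square_norm power2_eq_square)
    ultimately have "norm g * (t * norm g) \<le> (L + e) * (t * norm g)" by (simp add: algebra_simps)
    then show ?thesis using t(1) False by simp
  qed
qed

lemma absolutely_continuous_lipschitz:
  assumes "L-lipschitz_on {a..b} f"
  shows "absolutely_continuous_on_interval a b f"
proof (rule absolutely_continuous_lipschitz_compose[where \<phi> = "\<lambda>t. t", OF _ assms])
  have "(\<Sum>(u, v)\<in>I. norm (v - u)) < e"
    if "\<forall>(u, v)\<in>I. a \<le> u \<and> u \<le> v \<and> v \<le> b" "(\<Sum>(u, v)\<in>I. v - u) < e" for I :: "(real \<times> real) set" and e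
  proof -
    have "(\<Sum>(u, v)\<in>I. norm (v - u)) = (\<Sum>(u, v)\<in>I. v - u)" using that(1) by (intro sum.cong) auto
    then show ?thesis using that(2) by simp
  qed
  then show "absolutely_continuous_on_interval a b (\<lambda>t. t)"
    unfolding absolutely_continuous_on_interval_def by blast
qed simp

text \<open>By Rademacher's theorem and Fubini, almost every translate of the segment meets the exceptional
  set in a null set.\<close>

lemma nonincreasing_of_gderiv_AE:
  fixes f :: "'a::euclidean_space \<Rightarrow> real"
  assumes f: "L-lipschitz_on UNIV f" and N: "negligible N"
    and W: "open W" "convex W" "z \<in> W" "z + v \<in> W"
    and grad: "\<And>x g. x \<in> W \<Longrightarrow> x \<notin> N \<Longrightarrow> GDERIV f x :> g \<Longrightarrow> inner g v \<le> 0"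
  shows "f (z + v) \<le> f z"
proof (rule ccontr)
  assume less: "\<not> f (z + v) \<le> f z"
  have cont: "continuous_on UNIV f" using f by (rule lipschitz_on_continuous_on)
  \<comment> \<open>The segment from \<open>z\<close> may lie entirely in the exceptional set. A
    strict increase persists for all base points in an open set, which is not null and thus contains
    a \<open>y\<close> whose segment is good.\<close>
  define U where "U = {y. f y < f (y + v)} \<inter> W \<inter> (\<lambda>y. y + v) -` W"
  have "open {y. f y < f (y + v)}"
    by (intro open_Collect_less continuous_intros continuous_on_compose2[OF cont] cont) auto
  moreover have "open ((\<lambda>y. y + v) -` W)"
    by (intro open_vimage W(1) continuous_intros)
  ultimately have U: "open U" "z \<in> U" using W less by (auto simp: U_def)
  define N' where "N' = N \<union> {x. \<not> f differentiable (at x)}"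
  have "negligible N'" using N rademacher[OF f] by (simp add: N'_def)
  then have "negligible {x. \<not> negligible {s \<in> {0..1::real}. x + s *\<^sub>R v \<in> N'}}" by (rule negligible_lines)
  moreover have "\<not> negligible U" using U open_not_negligible by blast
  ultimately obtain y where y: "y \<in> U" and ny: "negligible {s \<in> {0..1::real}. y + s *\<^sub>R v \<in> N'}"
    using negligible_subset by blast
  have seg: "y + s *\<^sub>R v \<in> W" if "s \<in> {0..1}" for s
  proof -
    have "(1 - s) *\<^sub>R y + s *\<^sub>R (y + v) \<in> W" using W(2) y that by (intro convexD) (auto simp: U_def)
    then show ?thesis by (simp add: algebra_simps)
  qed
  have "f (y + 1 *\<^sub>R v) \<le> f (y + 0 *\<^sub>R v)"
  proof (rule absolutely_continuous_nonincreasing[where g = "\<lambda>s. f (y + s *\<^sub>R v)", OF _ _ ny])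
    have "(L * norm v)-lipschitz_on {0..1} (\<lambda>s. f (y + s *\<^sub>R v))"
    proof (rule lipschitz_onI)
      fix s t :: real
      have "dist (f (y + s *\<^sub>R v)) (f (y + t *\<^sub>R v)) \<le> L * dist (y + s *\<^sub>R v) (y + t *\<^sub>R v)"
        by (rule lipschitz_onD[OF f]) auto
      also have "dist (y + s *\<^sub>R v) (y + t *\<^sub>R v) = norm v * dist s t"
        by (simp add: dist_norm flip: scaleR_diff_left)
      finally show "dist (f (y + s *\<^sub>R v)) (f (y + t *\<^sub>R v)) \<le> L * norm v * dist s t" by simp
    qed (use lipschitz_on_nonneg[OF f] in simp)
    then show "absolutely_continuous_on_interval 0 1 (\<lambda>s. f (y + s *\<^sub>R v))"
      by (rule absolutely_continuous_lipschitz)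
    fix t e :: real
    assume t: "t \<in> {0..1}" "t \<notin> {s \<in> {0..1}. y + s *\<^sub>R v \<in> N'}" and e: "e > 0"
    let ?x = "y + t *\<^sub>R v"
    have x: "?x \<in> W" "?x \<notin> N" "f differentiable (at ?x)" using t seg by (auto simp: N'_def)
    define g where "g = grad f ?x"
    have g: "GDERIV f ?x :> g" using differentiable_gderiv[OF x(3)] by (simp add: g_def)
    have gv: "inner g v \<le> 0" by (rule grad[OF x(1,2) g])
    define e1 where "e1 = e / (norm v + 1)"
    have nv: "norm v + 1 > 0" using norm_ge_zero[of v] by linarith
    have e1: "e1 > 0" "e1 * norm v \<le> e"
    proof -
      show "e1 > 0" using e nv by (simp add: e1_def)
      then have "e1 * norm v \<le> e1 * (norm v + 1)" by simp
      also have "\<dots> = e" using nv by (simp add: e1_def)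
      finally show "e1 * norm v \<le> e" .
    qed
    obtain d where d: "d > 0" "\<And>w. norm (w - ?x) < d \<Longrightarrow>
        norm (f w - f ?x - inner (w - ?x) g) \<le> e1 * norm (w - ?x)"
      using g e1(1) unfolding gderiv_def has_derivative_at_alt by blast
    define d' where "d' = d / (norm v + 1)"
    have d': "d' > 0" using d nv by (simp add: d'_def)
    have near: "\<bar>f (y + s *\<^sub>R v) - f ?x - (s - t) * inner g v\<bar> \<le> e1 * (\<bar>s - t\<bar> * norm v)" if "\<bar>s - t\<bar> < d'" for s
    proof -
      have eq: "(y + s *\<^sub>R v) - ?x = (s - t) *\<^sub>R v" by (simp add: algebra_simps)
      have "\<bar>s - t\<bar> * norm v \<le> \<bar>s - t\<bar> * (norm v + 1)" by (simp add: mult_left_mono)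
      also have "\<dots> < d" using that nv by (simp add: d'_def pos_less_divide_eq)
      finally have "norm ((y + s *\<^sub>R v) - ?x) < d" unfolding eq by simp
      from d(2)[OF this] show ?thesis unfolding eq by (simp add: inner_commute)
    qed
    have "f (y + w *\<^sub>R v) - f (y + u *\<^sub>R v) \<le> e * (w - u)" if "u \<le> t" "t \<le> w" "w - u < d'" for u w
    proof -
      have "f (y + w *\<^sub>R v) - f (y + u *\<^sub>R v) \<le> (w - u) * inner g v + e1 * ((w - u) * norm v)"
        using near[of w] near[of u] that by (simp add: algebra_simps abs_le_iff)
      also have "\<dots> \<le> e1 * ((w - u) * norm v)" using gv that by (simp add: mult_nonneg_nonpos)
      also have "\<dots> = (e1 * norm v) * (w - u)" by simp
      also have "\<dots> \<le> e * (w - u)" using e1(2) that by (intro mult_right_mono) auto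
      finally show ?thesis .
    qed
    then show "\<exists>d>0. \<forall>u va. 0 \<le> u \<and> u \<le> t \<and> t \<le> va \<and> va \<le> 1 \<and> va - u < d \<longrightarrow>
        f (y + va *\<^sub>R v) - f (y + u *\<^sub>R v) \<le> e * (va - u)"
      using d' by blast
  qed simp
  then show False using y by (simp add: U_def)
qed

text \<open>Violations arbitrarily close to \<open>x0\<close> give bounded gradients and velocities.
  A subsequential limit pairs an element of the Clarke gradient at \<open>x0\<close> with a
  perturbed velocity at \<open>x0\<close>, and their inner product is nonnegative, against
  \<open>desc\<close>. Gradient and velocity are taken at different points \<open>x\<close> and
  \<open>y\<close>, because a velocity at \<open>\<psi> t\<close> is later tested on segments
  nearby.\<close>

lemma clarke_descent_neighbourhood:
  fixes B :: "'a::euclidean_space \<Rightarrow> real"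
  assumes B: "locally_lipschitz_fun B" and F: "usc_setmap F" "compact (F x0)" "F x0 \<noteq> {}" and \<epsilon>: "0 \<le> \<epsilon>"
    and desc: "\<And>\<zeta> \<eta> b. \<zeta> \<in> clarke_gradient \<Omega> B x0 \<Longrightarrow> \<eta> \<in> F x0 \<Longrightarrow> norm b \<le> \<epsilon> \<Longrightarrow> inner \<zeta> (\<eta> + b) < 0"
  obtains r where "r > 0" "\<And>x y v g. x \<in> ball x0 r \<Longrightarrow> y \<in> ball x0 r \<Longrightarrow> x \<notin> \<Omega> \<Longrightarrow> GDERIV B x :> g \<Longrightarrow>
    v \<in> perturbed F (\<lambda>_. \<epsilon>) y \<Longrightarrow> inner g v \<le> 0"
proof (rule ccontr)
  assume contr: "\<not> thesis"
  define h where "h n = inverse (real (Suc n))" for n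
  have h: "h n > 0" "h n \<le> 1" for n by (auto simp: h_def inverse_le_1_iff)
  have h_lim: "h \<longlonglongrightarrow> 0" unfolding h_def by (rule LIMSEQ_inverse_real_of_nat)
  have "\<exists>x y v g. x \<in> ball x0 (h n) \<and> y \<in> ball x0 (h n) \<and> x \<notin> \<Omega> \<and> GDERIV B x :> g \<and>
    v \<in> perturbed F (\<lambda>_. \<epsilon>) y \<and> inner g v > 0" for n
    using contr that[of "h n"] h(1)[of n] by (meson not_le)
  then obtain x y v g where *: "\<And>n. x n \<in> ball x0 (h n)" "\<And>n. y n \<in> ball x0 (h n)" "\<And>n. x n \<notin> \<Omega>"
    "\<And>n. GDERIV B (x n) :> g n" "\<And>n. v n \<in> perturbed F (\<lambda>_. \<epsilon>) (y n)" "\<And>n. inner (g n) (v n) > 0"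
    by metis
  have lim: "u \<longlonglongrightarrow> x0" if u: "\<And>n. u n \<in> ball x0 (h n)" for u
    unfolding tendsto_dist_iff[of _ x0]
  proof (rule tendsto_sandwich[OF _ _ tendsto_const h_lim])
    have "dist (u n) x0 \<le> h n" for n using u[of n] by (simp add: dist_commute)
    then show "eventually (\<lambda>n. dist (u n) x0 \<le> h n) sequentially" by (simp add: always_eventually)
  qed simp
  have xlim: "x \<longlonglongrightarrow> x0" and ylim: "y \<longlonglongrightarrow> x0" by (rule lim, rule *)+
  \<comment> \<open>The radius 2 leaves every \<open>x n\<close>, which is within 1 of
    \<open>x0\<close>, in the interior.\<close>
  obtain L where L: "L-lipschitz_on (cball x0 2) B"
    using B unfolding locally_lipschitz_fun_def by (metis compact_cball cball_eq_empty not_numeral_less_zero)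
  have gL: "norm (g n) \<le> L" for n
  proof (rule norm_gderiv_le_lipschitz[OF lipschitz_on_subset[OF L] open_ball _ *(4)])
    show "x n \<in> ball x0 2" using *(1)[of n] h(2)[of n] by auto
  qed auto
  have "\<exists>\<eta>\<in>F (y n). \<exists>b. norm b \<le> \<epsilon> \<and> v n = \<eta> + b" for n
    using *(5)[of n] mem_perturbed_iff[of "\<lambda>_. \<epsilon>" "y n" "v n" F] \<epsilon> by simp
  then obtain \<eta> b where \<eta>: "\<And>n. \<eta> n \<in> F (y n)" and b: "\<And>n. norm (b n) \<le> \<epsilon>" and v: "\<And>n. v n = \<eta> n + b n"
    by metis
  have "\<exists>\<eta>'\<in>F x0. infdist (\<eta> n) (F x0) = dist (\<eta> n) \<eta>'" for n
    using infdist_attains_inf[OF compact_imp_closed[OF F(2)] F(3)] by metis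
  \<comment> \<open>The vectors \<open>\<eta> n\<close> lie in varying sets; their nearest points in
    the compact \<open>F x0\<close> have a convergent subsequence, and upper semicontinuity makes
    the difference vanish.\<close>
  then obtain \<eta>' where \<eta>': "\<And>n. \<eta>' n \<in> F x0" "\<And>n. infdist (\<eta> n) (F x0) = dist (\<eta> n) (\<eta>' n)" by metis
  have \<eta>lim: "(\<lambda>n. \<eta> n - \<eta>' n) \<longlonglongrightarrow> 0"
  proof (rule LIMSEQ_I)
    fix e :: real assume e: "e > 0"
    obtain U where U: "open U" "x0 \<in> U" "\<And>y. y \<in> U \<Longrightarrow> F y \<subseteq> F x0 + (*\<^sub>R) (e / 2) ` cball 0 1"
      using F(1) e unfolding usc_setmap_def by (metis half_gt_zero)
    have "eventually (\<lambda>n. y n \<in> U) sequentially" using topological_tendstoD[OF ylim U(1,2)] .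
    then obtain N where N: "\<And>n. n \<ge> N \<Longrightarrow> y n \<in> U" unfolding eventually_sequentially by blast
    have "norm (\<eta> n - \<eta>' n - 0) < e" if "n \<ge> N" for n
    proof -
      have "\<eta> n \<in> perturbed F (\<lambda>_. e / 2) x0" using U(3)[OF N[OF that]] \<eta>[of n] by (auto simp: perturbed_def)
      then obtain \<theta> c where \<theta>: "\<theta> \<in> F x0" "norm c \<le> e / 2" "\<eta> n = \<theta> + c"
        using mem_perturbed_iff[of "\<lambda>_. e / 2" x0 "\<eta> n" F] e by auto
      have "dist (\<eta> n) (\<eta>' n) \<le> dist (\<eta> n) \<theta>" using infdist_le[OF \<theta>(1), of "\<eta> n"] \<eta>'(2) by simp
      then show ?thesis using \<theta> e by (simp add: dist_norm)
    qed
    then show "\<exists>N. \<forall>n\<ge>N. norm (\<eta> n - \<eta>' n - 0) < e" by blast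
  qed
  have comp: "compact (cball (0::'a) L \<times> F x0 \<times> cball (0::'a) \<epsilon>)" using F(2) by (intro compact_Times) auto
  have "\<forall>n. (g n, \<eta>' n, b n) \<in> cball 0 L \<times> F x0 \<times> cball 0 \<epsilon>" using gL \<eta>'(1) b by auto
  from seq_compactE[OF comp[unfolded compact_eq_seq_compact_metric] this] obtain l \<sigma> where l: "l \<in> cball 0 L \<times> F x0 \<times> cball 0 \<epsilon>" "strict_mono \<sigma>"
      "((\<lambda>n. (g n, \<eta>' n, b n)) \<circ> \<sigma>) \<longlonglongrightarrow> l" by blast
  obtain \<zeta> \<eta>0 b0 where l_eq: "l = (\<zeta>, \<eta>0, b0)" by (cases l) auto
  have lims: "(\<lambda>n. g (\<sigma> n)) \<longlonglongrightarrow> \<zeta>" "(\<lambda>n. \<eta>' (\<sigma> n)) \<longlonglongrightarrow> \<eta>0" "(\<lambda>n. b (\<sigma> n)) \<longlonglongrightarrow> b0"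
    using tendsto_fst[OF l(3)] tendsto_fst[OF tendsto_snd[OF l(3)]] tendsto_snd[OF tendsto_snd[OF l(3)]]
    by (simp_all add: l_eq o_def)
  have "(\<lambda>n. x (\<sigma> n)) \<longlonglongrightarrow> x0" using LIMSEQ_subseq_LIMSEQ[OF xlim l(2)] by (simp add: o_def)
  moreover have "grad B (x (\<sigma> n)) = g (\<sigma> n)" for n by (rule grad_eq[OF *(4)])
  moreover have "B differentiable (at (x (\<sigma> n)))" for n
    using *(4) unfolding gderiv_def differentiable_def by blast
  ultimately have \<zeta>: "\<zeta> \<in> clarke_gradient \<Omega> B x0"
    unfolding clarke_gradient_def using lims(1) *(3)
    by (intro hull_inc mem_Collect_eq[THEN iffD2] exI[of _ "\<lambda>n. x (\<sigma> n)"]) auto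
  have "(\<lambda>n. inner (g (\<sigma> n)) ((\<eta> (\<sigma> n) - \<eta>' (\<sigma> n)) + \<eta>' (\<sigma> n) + b (\<sigma> n))) \<longlonglongrightarrow> inner \<zeta> (0 + \<eta>0 + b0)"
    using LIMSEQ_subseq_LIMSEQ[OF \<eta>lim l(2)] lims by (intro tendsto_intros) (simp_all add: o_def)
  then have "0 \<le> inner \<zeta> (0 + \<eta>0 + b0)"
    by (rule LIMSEQ_le_const) (use *(6) v in \<open>auto intro!: exI[of _ 0] less_imp_le\<close>)
  moreover have "inner \<zeta> (\<eta>0 + b0) < 0" using l(1) \<zeta> by (intro desc) (auto simp: l_eq)
  ultimately show False by simp
qed

text \<open>With perturbations of size \<open>c / 2\<close> the inner product at a frontier point is
  at most \<open>- (c / 2) * norm \<zeta>\<close>, and this is negative because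
  \<open>\<zeta> \<noteq> 0\<close>.\<close>

lemma clarke_forward_invariant:
  fixes B :: "'a::euclidean_space \<Rightarrow> real"
  assumes B: "locally_lipschitz_fun B" and F: "usc_setmap F" "\<And>x. compact (F x)" "\<And>x. F x \<noteq> {}"
    and \<Omega>: "negligible \<Omega>" and c: "c > 0"
    and nz: "\<And>x \<zeta>. x \<in> frontier {x. B x \<le> 0} \<Longrightarrow> \<zeta> \<in> clarke_gradient \<Omega> B x \<Longrightarrow> \<zeta> \<noteq> 0"
    and desc: "\<And>x \<zeta> \<eta>. x \<in> frontier {x. B x \<le> 0} \<Longrightarrow> \<zeta> \<in> clarke_gradient \<Omega> B x \<Longrightarrow> \<eta> \<in> F x \<Longrightarrow>
      inner \<zeta> \<eta> \<le> - c * norm \<zeta>"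
  shows "forward_invariant (perturbed F (\<lambda>_. c / 2)) {x. B x \<le> 0}"
proof (rule forward_invariantI_frontier)
  fix x0 assume x0: "x0 \<in> frontier {x. B x \<le> 0}"
  obtain r where r: "r > 0" and gr: "\<And>x y v g. x \<in> ball x0 r \<Longrightarrow> y \<in> ball x0 r \<Longrightarrow> x \<notin> \<Omega> \<Longrightarrow> GDERIV B x :> g \<Longrightarrow>
    v \<in> perturbed F (\<lambda>_. c / 2) y \<Longrightarrow> inner g v \<le> 0"
  proof (rule clarke_descent_neighbourhood[OF B F(1) F(2) F(3), of "c / 2" \<Omega> x0])
    fix \<zeta> \<eta> b :: 'a assume a: "\<zeta> \<in> clarke_gradient \<Omega> B x0" "\<eta> \<in> F x0" "norm b \<le> c / 2"
    have "inner \<zeta> b \<le> norm \<zeta> * norm b" by (rule norm_cauchy_schwarz)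
    also have "\<dots> \<le> norm \<zeta> * (c / 2)" using a(3) by (intro mult_left_mono) auto
    finally have "inner \<zeta> (\<eta> + b) \<le> - (norm \<zeta> * (c / 2))"
      using desc[OF x0 a(1,2)] by (simp add: inner_add_right algebra_simps)
    moreover have "norm \<zeta> * (c / 2) > 0" using nz[OF x0 a(1)] c by simp
    ultimately show "inner \<zeta> (\<eta> + b) < 0" by linarith
  qed (use c in auto)
  obtain L where L: "L-lipschitz_on (cball x0 r) B"
    using B r unfolding locally_lipschitz_fun_def by (metis compact_cball cball_eq_empty not_less_iff_gr_or_eq)
  \<comment> \<open>Composing with the projection onto the ball, which does not increase distances,
    gives a globally Lipschitz function with the same values and gradients in the open ball.\<close>
  define B' where "B' x = B (closest_point (cball x0 r) x)" for x
  have B'_eq: "B' x = B x" if "x \<in> ball x0 r" for x using that by (simp add: B'_def closest_point_self)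
  have B'_lip: "L-lipschitz_on UNIV B'"
  proof (rule lipschitz_onI)
    fix x y
    have ne: "cball x0 r \<noteq> {}" using r by simp
    have "dist (B' x) (B' y) \<le> L * dist (closest_point (cball x0 r) x) (closest_point (cball x0 r) y)"
      unfolding B'_def by (intro lipschitz_onD[OF L] closest_point_in_set closed_cball ne)
    also have "\<dots> \<le> L * dist x y"
      using lipschitz_on_nonneg[OF L] closest_point_lipschitz[OF convex_cball closed_cball ne]
      by (intro mult_left_mono)
    finally show "dist (B' x) (B' y) \<le> L * dist x y" .
  qed (rule lipschitz_on_nonneg[OF L])
  have step: "B (z + h *\<^sub>R v) \<le> B z"
    if z: "z \<in> ball x0 r" "z + h *\<^sub>R v \<in> ball x0 r" and h: "0 \<le> h" and y: "y \<in> ball x0 r"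
      and v: "v \<in> perturbed F (\<lambda>_. c / 2) y" for z h v y
  proof -
    have "B' (z + h *\<^sub>R v) \<le> B' z"
    proof (rule nonincreasing_of_gderiv_AE[OF B'_lip \<Omega> open_ball convex_ball z])
      fix x g assume x: "x \<in> ball x0 r" "x \<notin> \<Omega>" and g: "GDERIV B' x :> g"
      have "GDERIV B x :> g"
        using g unfolding gderiv_def
        by (rule has_derivative_transform_within_open[OF _ open_ball x(1)]) (rule B'_eq)
      then have "inner g v \<le> 0" using gr[OF x(1) y x(2) _ v] by blast
      then show "inner g (h *\<^sub>R v) \<le> 0" using h by (simp add: mult_nonneg_nonpos)
    qed
    then show ?thesis using z by (simp add: B'_eq)
  qed
  have "\<psi> T \<in> {x. B x \<le> 0}" if y: "y \<in> {x. B x \<le> 0}" and T: "0 \<le> T"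
    and sol: "solution_from (perturbed F (\<lambda>_. c / 2)) y {0..T} \<psi>" and ball: "\<psi> ` {0..T} \<subseteq> ball x0 r" for y T \<psi>
  proof -
    have \<psi>: "\<psi> 0 = y" "absolutely_continuous_on_interval 0 T \<psi>"
      "negligible {t \<in> {0..T}. \<not> (\<exists>v. (\<psi> has_vector_derivative v) (at t within {0..T}) \<and>
        v \<in> perturbed F (\<lambda>_. c / 2) (\<psi> t))}"
      using sol T by (auto simp: solution_from_atLeastAtMost_iff)
    have "B (\<psi> T) \<le> B (\<psi> 0)"
    proof (rule lipschitz_nonincreasing_along_curve[OF T \<psi>(2) open_ball ball lipschitz_on_subset[OF L ball_subset_cball] \<psi>(3)])
      fix t assume t: "t \<in> {0..T}" "t \<notin> {t \<in> {0..T}. \<not> (\<exists>v. (\<psi> has_vector_derivative v) (at t within {0..T}) \<and>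
        v \<in> perturbed F (\<lambda>_. c / 2) (\<psi> t))}"
      then obtain v where v: "(\<psi> has_vector_derivative v) (at t within {0..T})" "v \<in> perturbed F (\<lambda>_. c / 2) (\<psi> t)"
        by blast
      have \<psi>t: "\<psi> t \<in> ball x0 r" using ball t(1) by blast
      then obtain s where s: "s > 0" "ball (\<psi> t) s \<subseteq> ball x0 r" using open_contains_ball open_ball by metis
      define d where "d = s / (norm v + 1)"
      have nv: "norm v + 1 > 0" using norm_ge_zero[of v] by linarith
      have d: "d > 0" "d * (norm v + 1) = s" using s nv by (auto simp: d_def)
      have "B (z + h *\<^sub>R v) \<le> B z + e * h" if "e > 0" "dist z (\<psi> t) < d" "0 \<le> h" "h < d" for z h e
      proof -
        have "h * norm v \<le> d * norm v" using that by (intro mult_right_mono) auto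
        then have "norm (h *\<^sub>R v) + dist z (\<psi> t) < s" using d(2) that by (simp add: algebra_simps)
        moreover have "dist (z + h *\<^sub>R v) (\<psi> t) \<le> norm (h *\<^sub>R v) + dist z (\<psi> t)"
          using dist_triangle[of "z + h *\<^sub>R v" "\<psi> t" z] by (simp add: dist_norm)
        ultimately have "z + h *\<^sub>R v \<in> ball (\<psi> t) s" "z \<in> ball (\<psi> t) s"
          using norm_ge_zero[of "h *\<^sub>R v"] by (auto simp: dist_commute simp del: norm_scaleR norm_ge_zero)
        then have "B (z + h *\<^sub>R v) \<le> B z" using s(2) that(3) \<psi>t v(2) by (intro step[of z h v "\<psi> t"]) auto
        then show ?thesis using that by (simp add: add_increasing2)
      qed
      then show "\<exists>v. (\<psi> has_vector_derivative v) (at t within {0..T}) \<and> (\<forall>e>0. \<exists>d>0. \<forall>z h.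
          dist z (\<psi> t) < d \<longrightarrow> 0 \<le> h \<longrightarrow> h < d \<longrightarrow> B (z + h *\<^sub>R v) \<le> B z + e * h)"
        using v(1) d(1) by blast
    qed
    then show ?thesis using y \<psi>(1) by simp
  qed
  then show "\<exists>r>0. \<forall>y T \<psi>. y \<in> {x. B x \<le> 0} \<longrightarrow> 0 \<le> T \<longrightarrow> solution_from (perturbed F (\<lambda>_. c / 2)) y {0..T} \<psi> \<longrightarrow>
      \<psi> ` {0..T} \<subseteq> ball x0 r \<longrightarrow> \<psi> T \<in> {x. B x \<le> 0}"
    using r by blast
qed

text \<open>The mean value inequality needs convexity, so it is applied on a ball containing
  \<open>U\<close>.\<close>

lemma continuously_differentiable_locally_lipschitz:
  fixes B :: "'a::euclidean_space \<Rightarrow> real"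
  assumes B: "continuously_differentiable B"
  shows "locally_lipschitz_fun B"
  unfolding locally_lipschitz_fun_def
proof (intro allI impI)
  fix U :: "'a set" assume "compact U \<and> U \<noteq> {}"
  then have "bounded U" using compact_imp_bounded by blast
  then obtain R where R: "\<forall>x\<in>U. norm x \<le> R" unfolding bounded_iff by blast
  have cont: "continuous_on UNIV (grad B)" and diff: "\<And>x. B differentiable (at x)"
    using B unfolding continuously_differentiable_def by auto
  have "bounded (grad B ` cball 0 R)"
    by (intro compact_imp_bounded compact_continuous_image continuous_on_subset[OF cont]) auto
  then obtain M where M: "\<forall>x\<in>cball 0 R. norm (grad B x) \<le> M" unfolding bounded_iff by blast
  have "norm (B x - B y) \<le> \<bar>M\<bar> * norm (x - y)" if "x \<in> cball 0 R" "y \<in> cball 0 R" for x y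
  proof (rule differentiable_bound[OF convex_cball _ _ that, of _ "\<lambda>x h. inner h (grad B x)"])
    fix z :: 'a assume z: "z \<in> cball 0 R"
    show "(B has_derivative (\<lambda>h. inner h (grad B z))) (at z within cball 0 R)"
      using differentiable_gderiv[OF diff, of z] unfolding gderiv_def by (rule has_derivative_at_withinI)
    show "onorm (\<lambda>h. inner h (grad B z)) \<le> \<bar>M\<bar>"
    proof (rule onorm_le)
      fix h have "norm (inner h (grad B z)) \<le> norm h * norm (grad B z)" by (rule Cauchy_Schwarz_ineq2[unfolded real_norm_def[symmetric]])
      also have "\<dots> \<le> norm h * \<bar>M\<bar>" using M z by (intro mult_left_mono) (force, simp)
      finally show "norm (inner h (grad B z)) \<le> \<bar>M\<bar> * norm h" by (simp add: mult.commute)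
    qed
  qed
  then have "\<bar>M\<bar>-lipschitz_on U B"
    using R by (intro lipschitz_onI) (auto simp: dist_norm)
  then show "\<exists>L. L-lipschitz_on U B" by blast
qed

text \<open>Limits of gradients equal the gradient by continuity, and a singleton is convex.
  Condition (4) thereby becomes an instance of the Clarke argument.\<close>

lemma clarke_gradient_continuously_differentiable:
  fixes B :: "'a::euclidean_space \<Rightarrow> real"
  assumes B: "continuously_differentiable B"
  shows "clarke_gradient \<Omega> B x \<subseteq> {grad B x}"
  unfolding clarke_gradient_def
proof (rule hull_minimal)
  have "isCont (grad B) x"
    using B unfolding continuously_differentiable_def by (simp add: continuous_on_eq_continuous_at)
  then show "{g. \<exists>X. X \<longlonglongrightarrow> x \<and> (\<forall>i. X i \<notin> \<Omega> \<union> {y. \<not> B differentiable (at y)}) \<and>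
      (\<lambda>i. grad B (X i)) \<longlonglongrightarrow> g} \<subseteq> {grad B x}"
    using isCont_tendsto_compose LIMSEQ_unique by blast
qed simp

section \<open>Invariance from proximal conditions, forwards and backwards in time\<close>

lemma inner_perturbed_le:
  fixes F :: "'a::euclidean_space \<Rightarrow> 'a set"
  assumes c: "0 < c" and k: "0 < k" and F: "F x \<subseteq> F y + (*\<^sub>R) (k * norm (x - y)) ` cball 0 1"
    and v: "v \<in> perturbed F (\<lambda>_. c / 2) x" and desc: "\<And>\<eta>. \<eta> \<in> F y \<Longrightarrow> inner \<zeta> \<eta> \<le> - c * norm \<zeta>"
  shows "inner \<zeta> v \<le> norm \<zeta> * (k * dist x y - c / 2)"
proof -
  obtain \<eta> b where \<eta>: "\<eta> \<in> F x" "norm b \<le> c / 2" "v = \<eta> + b"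
    using v c mem_perturbed_iff[of "\<lambda>_. c / 2" x v F] by auto
  \<comment> \<open>Descent is known only at \<open>y\<close>, where \<open>\<zeta>\<close> is a
    subgradient; the Lipschitz property replaces \<open>\<eta>\<close> by a vector
    \<open>\<theta>\<close> of \<open>F y\<close> at the cost
    \<open>k * norm (x - y)\<close>.\<close>
  have "\<eta> \<in> perturbed F (\<lambda>_. k * norm (x - y)) y" using F \<eta>(1) by (auto simp: perturbed_def)
  then obtain \<theta> d where \<theta>: "\<theta> \<in> F y" "norm d \<le> k * norm (x - y)" "\<eta> = \<theta> + d"
    using k mem_perturbed_iff[of "\<lambda>_. k * norm (x - y)" y \<eta> F] by auto
  have "inner \<zeta> b \<le> norm \<zeta> * (c / 2)"
    by (rule order_trans[OF norm_cauchy_schwarz mult_left_mono[OF \<eta>(2) norm_ge_zero]])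
  moreover have "inner \<zeta> d \<le> norm \<zeta> * (k * norm (x - y))"
    by (rule order_trans[OF norm_cauchy_schwarz mult_left_mono[OF \<theta>(2) norm_ge_zero]])
  ultimately show ?thesis
    using desc[OF \<theta>(1)] by (simp add: \<eta>(3) \<theta>(3) inner_add_right dist_norm algebra_simps)
qed

lemma solution_from_reverse:
  assumes T: "0 \<le> T" and sol: "solution_from G x {0..T} \<psi>"
  shows "solution_from (\<lambda>x. uminus ` G x) (\<psi> T) {0..T} (\<lambda>t. \<psi> (T - t))"
  unfolding solution_from_atLeastAtMost_iff[OF T]
proof (intro conjI)
  have \<psi>: "absolutely_continuous_on_interval 0 T \<psi>"
      "negligible {t \<in> {0..T}. \<not> (\<exists>v. (\<psi> has_vector_derivative v) (at t within {0..T}) \<and> v \<in> G (\<psi> t))}"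
    using sol unfolding solution_from_atLeastAtMost_iff[OF T] by auto
  show "absolutely_continuous_on_interval 0 T (\<lambda>t. \<psi> (T - t))"
    using absolutely_continuous_affine(2)[OF \<psi>(1), of T] by simp
  have "negligible ((\<lambda>t. T - t) ` {t \<in> {0..T}. \<not> (\<exists>v. (\<psi> has_vector_derivative v) (at t within {0..T}) \<and> v \<in> G (\<psi> t))})"
    by (rule negligible_differentiable_image_negligible[OF order_refl \<psi>(2)]) (intro derivative_intros)
  then show "negligible {t \<in> {0..T}. \<not> (\<exists>v. ((\<lambda>t. \<psi> (T - t)) has_vector_derivative v) (at t within {0..T}) \<and>
      v \<in> uminus ` G (\<psi> (T - t)))}"
  proof (rule negligible_subset, intro subsetI)
    fix t assume t: "t \<in> {t \<in> {0..T}. \<not> (\<exists>v. ((\<lambda>t. \<psi> (T - t)) has_vector_derivative v) (at t within {0..T}) \<and>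
      v \<in> uminus ` G (\<psi> (T - t)))}"
    have "\<not> (\<exists>v. (\<psi> has_vector_derivative v) (at (T - t) within {0..T}) \<and> v \<in> G (\<psi> (T - t)))"
    proof
      assume "\<exists>v. (\<psi> has_vector_derivative v) (at (T - t) within {0..T}) \<and> v \<in> G (\<psi> (T - t))"
      then obtain v where v: "(\<psi> has_vector_derivative v) (at (T - t) within {0..T})" "v \<in> G (\<psi> (T - t))" by blast
      have "(\<psi> has_vector_derivative v) (at (T - t) within (\<lambda>t. T - t) ` {0..T})"
        by (intro has_vector_derivative_within_subset[OF v(1)]) auto
      moreover have "((\<lambda>t. T - t) has_vector_derivative - 1) (at t within {0..T})"
        by (auto intro!: derivative_eq_intros)
      ultimately have "((\<lambda>t. \<psi> (T - t)) has_vector_derivative - v) (at t within {0..T})"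
        using vector_diff_chain_within[of "\<lambda>t. T - t" "- 1" t "{0..T}" \<psi> v] by (simp add: o_def)
      with v(2) t show False by auto
    qed
    then show "t \<in> (\<lambda>t. T - t) ` {t \<in> {0..T}. \<not> (\<exists>v. (\<psi> has_vector_derivative v) (at t within {0..T}) \<and> v \<in> G (\<psi> t))}"
      using t by (intro image_eqI[of _ _ "T - t"]) auto
  qed
qed simp

text \<open>\<open>inner_perturbed_le\<close> supplies the hypothesis \<open>decr\<close> of
  \<open>lsc_nonincreasing_along_solution\<close> with margin \<open>c / 2\<close>, once a closed
  ball around the frontier point is chosen inside \<open>U\<close>, with one Lipschitz constant
  \<open>k\<close> for \<open>F\<close>.\<close>

lemma proximal_forward_invariant_lsc:
  fixes B :: "'a::euclidean_space \<Rightarrow> real"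
  assumes B: "lsc_fun B" and F: "locally_lipschitz_setmap F" and U: "open U" "frontier {x. B x \<le> 0} \<subseteq> U"
    and c: "0 < c" and desc: "\<And>x \<zeta> \<eta>. x \<in> U \<Longrightarrow> \<zeta> \<in> proximal_subdifferential B x \<Longrightarrow> \<eta> \<in> F x \<Longrightarrow>
      inner \<zeta> \<eta> \<le> - c * norm \<zeta>"
  shows "forward_invariant (perturbed F (\<lambda>_. c / 2)) {x. B x \<le> 0}"
proof (rule forward_invariantI_frontier)
  fix x0 assume "x0 \<in> frontier {x. B x \<le> 0}"
  then obtain r where r: "r > 0" "cball x0 r \<subseteq> U" using U open_contains_cball by blast
  obtain k where k: "k > 0" "\<And>x y. x \<in> cball x0 r \<Longrightarrow> y \<in> cball x0 r \<Longrightarrow>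
      F x \<subseteq> F y + (*\<^sub>R) (k * norm (x - y)) ` cball 0 1"
    using F[unfolded locally_lipschitz_setmap_def, rule_format, of "cball x0 r"] r(1) by auto
  have "B (\<psi> T) \<le> B (\<psi> 0)" if T: "0 \<le> T" and sol: "solution_from (perturbed F (\<lambda>_. c / 2)) y {0..T} \<psi>"
    and ball: "\<psi> ` {0..T} \<subseteq> ball x0 (r / 2)" for y T \<psi>
  proof (rule lsc_nonincreasing_along_solution[OF B r(1) _ _ _ T _ ball, of k "c / 2"])
    show "solution_from (perturbed F (\<lambda>_. c / 2)) (\<psi> 0) {0..T} \<psi>" using sol by (simp add: solution_from_def)
    fix x y v \<zeta> assume a: "x \<in> ball x0 r" "y \<in> ball x0 r" "v \<in> perturbed F (\<lambda>_. c / 2) x"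
      "\<zeta> \<in> proximal_subdifferential B y"
    then have "y \<in> U" using r(2) by auto
    then show "inner \<zeta> v \<le> norm \<zeta> * (k * dist x y - c / 2)"
      using a by (intro inner_perturbed_le[OF c k(1) k(2)] desc) auto
  qed (use k c in auto)
  moreover have "\<psi> 0 = y" if "solution_from (perturbed F (\<lambda>_. c / 2)) y {0..T} \<psi>" for y T \<psi>
    using that by (simp add: solution_from_def)
  ultimately have "\<psi> T \<in> {x. B x \<le> 0}" if "y \<in> {x. B x \<le> 0}" "0 \<le> T"
    "solution_from (perturbed F (\<lambda>_. c / 2)) y {0..T} \<psi>" "\<psi> ` {0..T} \<subseteq> ball x0 (r / 2)" for y T \<psi>
    using that by (metis (no_types, lifting) mem_Collect_eq order_trans)
  then show "\<exists>r>0. \<forall>y T \<psi>. y \<in> {x. B x \<le> 0} \<longrightarrow> 0 \<le> T \<longrightarrow> solution_from (perturbed F (\<lambda>_. c / 2)) y {0..T} \<psi> \<longrightarrow>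
      \<psi> ` {0..T} \<subseteq> ball x0 r \<longrightarrow> \<psi> T \<in> {x. B x \<le> 0}"
    using half_gt_zero[OF r(1)] by blast
qed

text \<open>\<open>- B\<close> does not increase along solutions run backwards.\<close>

lemma proximal_forward_invariant_usc:
  fixes B :: "'a::euclidean_space \<Rightarrow> real"
  assumes B: "lsc_fun (\<lambda>x. - B x)" and F: "locally_lipschitz_setmap F" and U: "open U" "frontier {x. B x \<le> 0} \<subseteq> U"
    and c: "0 < c" and desc: "\<And>x \<zeta> \<eta>. x \<in> U \<Longrightarrow> \<zeta> \<in> proximal_subdifferential (\<lambda>x. - B x) x \<Longrightarrow> \<eta> \<in> F x \<Longrightarrow>
      c * norm \<zeta> \<le> inner \<zeta> \<eta>"
  shows "forward_invariant (perturbed F (\<lambda>_. c / 2)) {x. B x \<le> 0}"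
proof (rule forward_invariantI_frontier)
  fix x0 assume "x0 \<in> frontier {x. B x \<le> 0}"
  then obtain r where r: "r > 0" "cball x0 r \<subseteq> U" using U open_contains_cball by blast
  obtain k where k: "k > 0" "\<And>x y. x \<in> cball x0 r \<Longrightarrow> y \<in> cball x0 r \<Longrightarrow>
      F x \<subseteq> F y + (*\<^sub>R) (k * norm (x - y)) ` cball 0 1"
    using F[unfolded locally_lipschitz_setmap_def, rule_format, of "cball x0 r"] r(1) by auto
  have "B (\<psi> T) \<le> B (\<psi> 0)" if T: "0 \<le> T" and sol: "solution_from (perturbed F (\<lambda>_. c / 2)) y {0..T} \<psi>"
    and ball: "\<psi> ` {0..T} \<subseteq> ball x0 (r / 2)" for y T \<psi>
  proof -
    \<comment> \<open>The reversed arc runs from \<open>\<psi> T\<close> to \<open>\<psi> 0\<close>,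
      so that a nonincreasing \<open>- B\<close> along it bounds \<open>B (\<psi> T)\<close> by
      \<open>B (\<psi> 0)\<close>.\<close>
    have "- B (\<psi> (T - T)) \<le> - B (\<psi> (T - 0))"
    proof (rule lsc_nonincreasing_along_solution[where \<psi> = "\<lambda>t. \<psi> (T - t)" and k = k and \<delta> = "c / 2"
        and H = "\<lambda>x. uminus ` perturbed F (\<lambda>_. c / 2) x", OF B r(1) _ _ _ T])
      show "solution_from (\<lambda>x. uminus ` perturbed F (\<lambda>_. c / 2) x) (\<psi> (T - 0)) {0..T} (\<lambda>t. \<psi> (T - t))"
        using solution_from_reverse[OF T sol] by simp
      show "(\<lambda>t. \<psi> (T - t)) ` {0..T} \<subseteq> ball x0 (r / 2)"
      proof (rule image_subsetI)
        fix t assume "t \<in> {0..T}"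
        then have "\<psi> (T - t) \<in> \<psi> ` {0..T}" by (intro imageI) auto
        then show "\<psi> (T - t) \<in> ball x0 (r / 2)" using ball by blast
      qed
      fix x y v \<zeta> assume a: "x \<in> ball x0 r" "y \<in> ball x0 r" "v \<in> uminus ` perturbed F (\<lambda>_. c / 2) x"
        "\<zeta> \<in> proximal_subdifferential (\<lambda>x. - B x) y"
      then obtain w where w: "w \<in> perturbed F (\<lambda>_. c / 2) x" "v = - w" by auto
      have "y \<in> U" using a r(2) by auto
      \<comment> \<open>Both the velocity and the subgradient change sign: for
        \<open>- \<zeta>\<close> the hypothesis \<open>desc\<close> takes the form of a descent
        condition.\<close>
      then have "inner (- \<zeta>) w \<le> norm (- \<zeta>) * (k * dist x y - c / 2)"
        using a(1,2) desc[OF _ a(4)] by (intro inner_perturbed_le[OF c k(1) k(2) w(1)]) auto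
      then show "inner \<zeta> v \<le> norm \<zeta> * (k * dist x y - c / 2)" by (simp add: w(2))
    qed (use k c in auto)
    then show ?thesis by simp
  qed
  moreover have "\<psi> 0 = y" if "solution_from (perturbed F (\<lambda>_. c / 2)) y {0..T} \<psi>" for y T \<psi>
    using that by (simp add: solution_from_def)
  ultimately have "\<psi> T \<in> {x. B x \<le> 0}" if "y \<in> {x. B x \<le> 0}" "0 \<le> T"
    "solution_from (perturbed F (\<lambda>_. c / 2)) y {0..T} \<psi>" "\<psi> ` {0..T} \<subseteq> ball x0 (r / 2)" for y T \<psi>
    using that by (metis (no_types, lifting) mem_Collect_eq order_trans)
  then show "\<exists>r>0. \<forall>y T \<psi>. y \<in> {x. B x \<le> 0} \<longrightarrow> 0 \<le> T \<longrightarrow> solution_from (perturbed F (\<lambda>_. c / 2)) y {0..T} \<psi> \<longrightarrow>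
      \<psi> ` {0..T} \<subseteq> ball x0 r \<longrightarrow> \<psi> T \<in> {x. B x \<le> 0}"
    using half_gt_zero[OF r(1)] by blast
qed

section \<open>From positive infima to uniform robust safety\<close>

lemma positive_Inf_ereal_lower_bound:
  fixes S :: "ereal set"
  assumes "0 < Inf S"
  obtains c where "0 < c" "\<And>s. ereal s \<in> S \<Longrightarrow> c \<le> s"
proof -
  \<comment> \<open>A real number strictly below the infimum exists even when \<open>S\<close> is
    empty and the infimum is infinite.\<close>
  obtain c where c: "0 < ereal c" "ereal c < Inf S" using ereal_dense2[OF assms] by auto
  have "c \<le> s" if "ereal s \<in> S" for s
    using less_le_trans[OF c(2) Inf_lower[OF that]] by simp
  then show ?thesis using c(1) that by auto
qed

lemma uniformly_robustly_safe_if_forward_invariant: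
  assumes "barrier_candidate B Xo Xu" "0 < c" "forward_invariant (perturbed F (\<lambda>_. c)) {x. B x \<le> 0}"
  shows "uniformly_robustly_safe F Xo Xu"
proof -
  have "Xo \<subseteq> {x. B x \<le> 0}" "{x. B x \<le> 0} \<subseteq> - Xu"
    using assms(1) by (auto simp: barrier_candidate_def not_le)
  then have "safe (perturbed F (\<lambda>_. c)) Xo Xu"
    using assms(3) unfolding safe_def forward_invariant_def by blast
  then show ?thesis using assms(2) unfolding uniformly_robustly_safe_def by blast
qed

theorem theorem2:
  fixes F :: "real ^ 'n \<Rightarrow> (real ^ 'n) set"
    and Xo Xu K \<Omega> :: "(real ^ 'n) set"
    and B :: "real ^ 'n \<Rightarrow> real"
  assumes F_usc: "usc_setmap F"
    and F_values: "\<And>x. F x \<noteq> {} \<and> compact (F x) \<and> convex (F x)"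
    and B_candidate: "barrier_candidate B Xo Xu"
    and K_eq: "K = {x. B x \<le> 0}"
    and \<Omega>_null: "negligible \<Omega>"
    and conditions:
      "(\<exists>\<epsilon>>0. forward_invariant (perturbed F (\<lambda>_. \<epsilon>)) K)
     \<or> (bounded (frontier K) \<and>
         (\<exists>\<epsilon>. continuous_on UNIV \<epsilon> \<and> (\<forall>x. 0 < \<epsilon> x) \<and> forward_invariant (perturbed F \<epsilon>) K))
     \<or> (robustly_safe F Xo Xu \<and> (bounded (- Xu) \<or> bounded (- Xo)))
     \<or> (continuously_differentiable B \<and>
         (\<forall>x\<in>frontier K. grad B x \<noteq> 0) \<and>
         0 < Inf {ereal (inner (grad B x) (- \<eta>) / norm (grad B x)) | x \<eta>.
                    x \<in> frontier K \<and> \<eta> \<in> F x})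
     \<or> (locally_lipschitz_fun B \<and>
         (\<forall>x\<in>frontier K. \<forall>\<zeta>\<in>clarke_gradient \<Omega> B x. \<zeta> \<noteq> 0) \<and>
         0 < Inf {ereal (inner \<zeta> (- \<eta>) / norm \<zeta>) | x \<eta> \<zeta>.
                    x \<in> frontier K \<and> \<eta> \<in> F x \<and> \<zeta> \<in> clarke_gradient \<Omega> B x})
     \<or> (lsc_fun B \<and> locally_lipschitz_setmap F \<and>
         (\<exists>U. open U \<and> frontier K \<subseteq> U \<and>
            (\<forall>x\<in>U. \<forall>\<zeta>\<in>proximal_subdifferential B x. \<zeta> \<noteq> 0) \<and>
            0 < Inf {ereal (inner \<zeta> (- \<eta>) / norm \<zeta>) | x \<eta> \<zeta>.
                       x \<in> U \<and> \<eta> \<in> F x \<and> \<zeta> \<in> proximal_subdifferential B x}))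
     \<or> (usc_fun B \<and> locally_lipschitz_setmap F \<and> closure K \<inter> Xu = {} \<and>
         (\<exists>U. open U \<and> frontier K \<subseteq> U \<and>
            (\<forall>x\<in>U. \<forall>\<zeta>\<in>proximal_subdifferential (\<lambda>y. - B y) x. \<zeta> \<noteq> 0) \<and>
            0 < Inf {ereal (inner \<zeta> \<eta> / norm \<zeta>) | x \<eta> \<zeta>.
                       x \<in> U \<and> \<eta> \<in> F x \<and> \<zeta> \<in> proximal_subdifferential (\<lambda>y. - B y) x}))"
  shows "uniformly_robustly_safe F Xo Xu"
proof -
  note safeI = uniformly_robustly_safe_if_forward_invariant[OF B_candidate]
  \<comment> \<open>Shared by (4) and (5): it asks for a lower bound \<open>c\<close> of the
    quotients over Clarke gradients, which for a continuously differentiable \<open>B\<close>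
    contain nothing but \<open>grad B x\<close>.\<close>
  have clarke_case: "uniformly_robustly_safe F Xo Xu"
    if B: "locally_lipschitz_fun B" and nz: "\<And>x \<zeta>. x \<in> frontier K \<Longrightarrow> \<zeta> \<in> clarke_gradient \<Omega> B x \<Longrightarrow> \<zeta> \<noteq> 0"
      and c: "0 < c" and le: "\<And>x \<zeta> \<eta>. x \<in> frontier K \<Longrightarrow> \<zeta> \<in> clarke_gradient \<Omega> B x \<Longrightarrow> \<eta> \<in> F x \<Longrightarrow>
        c \<le> inner \<zeta> (- \<eta>) / norm \<zeta>" for c
  proof (rule safeI[OF half_gt_zero[OF c]])
    show "forward_invariant (perturbed F (\<lambda>_. c / 2)) {x. B x \<le> 0}"
    proof (rule clarke_forward_invariant[OF B F_usc _ _ \<Omega>_null c])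
      fix x \<zeta> \<eta> assume a: "x \<in> frontier {x. B x \<le> 0}" "\<zeta> \<in> clarke_gradient \<Omega> B x" "\<eta> \<in> F x"
      then have "\<zeta> \<noteq> 0" "c \<le> inner \<zeta> (- \<eta>) / norm \<zeta>" using nz le by (simp_all add: K_eq)
      then show "inner \<zeta> \<eta> \<le> - c * norm \<zeta>" by (simp add: field_simps)
    qed (use F_values nz in \<open>auto simp: K_eq\<close>)
  qed
  from conditions show ?thesis
  proof (elim disjE conjE exE)
    fix c :: real assume "0 < c" "forward_invariant (perturbed F (\<lambda>_. c)) K"
    then show ?thesis using safeI by (simp add: K_eq)
  next
    fix \<epsilon> assume "bounded (frontier K)" "continuous_on UNIV \<epsilon>" "\<forall>x. 0 < \<epsilon> x"
      "forward_invariant (perturbed F \<epsilon>) K"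
    then obtain c where "0 < c" "forward_invariant (perturbed F (\<lambda>_. c)) K"
      using uniform_forward_invariant_of_bounded_frontier[of K \<epsilon> F] by metis
    then show ?thesis using safeI by (simp add: K_eq)
  next
    have "Xo \<inter> Xu = {}" using B_candidate unfolding barrier_candidate_def by fastforce
    moreover assume "robustly_safe F Xo Xu" "bounded (- Xu)"
    ultimately show ?thesis by (intro uniformly_robustly_safeI_bounded) auto
  next
    have "Xo \<inter> Xu = {}" using B_candidate unfolding barrier_candidate_def by fastforce
    moreover assume "robustly_safe F Xo Xu" "bounded (- Xo)"
    ultimately show ?thesis by (intro uniformly_robustly_safeI_bounded) auto
  next
    assume B: "continuously_differentiable B" and nz: "\<forall>x\<in>frontier K. grad B x \<noteq> 0"
      and "0 < Inf {ereal (inner (grad B x) (- \<eta>) / norm (grad B x)) | x \<eta>. x \<in> frontier K \<and> \<eta> \<in> F x}"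
    then obtain c where c: "0 < c" "\<And>x \<eta>. x \<in> frontier K \<Longrightarrow> \<eta> \<in> F x \<Longrightarrow>
        c \<le> inner (grad B x) (- \<eta>) / norm (grad B x)"
      by (elim positive_Inf_ereal_lower_bound) blast
    have eq: "\<zeta> = grad B x" if "\<zeta> \<in> clarke_gradient \<Omega> B x" for \<zeta> x
      using clarke_gradient_continuously_differentiable[OF B] that by blast
    show ?thesis
    proof (rule clarke_case[OF continuously_differentiable_locally_lipschitz[OF B] _ c(1)])
      fix x \<zeta> assume "x \<in> frontier K" "\<zeta> \<in> clarke_gradient \<Omega> B x"
      then show "\<zeta> \<noteq> 0" using eq[of \<zeta> x] nz by auto
    next
      fix x \<zeta> \<eta> assume "x \<in> frontier K" "\<zeta> \<in> clarke_gradient \<Omega> B x" "\<eta> \<in> F x"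
      then show "c \<le> inner \<zeta> (- \<eta>) / norm \<zeta>" using eq[of \<zeta> x] c(2)[of x \<eta>] by simp
    qed
  next
    assume B: "locally_lipschitz_fun B" and nz: "\<forall>x\<in>frontier K. \<forall>\<zeta>\<in>clarke_gradient \<Omega> B x. \<zeta> \<noteq> 0"
      and "0 < Inf {ereal (inner \<zeta> (- \<eta>) / norm \<zeta>) | x \<eta> \<zeta>.
             x \<in> frontier K \<and> \<eta> \<in> F x \<and> \<zeta> \<in> clarke_gradient \<Omega> B x}"
    then obtain c where c: "0 < c" "\<And>x \<eta> \<zeta>. x \<in> frontier K \<Longrightarrow> \<eta> \<in> F x \<Longrightarrow> \<zeta> \<in> clarke_gradient \<Omega> B x \<Longrightarrow>
        c \<le> inner \<zeta> (- \<eta>) / norm \<zeta>"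
      by (elim positive_Inf_ereal_lower_bound) blast
    show ?thesis by (rule clarke_case[OF B _ c(1)]) (use nz c(2) in auto)
  next
    fix U assume B: "lsc_fun B" and F: "locally_lipschitz_setmap F" and U: "open U" "frontier K \<subseteq> U"
      and nz: "\<forall>x\<in>U. \<forall>\<zeta>\<in>proximal_subdifferential B x. \<zeta> \<noteq> 0"
      and "0 < Inf {ereal (inner \<zeta> (- \<eta>) / norm \<zeta>) | x \<eta> \<zeta>.
             x \<in> U \<and> \<eta> \<in> F x \<and> \<zeta> \<in> proximal_subdifferential B x}"
    then obtain c where c: "0 < c" "\<And>x \<eta> \<zeta>. x \<in> U \<Longrightarrow> \<eta> \<in> F x \<Longrightarrow> \<zeta> \<in> proximal_subdifferential B x \<Longrightarrow>
        c \<le> inner \<zeta> (- \<eta>) / norm \<zeta>"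
      by (elim positive_Inf_ereal_lower_bound) blast
    show ?thesis
    proof (rule safeI[OF half_gt_zero[OF c(1)]],
        rule proximal_forward_invariant_lsc[OF B F U(1) U(2)[unfolded K_eq] c(1)])
      fix x \<zeta> \<eta> assume "x \<in> U" "\<zeta> \<in> proximal_subdifferential B x" "\<eta> \<in> F x"
      with c(2)[of x \<eta> \<zeta>] nz have "\<zeta> \<noteq> 0" "c \<le> inner \<zeta> (- \<eta>) / norm \<zeta>" by auto
      then show "inner \<zeta> \<eta> \<le> - c * norm \<zeta>" by (simp add: field_simps)
    qed
  next
    fix U assume B: "usc_fun B" and F: "locally_lipschitz_setmap F" and U: "open U" "frontier K \<subseteq> U"
      and nz: "\<forall>x\<in>U. \<forall>\<zeta>\<in>proximal_subdifferential (\<lambda>y. - B y) x. \<zeta> \<noteq> 0"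
      and "0 < Inf {ereal (inner \<zeta> \<eta> / norm \<zeta>) | x \<eta> \<zeta>.
             x \<in> U \<and> \<eta> \<in> F x \<and> \<zeta> \<in> proximal_subdifferential (\<lambda>y. - B y) x}"
    then obtain c where c: "0 < c" "\<And>x \<eta> \<zeta>. x \<in> U \<Longrightarrow> \<eta> \<in> F x \<Longrightarrow>
        \<zeta> \<in> proximal_subdifferential (\<lambda>y. - B y) x \<Longrightarrow> c \<le> inner \<zeta> \<eta> / norm \<zeta>"
      by (elim positive_Inf_ereal_lower_bound) blast
    have lsc: "lsc_fun (\<lambda>x. - B x)"
      unfolding lsc_fun_def
    proof (intro allI impI)
      fix x a assume "a < - B x"
      then have "eventually (\<lambda>y. B y < - a) (nhds x)" using B unfolding usc_fun_def by simp
      then show "eventually (\<lambda>y. a < - B y) (nhds x)" by eventually_elim simp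
    qed
    show ?thesis
    proof (rule safeI[OF half_gt_zero[OF c(1)]],
        rule proximal_forward_invariant_usc[OF lsc F U(1) U(2)[unfolded K_eq] c(1)])
      fix x \<zeta> \<eta> assume "x \<in> U" "\<zeta> \<in> proximal_subdifferential (\<lambda>y. - B y) x" "\<eta> \<in> F x"
      with c(2)[of x \<eta> \<zeta>] nz have "\<zeta> \<noteq> 0" "c \<le> inner \<zeta> \<eta> / norm \<zeta>" by auto
      then show "c * norm \<zeta> \<le> inner \<zeta> \<eta>" by (simp add: field_simps)
    qed
  qed
qed

end
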